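(* Let $\{(X_i,d_i,\nu_i)\}_{i=1}^\infty$ be a sequence of compact measured length spaces with $\lim_{i\to\infty}(X_i,d_i,\nu_i)=(X,d,\nu_\infty)$ in the measured Gromov--Hausdorff topology. Let $\mathcal{F}$ be a family of continuous convex functions $U:[0,\infty)\to\mathbb{R}$ with $U(0)=0$. Given a function $\lambda:\mathcal{F}\to\mathbb{R}\cup\{-\infty\}$, suppose that each $(X_i,d_i,\nu_i)$ is weakly $\lambda$-displacement convex for the family $\mathcal{F}$. Then $(X,d,\nu_\infty)$ is weakly $\lambda$-displacement convex for the family $\mathcal{F}$.
   Context: A compact measured length space $(X,d,\nu)$ is a compact length space $(X,d)$ (the distance is the infimum of lengths of joining curves) with a Borel probability measure $\nu$. An $\epsilon$-Gromov--Hausdorff approximation $f:X_1\to X_2$ between compact metric spaces is a (not necessarily continuous, assumed Borel) map with $|d_2(f(x),f(x'))-d_1(x,x')|\le\epsilon$ for all $x,x'\in X_1$ and such that for every $x_2\in X_2$ there is $x_1\in X_1$ with $d_2(f(x_1),x_2)\le\epsilon$. $(X_i,d_i,\nu_i)\to(X,d,\nu_\infty)$ in the measured Gromov--Hausdorff topology means that there are Borel $\epsilon_i$-approximations $f_i:X_i\to X$ with $\epsilon_i\to0$ and $(f_i)_*\nu_i\to\nu_\infty$ in the weak-$*$ topology on Borel probability measures; here $(X,d)$ is a compact metric space with Borel probability measure $\nu_\infty$ (the limit is then automatically a length space). $P_2(X)$ is the set of Borel probability measures on $X$ with the quadratic Wasserstein metric $W_2(\mu_0,\mu_1)^2=\inf_\pi\int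 d(x_0,x_1)^2\,d\pi$ ($\pi$ ranging over couplings of $\mu_0,\mu_1$). A Wasserstein geodesic $\{\mu_t\}_{t\in[0,1]}$ is a minimizing geodesic of $P_2(X)$, parametrized so that $W_2(\mu_t,\mu_s)=|t-s|W_2(\mu_0,\mu_1)$. $U'(\infty)=\lim_{r\to\infty}U(r)/r$ and $U_\nu(\mu)=\int_X U(\rho)\,d\nu+U'(\infty)\mu_s(X)\in\mathbb{R}\cup\{\infty\}$, where $\mu=\rho\nu+\mu_s$ is the Lebesgue decomposition of $\mu$ with respect to $\nu$ (convention $\infty\cdot0=0$). $(X,d,\nu)$ is weakly $\lambda$-displacement convex for the family $\mathcal{F}$ if for any $\mu_0,\mu_1\in P_2(X)$ with supports contained in $\mathrm{supp}(\nu)$, one can find a Wasserstein geodesic $\{\mu_t\}_{t\in[0,1]}$ from $\mu_0$ to $\mu_1$ so that for each $U\in\mathcal{F}$ and all $t\in[0,1]$: $U_\nu(\mu_t)\le tU_\nu(\mu_1)+(1-t)U_\nu(\mu_0)-\frac12\lambda(U)t(1-t)W_2(\mu_0,\mu_1)^2$. *)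

theory Defs
  imports "HOL-Probability.Probability"
begin

section \<open>Borel measures on metric spaces\<close>

definition borel_of :: "'a metric \<Rightarrow> 'a measure" where
  "borel_of X = sigma (mspace X) {U. openin (mtopology_of X) U}"

text \<open>
  Borel probability measures. All spaces considered are compact, so the finiteness of second
  moments that is part of the usual definition of \<open>P\<^sub>2(X)\<close> is automatic.
\<close>

definition P2 :: "'a metric \<Rightarrow> 'a measure set" where
  "P2 X = {\<mu>. prob_space \<mu> \<and> sets \<mu> = sets (borel_of X)}"

definition measure_supp :: "'a metric \<Rightarrow> 'a measure \<Rightarrow> 'a set" where
  "measure_supp X \<mu> =
     {x \<in> mspace X. \<forall>U. openin (mtopology_of X) U \<and> x \<in> U \<longrightarrow> emeasure \<mu> U > 0}"

text \<open>Test functions need not be assumed bounded, since the spaces considered are compact.\<close>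

definition weak_star_conv :: "'a metric \<Rightarrow> (nat \<Rightarrow> 'a measure) \<Rightarrow> 'a measure \<Rightarrow> bool" where
  "weak_star_conv X \<mu>s \<mu> \<longleftrightarrow>
     (\<forall>g. continuous_map (mtopology_of X) euclideanreal g \<longrightarrow>
        (\<lambda>n. \<integral>x. g x \<partial>\<mu>s n) \<longlonglongrightarrow> (\<integral>x. g x \<partial>\<mu>))"

section \<open>Compact measured length spaces and measured Gromov--Hausdorff convergence\<close>

definition curve_length :: "'a metric \<Rightarrow> (real \<Rightarrow> 'a) \<Rightarrow> ennreal" where
  "curve_length X \<gamma> =
     (SUP (n, t) \<in> {(n :: nat, t :: nat \<Rightarrow> real). t 0 = 0 \<and> t n = 1 \<and> mono_on {..n} t}.
        \<Sum>k<n. ennreal (mdist X (\<gamma> (t k)) (\<gamma> (t (Suc k)))))"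

text \<open>The infimum of the empty set is \<open>\<infinity>\<close>, so a length space is path connected.\<close>

definition length_space :: "'a metric \<Rightarrow> bool" where
  "length_space X \<longleftrightarrow>
     (\<forall>x \<in> mspace X. \<forall>y \<in> mspace X.
        ennreal (mdist X x y) =
          (INF \<gamma> \<in> {\<gamma>. pathin (mtopology_of X) \<gamma> \<and> \<gamma> 0 = x \<and> \<gamma> 1 = y}. curve_length X \<gamma>))"

definition compact_measured_metric_space :: "'a metric \<Rightarrow> 'a measure \<Rightarrow> bool" where
  "compact_measured_metric_space X \<nu> \<longleftrightarrow> compact_space (mtopology_of X) \<and> \<nu> \<in> P2 X"

definition compact_measured_length_space :: "'a metric \<Rightarrow> 'a measure \<Rightarrow> bool" where
  "compact_measured_length_space X \<nu> \<longleftrightarrow>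
     compact_measured_metric_space X \<nu> \<and> length_space X"

definition GH_approximation :: "real \<Rightarrow> 'a metric \<Rightarrow> 'b metric \<Rightarrow> ('a \<Rightarrow> 'b) \<Rightarrow> bool" where
  "GH_approximation \<epsilon> X1 X2 f \<longleftrightarrow>
     f \<in> measurable (borel_of X1) (borel_of X2) \<and>
     (\<forall>x \<in> mspace X1. \<forall>x' \<in> mspace X1. \<bar>mdist X2 (f x) (f x') - mdist X1 x x'\<bar> \<le> \<epsilon>) \<and>
     (\<forall>x2 \<in> mspace X2. \<exists>x1 \<in> mspace X1. mdist X2 (f x1) x2 \<le> \<epsilon>)"

text \<open>
  The spaces of the sequence have arbitrary carriers inside one type, which is no restriction
  (a sequence of spaces embeds in its disjoint union); the limit may live in another type.
\<close>

definition measured_GH_conv ::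
    "(nat \<Rightarrow> 'a metric) \<Rightarrow> (nat \<Rightarrow> 'a measure) \<Rightarrow> 'b metric \<Rightarrow> 'b measure \<Rightarrow> bool" where
  "measured_GH_conv Xs \<nu>s X \<nu> \<longleftrightarrow>
     (\<exists>(\<epsilon> :: nat \<Rightarrow> real) f.
        (\<forall>i. GH_approximation (\<epsilon> i) (Xs i) X (f i)) \<and>
        \<epsilon> \<longlonglongrightarrow> 0 \<and>
        weak_star_conv X (\<lambda>i. distr (\<nu>s i) (borel_of X) (f i)) \<nu>)"

section \<open>Wasserstein distance and Wasserstein geodesics\<close>

text \<open>
  Compact metric spaces are separable, so the product sigma-algebra below is the Borel
  sigma-algebra of the product space.
\<close>

definition couplings :: "'a metric \<Rightarrow> 'a measure \<Rightarrow> 'a measure \<Rightarrow> ('a \<times> 'a) measure set" where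
  "couplings X \<mu>0 \<mu>1 =
     {\<pi>. sets \<pi> = sets (borel_of X \<Otimes>\<^sub>M borel_of X) \<and>
         distr \<pi> (borel_of X) fst = \<mu>0 \<and> distr \<pi> (borel_of X) snd = \<mu>1}"

text \<open>
  For compact \<open>X\<close> the integrand is bounded and the set of couplings is nonempty, so the
  real-valued integral and infimum have their intended meaning.
\<close>

definition W2 :: "'a metric \<Rightarrow> 'a measure \<Rightarrow> 'a measure \<Rightarrow> real" where
  "W2 X \<mu>0 \<mu>1 = sqrt (INF \<pi> \<in> couplings X \<mu>0 \<mu>1. \<integral>(x0, x1). (mdist X x0 x1)\<^sup>2 \<partial>\<pi>)"

definition wasserstein_geodesic ::
    "'a metric \<Rightarrow> 'a measure \<Rightarrow> 'a measure \<Rightarrow> (real \<Rightarrow> 'a measure) \<Rightarrow> bool" where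
  "wasserstein_geodesic X \<mu>0 \<mu>1 \<mu> \<longleftrightarrow>
     \<mu> 0 = \<mu>0 \<and> \<mu> 1 = \<mu>1 \<and> (\<forall>t \<in> {0..1}. \<mu> t \<in> P2 X) \<and>
     (\<forall>t \<in> {0..1}. \<forall>s \<in> {0..1}. W2 X (\<mu> t) (\<mu> s) = \<bar>t - s\<bar> * W2 X \<mu>0 \<mu>1)"

section \<open>The functionals and displacement convexity\<close>

text \<open>
  Functions \<open>U : [0,\<infinity>) \<rightarrow> \<real>\<close> are represented by total functions on the reals; only their
  values on \<open>[0,\<infinity>)\<close> are ever used.
\<close>

definition slope_at_infinity :: "(real \<Rightarrow> real) \<Rightarrow> ereal" where
  "slope_at_infinity U = Lim at_top (\<lambda>r. ereal (U r / r))"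

text \<open>\<open>\<mu> = \<rho> \<nu> + \<mu>s\<close> with \<open>\<mu>s\<close> singular with respect to \<open>\<nu>\<close>.\<close>

definition lebesgue_decomposition ::
    "'a measure \<Rightarrow> 'a measure \<Rightarrow> ('a \<Rightarrow> real) \<Rightarrow> 'a measure \<Rightarrow> bool" where
  "lebesgue_decomposition \<nu> \<mu> \<rho> \<mu>s \<longleftrightarrow>
     \<rho> \<in> borel_measurable \<nu> \<and> (\<forall>x \<in> space \<nu>. 0 \<le> \<rho> x) \<and> sets \<mu>s = sets \<nu> \<and>
     (\<forall>A \<in> sets \<nu>. emeasure \<mu> A = emeasure (density \<nu> (\<lambda>x. ennreal (\<rho> x))) A + emeasure \<mu>s A) \<and>
     (\<exists>N \<in> null_sets \<nu>. emeasure \<mu>s (space \<nu> - N) = 0)"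

text \<open>
  Integral with values in the extended reals: positive part minus negative part. For
  \<open>f = U \<circ> \<rho>\<close> the negative part is integrable, since \<open>U\<close> is bounded below by a linear function,
  so the difference is never \<open>\<infinity> - \<infinity>\<close>.
\<close>

definition ext_integral :: "'a measure \<Rightarrow> ('a \<Rightarrow> real) \<Rightarrow> ereal" where
  "ext_integral \<nu> f =
     enn2ereal (\<integral>\<^sup>+x. ennreal (f x) \<partial>\<nu>) - enn2ereal (\<integral>\<^sup>+x. ennreal (- f x) \<partial>\<nu>)"

text \<open>
  The Lebesgue decomposition is unique (the density up to null sets), so the value does not
  depend on the chosen one. Multiplication of extended reals satisfies \<open>\<infinity> * 0 = 0\<close>.
\<close>

definition U_functional :: "(real \<Rightarrow> real) \<Rightarrow> 'a measure \<Rightarrow> 'a measure \<Rightarrow> ereal" where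
  "U_functional U \<nu> \<mu> =
     (let (\<rho>, \<mu>s) = (SOME (\<rho>, \<mu>s). lebesgue_decomposition \<nu> \<mu> \<rho> \<mu>s)
      in ext_integral \<nu> (\<lambda>x. U (\<rho> x)) + slope_at_infinity U * enn2ereal (emeasure \<mu>s (space \<mu>s)))"

text \<open>
  In the inequality the right-hand side never has the form \<open>\<infinity> - \<infinity>\<close>: the functionals do not take
  the value \<open>-\<infinity>\<close>, and \<open>\<lambda> U\<close> is assumed not to be \<open>\<infinity>\<close>.
\<close>

definition weakly_displacement_convex ::
    "'a metric \<Rightarrow> 'a measure \<Rightarrow> (real \<Rightarrow> real) set \<Rightarrow> ((real \<Rightarrow> real) \<Rightarrow> ereal) \<Rightarrow> bool" where
  "weakly_displacement_convex X \<nu> F lam \<longleftrightarrow>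
     (\<forall>\<mu>0 \<in> P2 X. \<forall>\<mu>1 \<in> P2 X.
        measure_supp X \<mu>0 \<subseteq> measure_supp X \<nu> \<and> measure_supp X \<mu>1 \<subseteq> measure_supp X \<nu> \<longrightarrow>
        (\<exists>\<mu>. wasserstein_geodesic X \<mu>0 \<mu>1 \<mu> \<and>
           (\<forall>U \<in> F. \<forall>t \<in> {0..1}.
              U_functional U \<nu> (\<mu> t) \<le>
                ereal t * U_functional U \<nu> \<mu>1 + ereal (1 - t) * U_functional U \<nu> \<mu>0
                - ereal (1 / 2) * lam U * ereal (t * (1 - t)) * ereal ((W2 X \<mu>0 \<mu>1)\<^sup>2))))"

end

theory Submission
  imports Defs
begin

text \<open>
  For a convex \<open>U\<close> the functional \<open>U\<^sub>\<nu>(\<mu>)\<close> is the supremum of \<open>\<integral>a d\<mu> - \<integral>b d\<nu>\<close> over pairs of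
  continuous functions such that \<open>r \<mapsto> a(x) r - b(x)\<close> is below \<open>U\<close> for every \<open>x\<close>. Each of these
  expressions is linear in \<open>\<mu>\<close> and \<open>\<nu>\<close> and can be pulled back along the approximations, so \<open>U\<^sub>\<nu>(\<mu>)\<close>
  is jointly lower semicontinuous.

  Given \<open>\<mu>\<^sub>0, \<mu>\<^sub>1\<close> on the limit space, choose a fine continuous partition of unity \<open>\<phi>\<^sub>j\<close>, distribute the
  masses \<open>\<integral>\<phi>\<^sub>j d\<mu>\<close> over \<open>X\<^sub>i\<close> proportionally to \<open>(\<phi>\<^sub>j \<circ> f\<^sub>i) \<nu>\<^sub>i\<close>, and join the two resulting measures by
  a geodesic on which the displacement inequality holds. By Jensen's inequality the values of the
  functionals at the endpoints do not increase, up to an error that is uniform enough to serve all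
  \<open>U\<close> at once. The images of the geodesics under \<open>f\<^sub>i\<close> subconverge weakly to a geodesic of \<open>P\<^sub>2(X)\<close>,
  and semicontinuity gives the inequality in the limit.
\<close>

section \<open>Borel measures and continuous functions on a compact metric space\<close>

text \<open>The approximations are Borel without inverses, so a measure reaches \<open>X_i\<close>
  only through finitely many cell masses, and functions pulled back along \<open>f_i\<close> are
  measurable but not continuous. Hence the bound from below by minorant pairs is proved for bounded
  Borel pairs, while near-equality is reached by continuous ones. The cell masses n' in
  \<open>X_i\<close> only converge to the masses n in \<open>X\<close>, and for rapidly growing U
  the value at r n / n' is not controlled by the value at r. Therefore \<theta> \<mu> + (1 -
  \<theta>) \<nu> is transplanted in place of \<mu>, with \<theta> tending to 1. This costs at most
  (1 - \<theta>) B, where B is a nonnegative bound of U on [0, 2]. The support condition ensures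
  that \<mu> charges no cell of \<nu>-mass zero. Couplings are replaced by their matrices relative
  to a partition of unity, which makes gluing and limits of couplings finite-dimensional. As
  \<lambda>(U) may have either sign, the distances of the transplanted endpoints must converge; an
  upper bound is not enough.\<close>

abbreviation contr :: "'a metric \<Rightarrow> ('a \<Rightarrow> real) \<Rightarrow> bool" where
  "contr X g \<equiv> continuous_map (mtopology_of X) euclideanreal g"

lemma space_borel_of [simp]: "space (borel_of X) = mspace X"
  by (simp add: borel_of_def space_measure_of_conv)

lemma openin_sets_borel_of: "openin (mtopology_of X) U \<Longrightarrow> U \<in> sets (borel_of X)"
  unfolding borel_of_def using openin_subset by (fastforce simp: sets_measure_of_conv)

lemma closedin_sets_borel_of:
  assumes "closedin (mtopology_of X) K" shows "K \<in> sets (borel_of X)"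
proof -
  have "K = space (borel_of X) - (mspace X - K)"
    using closedin_subset[OF assms] by auto
  then show ?thesis
    using openin_sets_borel_of[of X "mspace X - K"] assms
    by (metis closedin_def sets.compl_sets topspace_mtopology_of)
qed

lemma cont_measurable:
  assumes "contr X g" shows "g \<in> borel_measurable (borel_of X)"
proof (rule borel_measurableI)
  fix S :: "real set" assume "open S"
  then have "openin (mtopology_of X) {x \<in> topspace (mtopology_of X). g x \<in> S}"
    using assms by (intro openin_continuous_map_preimage) auto
  moreover have "{x \<in> topspace (mtopology_of X). g x \<in> S} = g -` S \<inter> space (borel_of X)"
    by auto
  ultimately show "g -` S \<inter> space (borel_of X) \<in> sets (borel_of X)"
    by (simp add: openin_sets_borel_of)
qed

lemma P2_D:
  assumes "\<mu> \<in> P2 X"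
  shows "prob_space \<mu>" "sets \<mu> = sets (borel_of X)" "space \<mu> = mspace X"
  using assms sets_eq_imp_space_eq[of \<mu> "borel_of X"] by (auto simp: P2_def)

lemma cont_measurable_P2:
  assumes "\<mu> \<in> P2 X" "contr X g" shows "g \<in> borel_measurable \<mu>"
  using cont_measurable[OF assms(2)] measurable_cong_sets[OF P2_D(2)[OF assms(1)] refl] by auto

lemma cont_mdist: "a \<in> mspace X \<Longrightarrow> contr X (\<lambda>x. mdist X x a)"
  by (intro continuous_map_mdist) auto

lemma cont_bounded:
  assumes "compact_space (mtopology_of X)" "contr X g"
  obtains B where "B \<ge> 0" "\<And>x. x \<in> mspace X \<Longrightarrow> \<bar>g x\<bar> \<le> B"
proof -
  have "compactin euclideanreal (g ` topspace (mtopology_of X))"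
    using assms image_compactin compact_space_def by blast
  then have "bounded (g ` mspace X)"
    by (simp add: compact_imp_bounded)
  then obtain B where "\<And>x. x \<in> mspace X \<Longrightarrow> \<bar>g x\<bar> \<le> B"
    unfolding bounded_iff by auto
  then have "\<And>x. x \<in> mspace X \<Longrightarrow> \<bar>g x\<bar> \<le> max B 0"
    by fastforce
  then show ?thesis using that[of "max B 0"] by auto
qed

lemma cont_uniformly:
  assumes "compact_space (mtopology_of X)" "contr X g" "e > 0"
  obtains d where "d > 0"
    "\<And>x y. x \<in> mspace X \<Longrightarrow> y \<in> mspace X \<Longrightarrow> mdist X x y < d \<Longrightarrow> \<bar>g x - g y\<bar> < e"
proof -
  have "uniformly_continuous_map X euclidean_metric g"
    using assms by (intro continuous_imp_uniformly_continuous_map) auto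
  then have "\<exists>d>0. \<forall>x\<in>mspace X. \<forall>y\<in>mspace X. mdist X y x < d \<longrightarrow> dist (g y) (g x) < e"
    unfolding uniformly_continuous_map_def using \<open>e > 0\<close> by auto
  then show ?thesis using that unfolding dist_real_def by blast
qed

lemma mdist_bounded:
  assumes "compact_space (mtopology_of X)"
  obtains D where "D \<ge> 0" "\<And>x y. x \<in> mspace X \<Longrightarrow> y \<in> mspace X \<Longrightarrow> mdist X x y \<le> D"
proof (cases "mspace X = {}")
  case True
  then show ?thesis using that[of 0] by auto
next
  case False
  then obtain a where a: "a \<in> mspace X" by auto
  obtain B where B: "B \<ge> 0" "\<And>x. x \<in> mspace X \<Longrightarrow> \<bar>mdist X x a\<bar> \<le> B"
    using cont_bounded[OF assms cont_mdist[OF a]] by blast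
  have "mdist X x y \<le> 2 * B" if "x \<in> mspace X" "y \<in> mspace X" for x y
    using mdist_triangle[of x X a y] B(2)[OF that(1)] B(2)[OF that(2)] that a
    by (simp add: mdist_commute)
  then show ?thesis using that[of "2 * B"] B by auto
qed

lemma P2_integrable_bounded:
  assumes "\<mu> \<in> P2 X" "g \<in> borel_measurable (borel_of X)" "\<And>x. x \<in> mspace X \<Longrightarrow> \<bar>g x\<bar> \<le> (B::real)"
  shows "integrable \<mu> g"
proof -
  interpret prob_space \<mu> by (rule P2_D(1)[OF assms(1)])
  have "g \<in> borel_measurable \<mu>"
    using assms(2) by (simp add: measurable_cong_sets[OF P2_D(2)[OF assms(1)] refl])
  then show ?thesis
    using assms(3) P2_D(3)[OF assms(1)] by (intro integrable_const_bound[where B=B]) auto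
qed

lemma cont_integrable:
  assumes "compact_space (mtopology_of X)" "\<mu> \<in> P2 X" "contr X g"
  shows "integrable \<mu> g"
  using cont_bounded[OF assms(1,3)] P2_integrable_bounded[OF assms(2) cont_measurable[OF assms(3)]]
  by metis

section \<open>Partitions of unity\<close>

text \<open>The functions are indexed by the centres of the balls that carry them.\<close>

definition fine_partition :: "'a metric \<Rightarrow> real \<Rightarrow> 'a set \<Rightarrow> ('a \<Rightarrow> 'a \<Rightarrow> real) \<Rightarrow> bool" where
  "fine_partition X \<delta> J \<phi> \<longleftrightarrow> finite J \<and> J \<subseteq> mspace X \<and> (\<forall>j\<in>J. contr X (\<phi> j)) \<and>
     (\<forall>j\<in>J. \<forall>x\<in>mspace X. 0 \<le> \<phi> j x \<and> (\<phi> j x \<noteq> 0 \<longrightarrow> mdist X x j \<le> \<delta>)) \<and>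
     (\<forall>x\<in>mspace X. (\<Sum>j\<in>J. \<phi> j x) = 1)"

lemma fine_partition_D:
  assumes "fine_partition X \<delta> J \<phi>"
  shows "finite J" "J \<subseteq> mspace X" "\<And>j. j \<in> J \<Longrightarrow> contr X (\<phi> j)"
    "\<And>j x. j \<in> J \<Longrightarrow> x \<in> mspace X \<Longrightarrow> 0 \<le> \<phi> j x"
    "\<And>j x. j \<in> J \<Longrightarrow> x \<in> mspace X \<Longrightarrow> \<phi> j x \<le> 1"
    "\<And>j x. j \<in> J \<Longrightarrow> x \<in> mspace X \<Longrightarrow> \<phi> j x \<noteq> 0 \<Longrightarrow> mdist X x j \<le> \<delta>"
    "\<And>x. x \<in> mspace X \<Longrightarrow> (\<Sum>j\<in>J. \<phi> j x) = 1"
proof -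
  show *: "finite J" "J \<subseteq> mspace X" "\<And>j. j \<in> J \<Longrightarrow> contr X (\<phi> j)"
    "\<And>j x. j \<in> J \<Longrightarrow> x \<in> mspace X \<Longrightarrow> 0 \<le> \<phi> j x"
    "\<And>j x. j \<in> J \<Longrightarrow> x \<in> mspace X \<Longrightarrow> \<phi> j x \<noteq> 0 \<Longrightarrow> mdist X x j \<le> \<delta>"
    "\<And>x. x \<in> mspace X \<Longrightarrow> (\<Sum>j\<in>J. \<phi> j x) = 1"
    using assms by (auto simp: fine_partition_def)
  fix j x assume "j \<in> J" "x \<in> mspace X"
  then show "\<phi> j x \<le> 1"
    using member_le_sum[of j J "\<lambda>j. \<phi> j x"] * by auto
qed

text \<open>Tent functions over a finite \<delta>-net are divided by their sum, which is positive
  because the open balls of radius \<delta> cover the space.\<close>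

lemma fine_partition_exists:
  assumes "compact_space (mtopology_of X)" "\<delta> > 0"
  obtains J \<phi> where "fine_partition X \<delta> J \<phi>"
proof -
  interpret Metric_space "mspace X" "mdist X" by simp
  have "mtotally_bounded (mspace X)"
    using assms by (simp add: mtopology_of_def compact_space_eq_mcomplete_mtotally_bounded)
  then have "\<exists>J. finite J \<and> J \<subseteq> mspace X \<and> mspace X \<subseteq> (\<Union>x\<in>J. mball x \<delta>)"
    using \<open>\<delta> > 0\<close> unfolding mtotally_bounded_def by simp
  then obtain J where J: "finite J" "J \<subseteq> mspace X" "mspace X \<subseteq> (\<Union>x\<in>J. mball x \<delta>)"
    by (elim exE conjE)
  define \<psi> where "\<psi> j x = max 0 (\<delta> - mdist X x j)" for j x
  have pos: "(\<Sum>j\<in>J. \<psi> j x) > 0" if x: "x \<in> mspace X" for x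
  proof -
    obtain j where "j \<in> J" "mdist X j x < \<delta>"
      using subsetD[OF J(3) x] by auto
    then have "\<psi> j x > 0" by (simp add: \<psi>_def mdist_commute)
    then show ?thesis
      using J \<open>j \<in> J\<close> by (intro sum_pos2[of J j]) (auto simp: \<psi>_def)
  qed
  have "contr X (\<lambda>x. \<psi> j x / (\<Sum>i\<in>J. \<psi> i x))" if "j \<in> J" for j
    using J that pos unfolding \<psi>_def
    by (intro continuous_map_real_divide continuous_map_sum continuous_map_real_max
        continuous_map_diff cont_mdist) (auto simp: \<psi>_def less_imp_neq[THEN not_sym])
  moreover have "\<psi> j x / (\<Sum>i\<in>J. \<psi> i x) \<ge> 0" if "x \<in> mspace X" for j x
    using pos[OF that] by (simp add: \<psi>_def)
  moreover have "mdist X x j \<le> \<delta>" if "\<psi> j x / (\<Sum>i\<in>J. \<psi> i x) \<noteq> 0" for j x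
    using that by (auto simp: \<psi>_def max_def split: if_splits)
  moreover have "(\<Sum>j\<in>J. \<psi> j x / (\<Sum>i\<in>J. \<psi> i x)) = 1" if "x \<in> mspace X" for x
    using pos[OF that] by (simp flip: sum_divide_distrib)
  ultimately have "fine_partition X \<delta> J (\<lambda>j x. \<psi> j x / (\<Sum>i\<in>J. \<psi> i x))"
    using J unfolding fine_partition_def by blast
  then show ?thesis using that by blast
qed

lemma fine_partition_sum_integral:
  assumes "compact_space (mtopology_of X)" "fine_partition X \<delta> J \<phi>" "\<mu> \<in> P2 X" "contr X g"
  shows "(\<Sum>j\<in>J. \<integral>x. \<phi> j x * g x \<partial>\<mu>) = (\<integral>x. g x \<partial>\<mu>)"
proof -
  have "(\<Sum>j\<in>J. \<integral>x. \<phi> j x * g x \<partial>\<mu>) = (\<integral>x. (\<Sum>j\<in>J. \<phi> j x * g x) \<partial>\<mu>)"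
    using assms fine_partition_D[OF assms(2)]
    by (intro Bochner_Integration.integral_sum[symmetric] cont_integrable continuous_map_real_mult) auto
  also have "\<dots> = (\<integral>x. g x \<partial>\<mu>)"
    using fine_partition_D(7)[OF assms(2)] P2_D[OF assms(3)]
    by (intro Bochner_Integration.integral_cong) (auto simp flip: sum_distrib_right)
  finally show ?thesis .
qed

section \<open>Couplings\<close>

text \<open>Measurability refers to the product sigma-algebra, so continuity of the distance does
  not give it at once. The distance is a limit of finite sums of products of functions of one
  variable, built from partitions of unity of mesh 1/(n+1).\<close>

lemma mdist_measurable:
  assumes "compact_space (mtopology_of X)"
  shows "(\<lambda>(x, y). mdist X x y) \<in> borel_measurable (borel_of X \<Otimes>\<^sub>M borel_of X)"
proof -
  have "\<exists>J \<phi>. fine_partition X (1 / Suc n) J \<phi>" for n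
    using fine_partition_exists[OF assms, of "1 / Suc n"] by (metis of_nat_0_less_iff zero_less_Suc zero_less_divide_1_iff)
  then obtain J \<phi> where \<phi>: "\<And>n. fine_partition X (1 / Suc n) (J n) (\<phi> n)" by metis
  define e where "e n p = (\<Sum>j\<in>J n. \<Sum>l\<in>J n. \<phi> n j (fst p) * \<phi> n l (snd p) * mdist X j l)" for n p
  have [measurable]: "\<phi> n j \<in> borel_measurable (borel_of X)" if "j \<in> J n" for n j
    using fine_partition_D(3)[OF \<phi>] that by (intro cont_measurable) auto
  have m: "e n \<in> borel_measurable (borel_of X \<Otimes>\<^sub>M borel_of X)" for n
    unfolding e_def by (intro borel_measurable_sum borel_measurable_times borel_measurable_const) 
       (auto intro!: measurable_compose[OF measurable_fst] measurable_compose[OF measurable_snd])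
  \<comment> \<open>Replacing each of the two points by a centre within 1/(n+1) changes their
    distance by at most twice that, and the weights sum to one.\<close>
  have bd: "\<bar>e n (x, y) - mdist X x y\<bar> \<le> 2 / Suc n" if "x \<in> mspace X" "y \<in> mspace X" for x y n
  proof -
    note D = fine_partition_D[OF \<phi>[of n]]
    have s: "(\<Sum>j\<in>J n. \<Sum>l\<in>J n. \<phi> n j x * \<phi> n l y) = 1"
      using D(7)[OF that(1)] D(7)[OF that(2)] by (simp flip: sum_product)
    have "e n (x, y) - mdist X x y = (\<Sum>j\<in>J n. \<Sum>l\<in>J n. \<phi> n j x * \<phi> n l y * (mdist X j l - mdist X x y))"
      using s by (simp add: e_def right_diff_distrib sum_subtractf flip: sum_distrib_right)
    also have "\<bar>\<dots>\<bar> \<le> (\<Sum>j\<in>J n. \<Sum>l\<in>J n. \<bar>\<phi> n j x * \<phi> n l y * (mdist X j l - mdist X x y)\<bar>)"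
      by (rule order_trans[OF sum_abs]) (rule sum_mono, rule sum_abs)
    also have "\<dots> \<le> (\<Sum>j\<in>J n. \<Sum>l\<in>J n. \<phi> n j x * \<phi> n l y * (2 / Suc n))"
    proof (intro sum_mono)
      fix j l assume jl: "j \<in> J n" "l \<in> J n"
      then have jl': "j \<in> mspace X" "l \<in> mspace X" using D(2) by auto
      show "\<bar>\<phi> n j x * \<phi> n l y * (mdist X j l - mdist X x y)\<bar> \<le> \<phi> n j x * \<phi> n l y * (2 / Suc n)"
      proof (cases "\<phi> n j x = 0 \<or> \<phi> n l y = 0")
        case False
        then have "mdist X x j \<le> 1 / Suc n" "mdist X y l \<le> 1 / Suc n"
          using D(6) jl that by auto
        then have "\<bar>mdist X j l - mdist X x y\<bar> \<le> 2 / Suc n"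
          using mdist_triangle[of j X x l] mdist_triangle[of x X y l] mdist_triangle[of x X j y]
            mdist_triangle[of j X l y] that jl' by (simp add: mdist_commute abs_le_iff)
        moreover have "0 \<le> \<phi> n j x * \<phi> n l y" using D(4) jl that by simp
        ultimately show ?thesis
          unfolding abs_mult[of "\<phi> n j x * \<phi> n l y"] by (simp only: abs_of_nonneg) (rule mult_left_mono)
      qed auto
    qed
    also have "\<dots> = 2 / Suc n"
      using s by (simp flip: sum_distrib_right sum_divide_distrib)
    finally show ?thesis .
  qed
  show ?thesis
  proof (rule borel_measurable_LIMSEQ_real[OF _ m])
    fix p assume "p \<in> space (borel_of X \<Otimes>\<^sub>M borel_of X)"
    then obtain x y where p: "p = (x, y)" "x \<in> mspace X" "y \<in> mspace X"
      by (auto simp: space_pair_measure)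
    have "(\<lambda>n. 2 / real (Suc n)) \<longlonglongrightarrow> 0"
      by (rule LIMSEQ_Suc[OF lim_const_over_n])
    then have "(\<lambda>n. e n (x, y) - mdist X x y) \<longlonglongrightarrow> 0"
      by (rule Lim_null_comparison[rotated]) (simp only: real_norm_def bd[OF p(2,3)] eventually_True)
    then show "(\<lambda>n. e n p) \<longlonglongrightarrow> (case p of (x, y) \<Rightarrow> mdist X x y)"
      by (simp add: LIM_zero_iff p)
  qed
qed

lemma couplings_D:
  assumes "\<pi> \<in> couplings X \<mu>0 \<mu>1"
  shows "sets \<pi> = sets (borel_of X \<Otimes>\<^sub>M borel_of X)" "space \<pi> = mspace X \<times> mspace X"
    "distr \<pi> (borel_of X) fst = \<mu>0" "distr \<pi> (borel_of X) snd = \<mu>1"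
  using assms sets_eq_imp_space_eq[of \<pi> "borel_of X \<Otimes>\<^sub>M borel_of X"]
  by (auto simp: couplings_def space_pair_measure)

lemma couplings_measurable:
  assumes "\<pi> \<in> couplings X \<mu>0 \<mu>1"
  shows "measurable \<pi> N = measurable (borel_of X \<Otimes>\<^sub>M borel_of X) N"
  using couplings_D(1)[OF assms] by (rule measurable_cong_sets) simp

text \<open>The definition of \<open>couplings\<close> does not mention total mass; it is inherited
  from the first marginal.\<close>

lemma couplings_prob_space:
  assumes "\<pi> \<in> couplings X \<mu>0 \<mu>1" "\<mu>0 \<in> P2 X" shows "prob_space \<pi>"
proof -
  have "prob_space (distr \<pi> (borel_of X) fst)"
    using P2_D(1)[OF assms(2)] by (simp add: couplings_D(3)[OF assms(1)])
  then show ?thesis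
    by (rule prob_space_distrD[rotated]) (simp add: couplings_measurable[OF assms(1)])
qed

lemma couplings_nonempty:
  assumes "\<mu>0 \<in> P2 X" "\<mu>1 \<in> P2 X" shows "\<mu>0 \<Otimes>\<^sub>M \<mu>1 \<in> couplings X \<mu>0 \<mu>1"
proof -
  note m0 = P2_D[OF assms(1)] and m1 = P2_D[OF assms(2)]
  interpret a: prob_space \<mu>0 by (rule m0)
  interpret b: prob_space \<mu>1 by (rule m1)
  have s: "sets (\<mu>0 \<Otimes>\<^sub>M \<mu>1) = sets (borel_of X \<Otimes>\<^sub>M borel_of X)"
    using m0 m1 by (intro sets_pair_measure_cong)
  have "distr (\<mu>0 \<Otimes>\<^sub>M \<mu>1) (borel_of X) fst = distr (\<mu>0 \<Otimes>\<^sub>M \<mu>1) \<mu>0 fst"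
    by (intro distr_cong) (simp_all add: m0)
  then have "distr (\<mu>0 \<Otimes>\<^sub>M \<mu>1) (borel_of X) fst = \<mu>0"
    by (simp add: b.distr_pair_fst)
  moreover have "distr (\<mu>0 \<Otimes>\<^sub>M \<mu>1) (borel_of X) snd = \<mu>1"
  proof (rule measure_eqI)
    fix A assume A: "A \<in> sets (distr (\<mu>0 \<Otimes>\<^sub>M \<mu>1) (borel_of X) snd)"
    then have A': "A \<in> sets \<mu>1" by (simp add: m1)
    have "snd -` A \<inter> space (\<mu>0 \<Otimes>\<^sub>M \<mu>1) = space \<mu>0 \<times> A"
      using sets.sets_into_space[OF A'] by (auto simp: space_pair_measure)
    moreover have "snd \<in> measurable (\<mu>0 \<Otimes>\<^sub>M \<mu>1) (borel_of X)"
      unfolding measurable_cong_sets[OF refl m1(2)[symmetric]] by (rule measurable_snd)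
    ultimately show "emeasure (distr (\<mu>0 \<Otimes>\<^sub>M \<mu>1) (borel_of X) snd) A = emeasure \<mu>1 A"
      using A A' by (simp add: emeasure_distr b.emeasure_pair_measure_Times a.emeasure_space_1)
  qed (simp add: m1)
  ultimately show ?thesis using s by (auto simp: couplings_def)
qed

abbreviation cost :: "'a metric \<Rightarrow> ('a \<times> 'a) measure \<Rightarrow> real" where
  "cost X \<pi> \<equiv> \<integral>(x0, x1). (mdist X x0 x1)\<^sup>2 \<partial>\<pi>"

lemma cost_nonneg: "0 \<le> cost X \<pi>"
  by (auto intro!: Bochner_Integration.integral_nonneg)

lemma W2_squared_le:
  assumes "\<pi> \<in> couplings X \<mu>0 \<mu>1" shows "(W2 X \<mu>0 \<mu>1)\<^sup>2 \<le> cost X \<pi>"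
proof -
  have "0 \<le> (INF \<pi> \<in> couplings X \<mu>0 \<mu>1. cost X \<pi>)"
    using assms by (intro cINF_greatest cost_nonneg) auto
  moreover have "(INF \<pi> \<in> couplings X \<mu>0 \<mu>1. cost X \<pi>) \<le> cost X \<pi>"
    using assms by (intro cINF_lower bdd_belowI2[where m=0] cost_nonneg)
  ultimately show ?thesis by (simp add: W2_def)
qed

lemma W2_nonneg: "\<mu>0 \<in> P2 X \<Longrightarrow> \<mu>1 \<in> P2 X \<Longrightarrow> 0 \<le> W2 X \<mu>0 \<mu>1"
  unfolding W2_def real_sqrt_ge_0_iff
  by (intro cINF_greatest cost_nonneg) (use couplings_nonempty in auto)

lemma W2_squared_approx:
  assumes "\<mu>0 \<in> P2 X" "\<mu>1 \<in> P2 X" "e > 0"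
  obtains \<pi> where "\<pi> \<in> couplings X \<mu>0 \<mu>1" "cost X \<pi> < (W2 X \<mu>0 \<mu>1)\<^sup>2 + e"
proof -
  have ne: "couplings X \<mu>0 \<mu>1 \<noteq> {}" using couplings_nonempty assms by auto
  have "0 \<le> (INF \<pi> \<in> couplings X \<mu>0 \<mu>1. cost X \<pi>)"
    using ne by (intro cINF_greatest cost_nonneg) auto
  then have "(INF \<pi> \<in> couplings X \<mu>0 \<mu>1. cost X \<pi>) < (W2 X \<mu>0 \<mu>1)\<^sup>2 + e"
    using assms by (simp add: W2_def)
  then show ?thesis
    using that cINF_less_iff[OF ne bdd_belowI2[where m=0 and f="cost X"]] cost_nonneg by metis
qed

lemma cost_integrable:
  assumes "compact_space (mtopology_of X)" "\<pi> \<in> couplings X \<mu>0 \<mu>1" "\<mu>0 \<in> P2 X"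
  shows "integrable \<pi> (\<lambda>(x, y). (mdist X x y)\<^sup>2)"
proof -
  interpret prob_space \<pi> using couplings_prob_space assms by blast
  obtain D where D: "D \<ge> 0" "\<And>x y. x \<in> mspace X \<Longrightarrow> y \<in> mspace X \<Longrightarrow> mdist X x y \<le> D"
    using mdist_bounded[OF assms(1)] by blast
  have [measurable]: "(\<lambda>(x, y). mdist X x y) \<in> borel_measurable \<pi>"
    using mdist_measurable[OF assms(1)] by (simp add: couplings_measurable[OF assms(2)])
  have "(\<lambda>p. (case p of (x, y) \<Rightarrow> mdist X x y)\<^sup>2) \<in> borel_measurable \<pi>" by measurable
  then show ?thesis
    using D couplings_D[OF assms(2)]
    by (intro integrable_const_bound[where B="D\<^sup>2"]) (auto simp: case_prod_beta intro!: power_mono)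
qed

section \<open>Wasserstein distance through finite coupling matrices\<close>

text \<open>This turns a matrix into a coupling. Normalise the pieces \<alpha> j \<sigma> and
  \<beta> l \<tau> to probability measures and add their products with weights \<open>P j l\<close>:
  the marginals are the two mixtures, and the product with index (j, l) moves mass by at most
  \<open>C j l\<close>. It serves both to bound distances on one space, with \<sigma> and \<tau> the
  measures themselves, and to build measures on the approximating spaces.\<close>

lemma mixture_W2:
  fixes \<alpha> \<beta> :: "'i \<Rightarrow> 'a \<Rightarrow> real" and P C :: "'i \<Rightarrow> 'i \<Rightarrow> real"
  assumes X: "compact_space (mtopology_of X)" and \<sigma>: "\<sigma> \<in> P2 X" and \<tau>: "\<tau> \<in> P2 X" and J: "finite J"
    and \<alpha>: "\<And>j. j \<in> J \<Longrightarrow> \<alpha> j \<in> borel_measurable (borel_of X)"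
      "\<And>j x. j \<in> J \<Longrightarrow> x \<in> mspace X \<Longrightarrow> 0 \<le> \<alpha> j x" "\<And>j x. j \<in> J \<Longrightarrow> x \<in> mspace X \<Longrightarrow> \<alpha> j x \<le> 1"
    and \<beta>: "\<And>j. j \<in> J \<Longrightarrow> \<beta> j \<in> borel_measurable (borel_of X)"
      "\<And>j x. j \<in> J \<Longrightarrow> x \<in> mspace X \<Longrightarrow> 0 \<le> \<beta> j x" "\<And>j x. j \<in> J \<Longrightarrow> x \<in> mspace X \<Longrightarrow> \<beta> j x \<le> 1"
    and P: "\<And>j l. j \<in> J \<Longrightarrow> l \<in> J \<Longrightarrow> 0 \<le> P j l" "(\<Sum>j\<in>J. \<Sum>l\<in>J. P j l) = 1"
      "\<And>j l. j \<in> J \<Longrightarrow> l \<in> J \<Longrightarrow> (\<integral>x. \<alpha> j x \<partial>\<sigma>) = 0 \<Longrightarrow> P j l = 0"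
      "\<And>j l. j \<in> J \<Longrightarrow> l \<in> J \<Longrightarrow> (\<integral>x. \<beta> l x \<partial>\<tau>) = 0 \<Longrightarrow> P j l = 0"
    and C: "\<And>j l x y. j \<in> J \<Longrightarrow> l \<in> J \<Longrightarrow> x \<in> mspace X \<Longrightarrow> y \<in> mspace X \<Longrightarrow>
       \<alpha> j x \<noteq> 0 \<Longrightarrow> \<beta> l y \<noteq> 0 \<Longrightarrow> mdist X x y \<le> C j l"
    and \<mu>: "\<mu> = density \<sigma> (\<lambda>x. ennreal (\<Sum>j\<in>J. (\<Sum>l\<in>J. P j l) / (\<integral>x. \<alpha> j x \<partial>\<sigma>) * \<alpha> j x))"
    and \<mu>': "\<mu>' = density \<tau> (\<lambda>y. ennreal (\<Sum>l\<in>J. (\<Sum>j\<in>J. P j l) / (\<integral>x. \<beta> l x \<partial>\<tau>) * \<beta> l y))"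
  shows "\<mu> \<in> P2 X" "\<mu>' \<in> P2 X" "(W2 X \<mu> \<mu>')\<^sup>2 \<le> (\<Sum>j\<in>J. \<Sum>l\<in>J. P j l * (C j l)\<^sup>2)"
proof -
  note s = P2_D[OF \<sigma>] and t = P2_D[OF \<tau>]
  interpret s: prob_space \<sigma> by (rule s)
  interpret t: prob_space \<tau> by (rule t)
  interpret st: pair_prob_space \<sigma> \<tau> ..
  have sets_st: "sets (\<sigma> \<Otimes>\<^sub>M \<tau>) = sets (borel_of X \<Otimes>\<^sub>M borel_of X)"
    using s t by (intro sets_pair_measure_cong)
  have space_st: "space (\<sigma> \<Otimes>\<^sub>M \<tau>) = mspace X \<times> mspace X" by (simp add: space_pair_measure s t)
  define A where "A j = (\<integral>x. \<alpha> j x \<partial>\<sigma>)" for j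
  define B where "B j = (\<integral>x. \<beta> j x \<partial>\<tau>)" for j
  have A0: "0 \<le> A j" if "j \<in> J" for j
    unfolding A_def using \<alpha>(2)[OF that] s by (intro integral_nonneg_AE AE_I2) auto
  have B0: "0 \<le> B j" if "j \<in> J" for j
    unfolding B_def using \<beta>(2)[OF that] t by (intro integral_nonneg_AE AE_I2) auto
  have [measurable]: "\<alpha> j \<in> borel_measurable \<sigma>" if "j \<in> J" for j
    using \<alpha>(1)[OF that] by (simp add: measurable_cong_sets[OF s(2) refl])
  have [measurable]: "\<beta> j \<in> borel_measurable \<tau>" if "j \<in> J" for j
    using \<beta>(1)[OF that] by (simp add: measurable_cong_sets[OF t(2) refl])
  have int\<alpha>: "integrable \<sigma> (\<alpha> j)" if "j \<in> J" for j
    using P2_integrable_bounded[OF \<sigma> \<alpha>(1)[OF that], of 1] \<alpha>(2,3)[OF that] by auto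
  have int\<beta>: "integrable \<tau> (\<beta> j)" if "j \<in> J" for j
    using P2_integrable_bounded[OF \<tau> \<beta>(1)[OF that], of 1] \<beta>(2,3)[OF that] by auto
  \<comment> \<open>Dividing by both masses normalises the pieces. A zero mass gives the quotient 0,
    which agrees with the vanishing of the corresponding entries of \<open>P\<close>.\<close>
  define w where "w j l = P j l / (A j * B l)" for j l
  have w0: "0 \<le> w j l" if "j \<in> J" "l \<in> J" for j l
    using P(1) A0 B0 that by (simp add: w_def)
  define k where "k x y = (\<Sum>j\<in>J. \<Sum>l\<in>J. w j l * (\<alpha> j x * \<beta> l y))" for x y
  have k0: "0 \<le> k x y" if "x \<in> mspace X" "y \<in> mspace X" for x y
    unfolding k_def using w0 \<alpha>(2) \<beta>(2) that by (intro sum_nonneg mult_nonneg_nonneg) auto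
  have km [measurable]: "(\<lambda>p. k (fst p) (snd p)) \<in> borel_measurable (\<sigma> \<Otimes>\<^sub>M \<tau>)"
    unfolding k_def by (intro borel_measurable_sum borel_measurable_times borel_measurable_const)
      (auto intro!: measurable_compose[OF measurable_fst] measurable_compose[OF measurable_snd])
  define \<pi> where "\<pi> = density (\<sigma> \<Otimes>\<^sub>M \<tau>) (\<lambda>p. ennreal (k (fst p) (snd p)))"
  have sets\<pi>: "sets \<pi> = sets (borel_of X \<Otimes>\<^sub>M borel_of X)" by (simp add: \<pi>_def sets_st)
  have space\<pi>: "space \<pi> = mspace X \<times> mspace X" by (simp add: \<pi>_def space_st)
  define \<rho> where "\<rho> x = (\<Sum>j\<in>J. (\<Sum>l\<in>J. P j l) / A j * \<alpha> j x)" for x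
  define \<rho>' where "\<rho>' y = (\<Sum>l\<in>J. (\<Sum>j\<in>J. P j l) / B l * \<beta> l y)" for y
  \<comment> \<open>Cancelling \<open>A j\<close> or \<open>B l\<close> is legitimate even when it
    is zero, because then \<open>P j l\<close> is zero as well.\<close>
  have wB: "w j l * (r * B l) = P j l / A j * r" "w j l * (A j * r) = P j l / B l * r"
    if "j \<in> J" "l \<in> J" for j l r
    using P(3,4)[OF that] by (auto simp: w_def A_def B_def)
  have in1: "(\<integral>\<^sup>+y. ennreal (k x y) \<partial>\<tau>) = ennreal (\<rho> x)" if "x \<in> mspace X" for x
  proof -
    have i: "integrable \<tau> (k x)"
      unfolding k_def using int\<beta> by (intro Bochner_Integration.integrable_sum) auto
    have "(\<integral>\<^sup>+y. ennreal (k x y) \<partial>\<tau>) = ennreal (\<integral>y. k x y \<partial>\<tau>)"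
      using k0 that t i by (intro nn_integral_eq_integral) auto
    also have "(\<integral>y. k x y \<partial>\<tau>) = (\<Sum>j\<in>J. \<Sum>l\<in>J. w j l * (\<alpha> j x * B l))"
      unfolding k_def using int\<beta> by (simp add: Bochner_Integration.integral_sum B_def)
    also have "\<dots> = \<rho> x"
      by (simp add: \<rho>_def wB sum_distrib_right sum_divide_distrib)
    finally show ?thesis .
  qed
  have in2: "(\<integral>\<^sup>+x. ennreal (k x y) \<partial>\<sigma>) = ennreal (\<rho>' y)" if "y \<in> mspace X" for y
  proof -
    have i: "integrable \<sigma> (\<lambda>x. k x y)"
      unfolding k_def using int\<alpha> by (intro Bochner_Integration.integrable_sum) auto
    have "(\<integral>\<^sup>+x. ennreal (k x y) \<partial>\<sigma>) = ennreal (\<integral>x. k x y \<partial>\<sigma>)"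
      using k0 that s i by (intro nn_integral_eq_integral) auto
    also have "(\<integral>x. k x y \<partial>\<sigma>) = (\<Sum>j\<in>J. \<Sum>l\<in>J. w j l * (A j * \<beta> l y))"
      unfolding k_def using int\<alpha> by (simp add: Bochner_Integration.integral_sum A_def)
    also have "\<dots> = (\<Sum>l\<in>J. \<Sum>j\<in>J. w j l * (A j * \<beta> l y))" by (rule sum.swap)
    also have "\<dots> = \<rho>' y"
      by (simp add: \<rho>'_def wB sum_distrib_right sum_divide_distrib)
    finally show ?thesis .
  qed
  have m1: "distr \<pi> (borel_of X) fst = \<mu>"
  proof (rule measure_eqI)
    fix S assume "S \<in> sets (distr \<pi> (borel_of X) fst)"
    then have S: "S \<in> sets (borel_of X)" by simp
    then have S': "S \<in> sets \<sigma>" by (simp add: s)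
    have "fst \<in> measurable \<pi> (borel_of X)" by (simp add: measurable_cong_sets[OF sets\<pi> refl])
    then have "emeasure (distr \<pi> (borel_of X) fst) S = emeasure \<pi> (fst -` S \<inter> space \<pi>)"
      using S by (rule emeasure_distr)
    also have "fst -` S \<inter> space \<pi> = S \<times> space \<tau>"
      using sets.sets_into_space[OF S] by (auto simp: space\<pi> t)
    also have "emeasure \<pi> \<dots> = (\<integral>\<^sup>+p. ennreal (k (fst p) (snd p)) * indicator (S \<times> space \<tau>) p \<partial>(\<sigma> \<Otimes>\<^sub>M \<tau>))"
      unfolding \<pi>_def using S' by (intro emeasure_density) auto
    also have "\<dots> = (\<integral>\<^sup>+x. \<integral>\<^sup>+y. ennreal (k x y) * indicator (S \<times> space \<tau>) (x, y) \<partial>\<tau> \<partial>\<sigma>)"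
      using S' by (subst t.nn_integral_fst[symmetric]) auto
    also have "\<dots> = (\<integral>\<^sup>+x. (\<integral>\<^sup>+y. ennreal (k x y) \<partial>\<tau>) * indicator S x \<partial>\<sigma>)"
      by (intro nn_integral_cong) (auto intro!: nn_integral_cong simp: indicator_def)
    also have "\<dots> = (\<integral>\<^sup>+x. ennreal (\<rho> x) * indicator S x \<partial>\<sigma>)"
      by (intro nn_integral_cong) (simp add: in1 s)
    also have "\<dots> = emeasure \<mu> S"
      unfolding \<mu> \<rho>_def A_def using S' by (subst emeasure_density) auto
    finally show "emeasure (distr \<pi> (borel_of X) fst) S = emeasure \<mu> S" .
  qed (simp add: \<mu> s)
  have m2: "distr \<pi> (borel_of X) snd = \<mu>'"
  proof (rule measure_eqI)
    fix S assume "S \<in> sets (distr \<pi> (borel_of X) snd)"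
    then have S: "S \<in> sets (borel_of X)" by simp
    then have S': "S \<in> sets \<tau>" by (simp add: t)
    have "snd \<in> measurable \<pi> (borel_of X)" by (simp add: measurable_cong_sets[OF sets\<pi> refl])
    then have "emeasure (distr \<pi> (borel_of X) snd) S = emeasure \<pi> (snd -` S \<inter> space \<pi>)"
      using S by (rule emeasure_distr)
    also have "snd -` S \<inter> space \<pi> = space \<sigma> \<times> S"
      using sets.sets_into_space[OF S] by (auto simp: space\<pi> s)
    also have "emeasure \<pi> \<dots> = (\<integral>\<^sup>+p. ennreal (k (fst p) (snd p)) * indicator (space \<sigma> \<times> S) p \<partial>(\<sigma> \<Otimes>\<^sub>M \<tau>))"
      unfolding \<pi>_def using S' by (intro emeasure_density) auto
    also have "\<dots> = (\<integral>\<^sup>+y. \<integral>\<^sup>+x. ennreal (k x y) * indicator (space \<sigma> \<times> S) (x, y) \<partial>\<sigma> \<partial>\<tau>)"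
      using S' by (subst st.nn_integral_snd[symmetric]) auto
    also have "\<dots> = (\<integral>\<^sup>+y. (\<integral>\<^sup>+x. ennreal (k x y) \<partial>\<sigma>) * indicator S y \<partial>\<tau>)"
      by (intro nn_integral_cong) (auto intro!: nn_integral_cong simp: indicator_def)
    also have "\<dots> = (\<integral>\<^sup>+y. ennreal (\<rho>' y) * indicator S y \<partial>\<tau>)"
      by (intro nn_integral_cong) (simp add: in2 t)
    also have "\<dots> = emeasure \<mu>' S"
      unfolding \<mu>' \<rho>'_def B_def using S' by (subst emeasure_density) auto
    finally show "emeasure (distr \<pi> (borel_of X) snd) S = emeasure \<mu>' S" .
  qed (simp add: \<mu>' t)
  have pi: "\<pi> \<in> couplings X \<mu> \<mu>'" by (simp add: couplings_def sets\<pi> m1 m2)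
  have \<rho>0: "0 \<le> (\<Sum>l\<in>J. P j l) / A j * \<alpha> j x" if "x \<in> mspace X" "j \<in> J" for x j
    using P(1) A0 \<alpha>(2) that by (intro mult_nonneg_nonneg divide_nonneg_nonneg sum_nonneg) auto
  have \<rho>0': "0 \<le> \<rho> x" if "x \<in> mspace X" for x
    unfolding \<rho>_def using \<rho>0 that by (intro sum_nonneg) auto
  have int\<rho>: "integrable \<sigma> \<rho>" unfolding \<rho>_def using int\<alpha> by (intro Bochner_Integration.integrable_sum) auto
  have "emeasure \<mu> (space \<mu>) = (\<integral>\<^sup>+x. ennreal (\<rho> x) \<partial>\<sigma>)"
    unfolding \<mu> \<rho>_def A_def by (subst emeasure_density) (auto intro!: nn_integral_cong simp: indicator_def)
  also have "\<dots> = ennreal (\<integral>x. \<rho> x \<partial>\<sigma>)"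
    using int\<rho> \<rho>0' s by (intro nn_integral_eq_integral AE_I2) auto
  also have "(\<integral>x. \<rho> x \<partial>\<sigma>) = (\<Sum>j\<in>J. (\<Sum>l\<in>J. P j l) / A j * A j)"
    unfolding \<rho>_def using int\<alpha> by (simp add: Bochner_Integration.integral_sum A_def)
  also have "\<dots> = (\<Sum>j\<in>J. \<Sum>l\<in>J. P j l)"
    using P(3) by (intro sum.cong refl) (auto simp: A_def)
  finally have "emeasure \<mu> (space \<mu>) = 1" using P by simp
  then have p\<mu>: "prob_space \<mu>" by (rule prob_spaceI)
  then show \<mu>P: "\<mu> \<in> P2 X" by (simp add: P2_def \<mu> s)
  \<comment> \<open>The second mixture needs no separate computation of its mass: it is a marginal
    of the probability measure \<pi>.\<close>
  have "prob_space \<pi>" by (rule couplings_prob_space[OF pi \<mu>P])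
  then have "prob_space (distr \<pi> (borel_of X) snd)"
    by (rule prob_space.prob_space_distr) (simp add: couplings_measurable[OF pi])
  then show "\<mu>' \<in> P2 X" by (simp add: m2) (simp add: P2_def \<mu>' t)
  have dm: "(\<lambda>p. mdist X (fst p) (snd p)) \<in> borel_measurable (\<sigma> \<Otimes>\<^sub>M \<tau>)"
    using mdist_measurable[OF X] by (simp add: measurable_cong_sets[OF sets_st refl] case_prod_beta')
  have int\<alpha>\<beta>: "integrable (\<sigma> \<Otimes>\<^sub>M \<tau>) (\<lambda>p. \<alpha> j (fst p) * \<beta> l (snd p))" if "j \<in> J" "l \<in> J" for j l
  proof (rule st.P.integrable_const_bound[where B=1])
    show "AE p in \<sigma> \<Otimes>\<^sub>M \<tau>. norm (\<alpha> j (fst p) * \<beta> l (snd p)) \<le> 1"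
      using \<alpha>(2,3) \<beta>(2,3) that by (intro AE_I2) (auto simp: space_st intro!: mult_le_one)
    show "(\<lambda>p. \<alpha> j (fst p) * \<beta> l (snd p)) \<in> borel_measurable (\<sigma> \<Otimes>\<^sub>M \<tau>)"
      using that by measurable
  qed
  have prod_int: "(\<integral>p. \<alpha> j (fst p) * \<beta> l (snd p) \<partial>(\<sigma> \<Otimes>\<^sub>M \<tau>)) = A j * B l" if "j \<in> J" "l \<in> J" for j l
    using st.integral_fst'[OF int\<alpha>\<beta>[OF that]] by (simp add: A_def B_def)
  have "cost X \<pi> = (\<integral>p. k (fst p) (snd p) *\<^sub>R (mdist X (fst p) (snd p))\<^sup>2 \<partial>(\<sigma> \<Otimes>\<^sub>M \<tau>))"
    unfolding \<pi>_def case_prod_beta' using dm k0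
    by (intro integral_density AE_I2) (auto simp: space_st)
  also have "\<dots> \<le> (\<integral>p. (\<Sum>j\<in>J. \<Sum>l\<in>J. w j l * (\<alpha> j (fst p) * \<beta> l (snd p)) * (C j l)\<^sup>2) \<partial>(\<sigma> \<Otimes>\<^sub>M \<tau>))"
  proof (rule integral_mono')
    show "integrable (\<sigma> \<Otimes>\<^sub>M \<tau>) (\<lambda>p. \<Sum>j\<in>J. \<Sum>l\<in>J. w j l * (\<alpha> j (fst p) * \<beta> l (snd p)) * (C j l)\<^sup>2)"
      using int\<alpha>\<beta> by (intro Bochner_Integration.integrable_sum) auto
    fix p assume "p \<in> space (\<sigma> \<Otimes>\<^sub>M \<tau>)"
    then have p: "fst p \<in> mspace X" "snd p \<in> mspace X" by (auto simp: space_st)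
    show "0 \<le> (\<Sum>j\<in>J. \<Sum>l\<in>J. w j l * (\<alpha> j (fst p) * \<beta> l (snd p)) * (C j l)\<^sup>2)"
      using w0 \<alpha>(2) \<beta>(2) p by (intro sum_nonneg mult_nonneg_nonneg) auto
    have "w j l * (\<alpha> j (fst p) * \<beta> l (snd p)) * (mdist X (fst p) (snd p))\<^sup>2
       \<le> w j l * (\<alpha> j (fst p) * \<beta> l (snd p)) * (C j l)\<^sup>2" if jl: "j \<in> J" "l \<in> J" for j l
    proof (cases "\<alpha> j (fst p) = 0 \<or> \<beta> l (snd p) = 0")
      case False
      then have "(mdist X (fst p) (snd p))\<^sup>2 \<le> (C j l)\<^sup>2" using C[OF jl p] by (intro power_mono) auto
      then show ?thesis using w0 \<alpha>(2) \<beta>(2) p jl by (intro mult_left_mono) auto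
    qed auto
    then show "k (fst p) (snd p) *\<^sub>R (mdist X (fst p) (snd p))\<^sup>2
        \<le> (\<Sum>j\<in>J. \<Sum>l\<in>J. w j l * (\<alpha> j (fst p) * \<beta> l (snd p)) * (C j l)\<^sup>2)"
      unfolding k_def by (simp add: sum_distrib_right sum_mono)
  qed
  also have "\<dots> = (\<Sum>j\<in>J. \<Sum>l\<in>J. w j l * (A j * B l) * (C j l)\<^sup>2)"
    using int\<alpha>\<beta> by (simp add: Bochner_Integration.integral_sum prod_int)
  also have "\<dots> = (\<Sum>j\<in>J. \<Sum>l\<in>J. P j l * (C j l)\<^sup>2)"
    using P(3,4) by (intro sum.cong refl) (auto simp: w_def A_def B_def)
  finally show "(W2 X \<mu> \<mu>')\<^sup>2 \<le> (\<Sum>j\<in>J. \<Sum>l\<in>J. P j l * (C j l)\<^sup>2)"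
    using W2_squared_le[OF pi] by simp
qed

lemma P2_measure_space: "\<mu> \<in> P2 X \<Longrightarrow> measure \<mu> (mspace X) = 1"
  using prob_space.prob_space[OF P2_D(1)] P2_D(3) by metis

text \<open>Applied with \<sigma> = \<mu>, \<tau> = \<mu>' and the partition functions as pieces,
  the mixture construction gives back \<mu> and \<mu>', since the partition sums to one. A point in
  the cell of j is within \<delta> of j, hence the excess 2 \<delta> over the distance of the
  centres.\<close>

lemma matrix_W2:
  assumes X: "compact_space (mtopology_of X)" and \<phi>: "fine_partition X \<delta> J \<phi>"
    and \<mu>: "\<mu> \<in> P2 X" and \<mu>': "\<mu>' \<in> P2 X"
    and P: "\<And>j l. j \<in> J \<Longrightarrow> l \<in> J \<Longrightarrow> 0 \<le> P j l"
      "\<And>j. j \<in> J \<Longrightarrow> (\<Sum>l\<in>J. P j l) = (\<integral>x. \<phi> j x \<partial>\<mu>)"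
      "\<And>l. l \<in> J \<Longrightarrow> (\<Sum>j\<in>J. P j l) = (\<integral>x. \<phi> l x \<partial>\<mu>')"
  shows "(W2 X \<mu> \<mu>')\<^sup>2 \<le> (\<Sum>j\<in>J. \<Sum>l\<in>J. P j l * (mdist X j l + 2 * \<delta>)\<^sup>2)"
proof -
  note D = fine_partition_D[OF \<phi>]
  have meas: "\<phi> j \<in> borel_measurable (borel_of X)" if "j \<in> J" for j
    using D(3)[OF that] by (rule cont_measurable)
  \<comment> \<open>The factor A / A is 1 unless A = 0; in that case \<phi> j vanishes almost
    everywhere, so the default value 0 does no harm.\<close>
  have dens: "density \<mu> (\<lambda>x. ennreal (\<Sum>j\<in>J. (\<integral>x. \<phi> j x \<partial>\<mu>) / (\<integral>x. \<phi> j x \<partial>\<mu>) * \<phi> j x)) = \<mu>"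
    if \<mu>: "\<mu> \<in> P2 X" for \<mu>
  proof -
    note m = P2_D[OF \<mu>]
    have [measurable]: "\<phi> j \<in> borel_measurable \<mu>" if "j \<in> J" for j
      using meas[OF that] by (simp add: measurable_cong_sets[OF m(2) refl])
    have "AE x in \<mu>. \<forall>j\<in>J. (\<integral>x. \<phi> j x \<partial>\<mu>) / (\<integral>x. \<phi> j x \<partial>\<mu>) * \<phi> j x = \<phi> j x"
    proof (intro AE_finite_allI D(1))
      fix j assume j: "j \<in> J"
      show "AE x in \<mu>. (\<integral>x. \<phi> j x \<partial>\<mu>) / (\<integral>x. \<phi> j x \<partial>\<mu>) * \<phi> j x = \<phi> j x"
      proof (cases "(\<integral>x. \<phi> j x \<partial>\<mu>) = 0")
        case True
        then have "AE x in \<mu>. \<phi> j x = 0"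
          using integral_nonneg_eq_0_iff_AE[OF cont_integrable[OF X \<mu> D(3)[OF j]] AE_I2] D(4)[OF j] m by auto
        then show ?thesis by eventually_elim auto
      qed auto
    qed
    then have "AE x in \<mu>. ennreal (\<Sum>j\<in>J. (\<integral>x. \<phi> j x \<partial>\<mu>) / (\<integral>x. \<phi> j x \<partial>\<mu>) * \<phi> j x) = 1"
      using AE_space
    proof eventually_elim
      case (elim x)
      then have "(\<Sum>j\<in>J. (\<integral>x. \<phi> j x \<partial>\<mu>) / (\<integral>x. \<phi> j x \<partial>\<mu>) * \<phi> j x) = (\<Sum>j\<in>J. \<phi> j x)"
        by (intro sum.cong) auto
      then show ?case using elim D(7) m by simp
    qed
    then have "density \<mu> (\<lambda>x. ennreal (\<Sum>j\<in>J. (\<integral>x. \<phi> j x \<partial>\<mu>) / (\<integral>x. \<phi> j x \<partial>\<mu>) * \<phi> j x)) = density \<mu> (\<lambda>_. 1)"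
      by (intro density_cong) auto
    then show ?thesis by (simp add: density_1)
  qed
  have "(\<Sum>j\<in>J. \<integral>x. \<phi> j x \<partial>\<mu>) = 1"
    using fine_partition_sum_integral[OF X \<phi> \<mu>, of "\<lambda>_. 1"] P2_measure_space[OF \<mu>] by (simp add: P2_D(3)[OF \<mu>])
  then have one: "(\<Sum>j\<in>J. \<Sum>l\<in>J. P j l) = 1" by (simp add: P)
  \<comment> \<open>A nonnegative entry is at most its row sum and its column sum.\<close>
  have z: "P j l = 0" if "j \<in> J" "l \<in> J" "(\<integral>x. \<phi> j x \<partial>\<mu>) = 0 \<or> (\<integral>x. \<phi> l x \<partial>\<mu>') = 0" for j l
    using that P(1) member_le_sum[of l J "\<lambda>l. P j l"] member_le_sum[of j J "\<lambda>j. P j l"] D(1)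
      P(2)[of j] P(3)[of l] by (metis (mono_tags, lifting) DiffD1 antisym)
  show ?thesis
  proof (rule mixture_W2(3)[OF X \<mu> \<mu>' D(1), where \<alpha>=\<phi> and \<beta>=\<phi>])
    show "mdist X x y \<le> mdist X j l + 2 * \<delta>" if "j \<in> J" "l \<in> J" "x \<in> mspace X" "y \<in> mspace X" "\<phi> j x \<noteq> 0" "\<phi> l y \<noteq> 0" for j l x y
    proof -
      have "j \<in> mspace X" "l \<in> mspace X" using that D(2) by auto
      then show ?thesis
        using D(6)[OF that(1,3,5)] D(6)[OF that(2,4,6)] mdist_triangle[of x X j y] mdist_triangle[of j X l y] that
        by (simp add: mdist_commute)
    qed
    show "\<mu> = density \<mu> (\<lambda>x. ennreal (\<Sum>j\<in>J. (\<Sum>l\<in>J. P j l) / (\<integral>x. \<phi> j x \<partial>\<mu>) * \<phi> j x))"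
      using dens[OF \<mu>] by (simp add: P(2) cong: sum.cong)
    show "\<mu>' = density \<mu>' (\<lambda>x. ennreal (\<Sum>l\<in>J. (\<Sum>j\<in>J. P j l) / (\<integral>x. \<phi> l x \<partial>\<mu>') * \<phi> l x))"
      using dens[OF \<mu>'] by (simp add: P(3) cong: sum.cong)
  qed (use D meas P one z in auto)
qed

definition matrix_marginals :: "'i set \<Rightarrow> ('i \<Rightarrow> 'i \<Rightarrow> real) \<Rightarrow> ('i \<Rightarrow> real) \<Rightarrow> ('i \<Rightarrow> real) \<Rightarrow> bool" where
  "matrix_marginals J P a b \<longleftrightarrow> (\<forall>j\<in>J. \<forall>l\<in>J. 0 \<le> P j l) \<and> (\<forall>j\<in>J. (\<Sum>l\<in>J. P j l) = a j) \<and>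
     (\<forall>l\<in>J. (\<Sum>j\<in>J. P j l) = b l)"

lemma matrix_marginals_D:
  assumes "matrix_marginals J P a b"
  shows "\<And>j l. j \<in> J \<Longrightarrow> l \<in> J \<Longrightarrow> 0 \<le> P j l" "\<And>j. j \<in> J \<Longrightarrow> (\<Sum>l\<in>J. P j l) = a j"
    "\<And>l. l \<in> J \<Longrightarrow> (\<Sum>j\<in>J. P j l) = b l"
  using assms by (auto simp: matrix_marginals_def)

text \<open>Conversely, integrating \<phi> j (x) \<phi> l (y) against a coupling yields a matrix
  with the right marginals and nearly the same cost. The slack \<open>c\<close> anticipates what is
  later added to the distances of centres: 2 \<delta> for semicontinuity, \<delta> for the triangle
  inequality, 2 \<delta> + \<epsilon> for transplantation. The entries are bounded by 1 so that
  subsequences can be extracted.\<close>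

lemma coupling_matrix:
  assumes X: "compact_space (mtopology_of X)" and \<phi>: "fine_partition X \<delta> J \<phi>"
    and \<mu>: "\<mu> \<in> P2 X" and \<mu>': "\<mu>' \<in> P2 X" and \<pi>: "\<pi> \<in> couplings X \<mu> \<mu>'"
    and Dia: "\<And>x y. x \<in> mspace X \<Longrightarrow> y \<in> mspace X \<Longrightarrow> mdist X x y \<le> D"
    and c: "0 \<le> c" "0 \<le> \<delta>"
  obtains P where "matrix_marginals J P (\<lambda>j. \<integral>x. \<phi> j x \<partial>\<mu>) (\<lambda>l. \<integral>x. \<phi> l x \<partial>\<mu>')" "\<forall>j\<in>J. \<forall>l\<in>J. P j l \<le> 1"
    "(\<Sum>j\<in>J. \<Sum>l\<in>J. P j l * (mdist X j l + c)\<^sup>2) \<le> cost X \<pi> + (2 * \<delta> + c) * (2 * D + (2 * \<delta> + c))"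
proof -
  note A = fine_partition_D[OF \<phi>]
  interpret prob_space \<pi> by (rule couplings_prob_space[OF \<pi> \<mu>])
  define P where "P j l = (\<integral>p. \<phi> j (fst p) * \<phi> l (snd p) \<partial>\<pi>)" for j l
  have [measurable]: "\<phi> j \<in> borel_measurable (borel_of X)" if "j \<in> J" for j
    using A(3)[OF that] by (rule cont_measurable)
  have sp: "fst p \<in> mspace X" "snd p \<in> mspace X" if "p \<in> space \<pi>" for p
    using that unfolding couplings_D(2)[OF \<pi>] by (simp_all add: mem_Times_iff)
  have int: "integrable \<pi> (\<lambda>p. \<phi> j (fst p) * \<phi> l (snd p))" if "j \<in> J" "l \<in> J" for j l
  proof (rule integrable_const_bound[where B=1])
    show "AE p in \<pi>. norm (\<phi> j (fst p) * \<phi> l (snd p)) \<le> 1"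
      using A(4,5) that sp by (intro AE_I2) (auto intro!: mult_le_one)
    have "(\<lambda>p. \<phi> j (fst p) * \<phi> l (snd p)) \<in> borel_measurable (borel_of X \<Otimes>\<^sub>M borel_of X)"
      using that by measurable
    then show "(\<lambda>p. \<phi> j (fst p) * \<phi> l (snd p)) \<in> borel_measurable \<pi>"
      by (simp add: couplings_measurable[OF \<pi>])
  qed
  have P01: "0 \<le> P j l" "P j l \<le> 1" if jl: "j \<in> J" "l \<in> J" for j l
  proof -
    show "0 \<le> P j l" unfolding P_def using A(4) jl sp by (intro integral_nonneg_AE AE_I2) auto
    show "P j l \<le> 1" unfolding P_def
      using A(4,5) jl sp by (intro integral_le_const[OF int[OF jl]] AE_I2) (auto intro!: mult_le_one)
  qed
  have P1: "(\<Sum>l\<in>J. P j l) = (\<integral>x. \<phi> j x \<partial>\<mu>)" if j: "j \<in> J" for j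
  proof -
    have "(\<Sum>l\<in>J. P j l) = (\<integral>p. (\<Sum>l\<in>J. \<phi> j (fst p) * \<phi> l (snd p)) \<partial>\<pi>)"
      unfolding P_def using int j by (intro Bochner_Integration.integral_sum[symmetric]) auto
    also have "\<dots> = (\<integral>p. \<phi> j (fst p) \<partial>\<pi>)"
      using sp A(7) by (intro Bochner_Integration.integral_cong) (auto simp flip: sum_distrib_left)
    also have "\<dots> = (\<integral>x. \<phi> j x \<partial>distr \<pi> (borel_of X) fst)"
      using j by (subst integral_distr) (auto simp: couplings_measurable[OF \<pi>])
    finally show ?thesis by (simp add: couplings_D(3)[OF \<pi>])
  qed
  have P2: "(\<Sum>j\<in>J. P j l) = (\<integral>x. \<phi> l x \<partial>\<mu>')" if l: "l \<in> J" for l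
  proof -
    have "(\<Sum>j\<in>J. P j l) = (\<integral>p. (\<Sum>j\<in>J. \<phi> j (fst p) * \<phi> l (snd p)) \<partial>\<pi>)"
      unfolding P_def using int l by (intro Bochner_Integration.integral_sum[symmetric]) auto
    also have "\<dots> = (\<integral>p. \<phi> l (snd p) \<partial>\<pi>)"
      using sp A(7) by (intro Bochner_Integration.integral_cong) (auto simp flip: sum_distrib_right)
    also have "\<dots> = (\<integral>x. \<phi> l x \<partial>distr \<pi> (borel_of X) snd)"
      using l by (subst integral_distr) (auto simp: couplings_measurable[OF \<pi>])
    finally show ?thesis by (simp add: couplings_D(4)[OF \<pi>])
  qed
  show thesis
  proof (rule that[of P])
    show "matrix_marginals J P (\<lambda>j. \<integral>x. \<phi> j x \<partial>\<mu>) (\<lambda>l. \<integral>x. \<phi> l x \<partial>\<mu>')" "\<forall>j\<in>J. \<forall>l\<in>J. P j l \<le> 1"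
      using P01 P1 P2 by (simp_all add: matrix_marginals_def)
    \<comment> \<open>Centres are within \<delta> of the points, so the distance of centres plus
      \<open>c\<close> is at most d + e with e = 2 \<delta> + c; the squares differ by e (2 d +
      e).\<close>
    let ?e = "2 * \<delta> + c"
    have "(\<Sum>j\<in>J. \<Sum>l\<in>J. P j l * (mdist X j l + c)\<^sup>2)
        = (\<integral>p. (\<Sum>j\<in>J. \<Sum>l\<in>J. \<phi> j (fst p) * \<phi> l (snd p) * (mdist X j l + c)\<^sup>2) \<partial>\<pi>)"
      unfolding P_def using int by (simp add: Bochner_Integration.integral_sum)
    also have "\<dots> \<le> (\<integral>p. (mdist X (fst p) (snd p))\<^sup>2 + ?e * (2 * D + ?e) \<partial>\<pi>)"
    proof (rule integral_mono)
      show "integrable \<pi> (\<lambda>p. \<Sum>j\<in>J. \<Sum>l\<in>J. \<phi> j (fst p) * \<phi> l (snd p) * (mdist X j l + c)\<^sup>2)"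
        using int by (intro Bochner_Integration.integrable_sum) auto
      show "integrable \<pi> (\<lambda>p. (mdist X (fst p) (snd p))\<^sup>2 + ?e * (2 * D + ?e))"
        using cost_integrable[OF X \<pi> \<mu>] by (intro Bochner_Integration.integrable_add) (auto simp: case_prod_beta')
      fix p assume "p \<in> space \<pi>"
      then obtain x y where p: "p = (x, y)" "x \<in> mspace X" "y \<in> mspace X" using sp by (metis prod.collapse)
      let ?d = "mdist X x y"
      have "\<phi> j x * \<phi> l y * (mdist X j l + c)\<^sup>2 \<le> \<phi> j x * \<phi> l y * (?d + ?e)\<^sup>2" if jl: "j \<in> J" "l \<in> J" for j l
      proof (cases "\<phi> j x = 0 \<or> \<phi> l y = 0")
        case False
        have "j \<in> mspace X" "l \<in> mspace X" using jl A(2) by auto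
        then have "mdist X j l + c \<le> ?d + ?e"
          using A(6)[OF jl(1) p(2)] A(6)[OF jl(2) p(3)] False mdist_triangle[of j X x l] mdist_triangle[of x X y l] p
          by (simp add: mdist_commute)
        then have "(mdist X j l + c)\<^sup>2 \<le> (?d + ?e)\<^sup>2" using c by (intro power_mono) auto
        then show ?thesis using A(4) jl p by (intro mult_left_mono) auto
      qed auto
      then have "(\<Sum>j\<in>J. \<Sum>l\<in>J. \<phi> j x * \<phi> l y * (mdist X j l + c)\<^sup>2) \<le> (\<Sum>j\<in>J. \<Sum>l\<in>J. \<phi> j x * \<phi> l y * (?d + ?e)\<^sup>2)"
        by (intro sum_mono) auto
      also have "\<dots> = (\<Sum>j\<in>J. \<phi> j x) * (\<Sum>l\<in>J. \<phi> l y) * (?d + ?e)\<^sup>2"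
        unfolding sum_product by (simp add: sum_distrib_right)
      also have "\<dots> = ?d\<^sup>2 + ?e * (2 * ?d + ?e)"
        using A(7) p by (simp add: power2_eq_square algebra_simps)
      also have "\<dots> \<le> ?d\<^sup>2 + ?e * (2 * D + ?e)"
        using Dia[OF p(2,3)] c by (intro add_left_mono mult_left_mono) auto
      finally show "(\<Sum>j\<in>J. \<Sum>l\<in>J. \<phi> j (fst p) * \<phi> l (snd p) * (mdist X j l + c)\<^sup>2)
          \<le> (mdist X (fst p) (snd p))\<^sup>2 + ?e * (2 * D + ?e)" by (simp add: p)
    qed
    also have "\<dots> = cost X \<pi> + ?e * (2 * D + ?e)"
      using cost_integrable[OF X \<pi> \<mu>] by (simp add: case_prod_beta' prob_space)
    finally show "(\<Sum>j\<in>J. \<Sum>l\<in>J. P j l * (mdist X j l + c)\<^sup>2) \<le> cost X \<pi> + ?e * (2 * D + ?e)" .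
  qed
qed

section \<open>Limits and gluing of coupling matrices\<close>

lemma finite_family_convergent_subseq:
  fixes f :: "nat \<Rightarrow> 'i \<Rightarrow> real"
  assumes "finite I" "\<And>k i. i \<in> I \<Longrightarrow> \<bar>f k i\<bar> \<le> B"
  obtains r :: "nat \<Rightarrow> nat" where "strict_mono r" "\<forall>i\<in>I. convergent (\<lambda>k. f (r k) i)"
proof -
  have "\<exists>r :: nat \<Rightarrow> nat. strict_mono r \<and> (\<forall>i\<in>I. convergent (\<lambda>k. f (r k) i))"
    using assms
  proof (induction I)
    case empty
    then show ?case by (auto intro!: exI[of _ id] simp: strict_mono_def)
  next
    case (insert i I)
    then obtain r :: "nat \<Rightarrow> nat" where r: "strict_mono r" "\<And>i. i \<in> I \<Longrightarrow> convergent (\<lambda>k. f (r k) i)"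
      by auto
    have "bounded (range (\<lambda>k. f (r k) i))"
      using insert.prems unfolding bounded_iff by (auto intro!: exI[of _ B])
    then obtain l s where s: "strict_mono (s :: nat \<Rightarrow> nat)" "((\<lambda>k. f (r k) i) \<circ> s) \<longlonglongrightarrow> l"
      using bounded_imp_convergent_subsequence by blast
    have "convergent (\<lambda>k. f ((r \<circ> s) k) i')" if "i' \<in> insert i I" for i'
    proof (cases "i' = i")
      case True
      then show ?thesis using s by (auto simp: convergent_def o_def)
    next
      case False
      then show ?thesis using convergent_subseq_convergent[OF r(2) s(1)] that by (auto simp: o_def)
    qed
    then show ?case using strict_mono_o[OF r(1) s(1)] by blast
  qed
  then show ?thesis using that by blast
qed

text \<open>The expression is the error made by \<open>coupling_matrix\<close>, with total slack
  \<open>c * \<delta>\<close>. It tends to 0 with the mesh; \<open>c\<close> is 4 for semicontinuity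
  and 3 for the triangle inequality.\<close>

lemma small_mesh:
  assumes "0 < (e::real)" "0 \<le> D" "0 \<le> c"
  obtains \<delta> where "0 < \<delta>" "\<delta> \<le> e" "c * \<delta> * (2 * D + c * \<delta>) \<le> e"
proof -
  have "((\<lambda>\<delta>. c * \<delta> * (2 * D + c * \<delta>)) \<longlongrightarrow> c * 0 * (2 * D + c * 0)) (at_right (0::real))"
    by (intro tendsto_intros)
  then have "\<forall>\<^sub>F \<delta> in at_right 0. c * \<delta> * (2 * D + c * \<delta>) < e"
    using assms by (intro order_tendstoD) auto
  moreover have "\<forall>\<^sub>F \<delta> in at_right (0::real). \<delta> < e"
    using assms by (intro order_tendstoD(2)[OF tendsto_ident_at]) auto
  moreover have "\<forall>\<^sub>F \<delta> in at_right (0::real). 0 < \<delta>"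
    by (rule eventually_at_right_less)
  ultimately have "\<forall>\<^sub>F \<delta> in at_right (0::real). 0 < \<delta> \<and> \<delta> \<le> e \<and> c * \<delta> * (2 * D + c * \<delta>) \<le> e"
    by eventually_elim auto
  then show ?thesis using that eventually_happens trivial_limit_at_right_real by blast
qed

text \<open>For a fixed partition, the matrices of nearly optimal couplings lie in a compact subset
  of a finite-dimensional space. Their marginals are integrals of the continuous functions \<phi> j,
  so weak convergence passes to a limit matrix with the correct marginals. No compactness of
  measures on the product space is involved.\<close>

lemma W2_lower_semicontinuous:
  assumes X: "compact_space (mtopology_of X)"
    and P2: "\<And>k. \<mu>k k \<in> P2 X" "\<And>k. \<mu>k' k \<in> P2 X" "\<mu> \<in> P2 X" "\<mu>' \<in> P2 X"
    and w: "weak_star_conv X \<mu>k \<mu>" "weak_star_conv X \<mu>k' \<mu>'"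
    and b: "\<And>k. (W2 X (\<mu>k k) (\<mu>k' k))\<^sup>2 \<le> b k" "b \<longlonglongrightarrow> L"
  shows "(W2 X \<mu> \<mu>')\<^sup>2 \<le> L"
proof (rule field_le_epsilon)
  fix e :: real assume e: "0 < e"
  obtain D where D: "D \<ge> 0" "\<And>x y. x \<in> mspace X \<Longrightarrow> y \<in> mspace X \<Longrightarrow> mdist X x y \<le> D"
    using mdist_bounded[OF X] by blast
  \<comment> \<open>The slack 2 \<delta> demanded by \<open>matrix_W2\<close> and the 2 \<delta>
    lost in passing to centres add up to 4 \<delta>.\<close>
  obtain \<delta> where \<delta>: "0 < \<delta>" "4 * \<delta> * (2 * D + 4 * \<delta>) \<le> e"
    using small_mesh[OF e D(1), of 4] by auto
  have \<delta>': "0 \<le> \<delta>" and \<delta>'': "0 \<le> 2 * \<delta>" using \<delta>(1) by simp_all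
  obtain J \<phi> where \<phi>: "fine_partition X \<delta> J \<phi>" using fine_partition_exists[OF X \<delta>(1)] by blast
  note A = fine_partition_D[OF \<phi>]
  let ?S = "\<lambda>P. \<Sum>j\<in>J. \<Sum>l\<in>J. P j l * (mdist X j l + 2 * \<delta>)\<^sup>2"
  define a where "a k j = (\<integral>x. \<phi> j x \<partial>\<mu>k k)" for k j
  define a' where "a' k j = (\<integral>x. \<phi> j x \<partial>\<mu>k' k)" for k j
  define R where "R k P \<longleftrightarrow> matrix_marginals J P (a k) (a' k) \<and> (\<forall>j\<in>J. \<forall>l\<in>J. P j l \<le> 1) \<and> ?S P \<le> b k + 1 / Suc k + e"
    for k P
  have "\<exists>P. R k P" for k
  proof -
    obtain \<pi> where \<pi>: "\<pi> \<in> couplings X (\<mu>k k) (\<mu>k' k)" "cost X \<pi> < (W2 X (\<mu>k k) (\<mu>k' k))\<^sup>2 + 1 / Suc k"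
      using W2_squared_approx[OF P2(1,2), of "1 / Suc k" k k] by auto
    obtain P where P: "matrix_marginals J P (a k) (a' k)" "\<forall>j\<in>J. \<forall>l\<in>J. P j l \<le> 1"
      "?S P \<le> cost X \<pi> + (2 * \<delta> + 2 * \<delta>) * (2 * D + (2 * \<delta> + 2 * \<delta>))"
      unfolding a_def a'_def by (rule coupling_matrix[OF X \<phi> P2(1,2) \<pi>(1) D(2) \<delta>'' \<delta>'])
    have "?S P \<le> b k + 1 / Suc k + e" using P(3) \<pi>(2) b(1)[of k] \<delta>(2) by simp
    with P have "R k P" unfolding R_def by blast
    then show ?thesis by blast
  qed
  then obtain P where R: "\<And>k. R k (P k)" by metis
  then have M: "\<And>k. matrix_marginals J (P k) (a k) (a' k)" and P1: "\<And>k j l. j \<in> J \<Longrightarrow> l \<in> J \<Longrightarrow> P k j l \<le> 1"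
    and P5: "\<And>k. ?S (P k) \<le> b k + 1 / Suc k + e"
    using R unfolding R_def by blast+
  note P = matrix_marginals_D[OF M, unfolded a_def a'_def]
  have fin: "finite (J \<times> J)" using A(1) by simp
  have bd: "\<bar>P k (fst i) (snd i)\<bar> \<le> 1" if "i \<in> J \<times> J" for i k
    using that P(1) P1 by auto
  obtain r :: "nat \<Rightarrow> nat" where r: "strict_mono r" "\<forall>i\<in>J \<times> J. convergent (\<lambda>k. P (r k) (fst i) (snd i))"
    by (rule finite_family_convergent_subseq[where f="\<lambda>k i. P k (fst i) (snd i)", OF fin bd])
  define Q where "Q j l = lim (\<lambda>k. P (r k) j l)" for j l
  have Q: "(\<lambda>k. P (r k) j l) \<longlonglongrightarrow> Q j l" if "j \<in> J" "l \<in> J" for j l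
    using bspec[OF r(2), of "(j, l)"] that unfolding Q_def by (simp add: convergent_LIMSEQ_iff)
  have sub: "(\<lambda>k. f (r k)) \<longlonglongrightarrow> (z::real)" if "f \<longlonglongrightarrow> z" for f z
    using LIMSEQ_subseq_LIMSEQ[OF that r(1)] by (simp add: o_def)
  have "(W2 X \<mu> \<mu>')\<^sup>2 \<le> ?S Q"
  proof (rule matrix_W2[OF X \<phi> P2(3,4)])
    fix j l assume "j \<in> J" "l \<in> J"
    then show "0 \<le> Q j l" using LIMSEQ_le_const[OF Q[of j l]] P(1) by blast
  next
    fix j assume j: "j \<in> J"
    have "(\<lambda>k. \<Sum>l\<in>J. P (r k) j l) \<longlonglongrightarrow> (\<Sum>l\<in>J. Q j l)" using Q j by (intro tendsto_sum) auto
    moreover have "(\<lambda>k. \<Sum>l\<in>J. P (r k) j l) \<longlonglongrightarrow> (\<integral>x. \<phi> j x \<partial>\<mu>)"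
      unfolding P(2)[OF j] using w(1) A(3)[OF j] unfolding weak_star_conv_def by (intro sub) blast
    ultimately show "(\<Sum>l\<in>J. Q j l) = (\<integral>x. \<phi> j x \<partial>\<mu>)" by (rule LIMSEQ_unique)
  next
    fix l assume l: "l \<in> J"
    have "(\<lambda>k. \<Sum>j\<in>J. P (r k) j l) \<longlonglongrightarrow> (\<Sum>j\<in>J. Q j l)" using Q l by (intro tendsto_sum) auto
    moreover have "(\<lambda>k. \<Sum>j\<in>J. P (r k) j l) \<longlonglongrightarrow> (\<integral>x. \<phi> l x \<partial>\<mu>')"
      unfolding P(3)[OF l] using w(2) A(3)[OF l] unfolding weak_star_conv_def by (intro sub) blast
    ultimately show "(\<Sum>j\<in>J. Q j l) = (\<integral>x. \<phi> l x \<partial>\<mu>')" by (rule LIMSEQ_unique)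
  qed
  also have "?S Q \<le> L + e"
  proof (rule LIMSEQ_le)
    show "(\<lambda>k. ?S (P (r k))) \<longlonglongrightarrow> ?S Q" using Q by (intro tendsto_sum tendsto_mult tendsto_const) auto
    have "(\<lambda>k. 1 / real (Suc k)) \<longlonglongrightarrow> 0" by (rule LIMSEQ_Suc[OF lim_const_over_n])
    then have "(\<lambda>k. b k + 1 / Suc k + e) \<longlonglongrightarrow> L + 0 + e" using b(2) by (intro tendsto_intros)
    from sub[OF this] show "(\<lambda>k. b (r k) + 1 / Suc (r k) + e) \<longlonglongrightarrow> L + e" by simp
    show "\<exists>N. \<forall>n\<ge>N. ?S (P (r n)) \<le> b (r n) + 1 / Suc (r n) + e" using P5 by blast
  qed
  finally show "(W2 X \<mu> \<mu>')\<^sup>2 \<le> L + e" .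
qed

text \<open>This is the Cauchy-Schwarz inequality with weights A and B. With A and B slightly above
  the two distances, integrating it bounds the cost of a glued coupling by (A + B) squared, so it
  takes the place of Minkowski's inequality.\<close>

lemma square_sum_le_weighted:
  fixes x y A B :: real
  assumes "0 < A" "0 < B" shows "(x + y)\<^sup>2 \<le> (A + B) * (x\<^sup>2 / A + y\<^sup>2 / B)"
proof -
  have "(A + B) * (x\<^sup>2 / A + y\<^sup>2 / B) - (x + y)\<^sup>2 = (B * x - A * y)\<^sup>2 / (A * B)"
    using assms by (simp add: field_simps power2_eq_square)
  moreover have "0 \<le> (B * x - A * y)\<^sup>2 / (A * B)" using assms by simp
  ultimately show ?thesis by linarith
qed

text \<open>The couplings are glued at the level of their matrices relative to a fine partition of unity,
  which avoids disintegration of measures.\<close>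

lemma W2_triangle:
  assumes X: "compact_space (mtopology_of X)" and P2: "\<mu>1 \<in> P2 X" "\<mu>2 \<in> P2 X" "\<mu>3 \<in> P2 X"
  shows "W2 X \<mu>1 \<mu>3 \<le> W2 X \<mu>1 \<mu>2 + W2 X \<mu>2 \<mu>3"
proof (rule field_le_epsilon)
  fix e' :: real assume e': "0 < e'"
  define e where "e = e' / 2"
  have e: "0 < e" using e' by (simp add: e_def)
  \<comment> \<open>Adding \<open>e\<close> makes A and B positive even if a distance vanishes, so
    that division by them is possible.\<close>
  define A where "A = W2 X \<mu>1 \<mu>2 + e"
  define B where "B = W2 X \<mu>2 \<mu>3 + e"
  have AB: "0 < A" "0 < B" "0 \<le> W2 X \<mu>1 \<mu>2" "0 \<le> W2 X \<mu>2 \<mu>3"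
    using W2_nonneg[OF P2(1,2)] W2_nonneg[OF P2(2,3)] e by (auto simp: A_def B_def)
  obtain D where D: "D \<ge> 0" "\<And>x y. x \<in> mspace X \<Longrightarrow> y \<in> mspace X \<Longrightarrow> mdist X x y \<le> D"
    using mdist_bounded[OF X] by blast
  \<comment> \<open>One half of the square of \<open>e\<close> pays for the mesh, the other half for
    the choice of a nearly optimal coupling. Together the cost stays below w^2 + e^2, hence below (w
    + e)^2.\<close>
  obtain \<delta> where \<delta>: "0 < \<delta>" "3 * \<delta> * (2 * D + 3 * \<delta>) \<le> e\<^sup>2 / 2"
    using small_mesh[of "e\<^sup>2 / 2" D 3] e D(1) by auto
  have \<delta>': "0 \<le> \<delta>" using \<delta>(1) by simp
  obtain J \<phi> where \<phi>: "fine_partition X \<delta> J \<phi>" using fine_partition_exists[OF X \<delta>(1)] by blast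
  note F = fine_partition_D[OF \<phi>]
  obtain \<pi> where \<pi>: "\<pi> \<in> couplings X \<mu>1 \<mu>2" "cost X \<pi> < (W2 X \<mu>1 \<mu>2)\<^sup>2 + e\<^sup>2 / 2"
    using W2_squared_approx[OF P2(1,2), of "e\<^sup>2 / 2"] e by auto
  obtain \<pi>' where \<pi>': "\<pi>' \<in> couplings X \<mu>2 \<mu>3" "cost X \<pi>' < (W2 X \<mu>2 \<mu>3)\<^sup>2 + e\<^sup>2 / 2"
    using W2_squared_approx[OF P2(2,3), of "e\<^sup>2 / 2"] e by auto
  \<comment> \<open>Slack \<delta> in each of the two matrices suffices, because the two slacks add
    up to the 2 \<delta> that \<open>matrix_W2\<close> asks for between the outer centres.\<close>
  obtain P where PM: "matrix_marginals J P (\<lambda>j. \<integral>x. \<phi> j x \<partial>\<mu>1) (\<lambda>l. \<integral>x. \<phi> l x \<partial>\<mu>2)" "\<forall>j\<in>J. \<forall>l\<in>J. P j l \<le> 1"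
    and P5: "(\<Sum>j\<in>J. \<Sum>l\<in>J. P j l * (mdist X j l + \<delta>)\<^sup>2) \<le> cost X \<pi> + (2 * \<delta> + \<delta>) * (2 * D + (2 * \<delta> + \<delta>))"
    by (rule coupling_matrix[OF X \<phi> P2(1,2) \<pi>(1) D(2) \<delta>' \<delta>'])
  obtain Q where QM: "matrix_marginals J Q (\<lambda>j. \<integral>x. \<phi> j x \<partial>\<mu>2) (\<lambda>l. \<integral>x. \<phi> l x \<partial>\<mu>3)" "\<forall>j\<in>J. \<forall>l\<in>J. Q j l \<le> 1"
    and Q5: "(\<Sum>j\<in>J. \<Sum>l\<in>J. Q j l * (mdist X j l + \<delta>)\<^sup>2) \<le> cost X \<pi>' + (2 * \<delta> + \<delta>) * (2 * D + (2 * \<delta> + \<delta>))"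
    by (rule coupling_matrix[OF X \<phi> P2(2,3) \<pi>'(1) D(2) \<delta>' \<delta>'])
  note P = matrix_marginals_D[OF PM(1)] and Q = matrix_marginals_D[OF QM(1)]
  have sq: "w\<^sup>2 + e\<^sup>2 \<le> (w + e)\<^sup>2" if "0 \<le> w" for w
    using that e by (simp add: power2_sum)
  have P4: "(\<Sum>j\<in>J. \<Sum>l\<in>J. P j l * (mdist X j l + \<delta>)\<^sup>2) \<le> A\<^sup>2"
    using P5 \<pi>(2) \<delta>(2) sq[OF AB(3)] unfolding A_def by simp
  have Q4: "(\<Sum>j\<in>J. \<Sum>l\<in>J. Q j l * (mdist X j l + \<delta>)\<^sup>2) \<le> B\<^sup>2"
    using Q5 \<pi>'(2) \<delta>(2) sq[OF AB(4)] unfolding B_def by simp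
  define m where "m l = (\<integral>x. \<phi> l x \<partial>\<mu>2)" for l
  have zP: "P j l = 0" if "j \<in> J" "l \<in> J" "m l = 0" for j l
    using that P(1) member_le_sum[of j J "\<lambda>j. P j l"] F(1) P(3)[of l] by (simp add: m_def order_antisym)
  have zQ: "Q l n = 0" if "n \<in> J" "l \<in> J" "m l = 0" for n l
    using that Q(1) member_le_sum[of n J "\<lambda>n. Q l n"] F(1) Q(2)[of l] by (simp add: m_def order_antisym)
  have m0: "0 \<le> m l" if "l \<in> J" for l
    using P(3)[OF that] P(1) that by (metis (no_types, lifting) m_def sum_nonneg)
  \<comment> \<open>The gluing makes the outer indices conditionally independent given the middle
    index l. If \<open>m l\<close> is zero, so are the entries of \<open>P\<close> and
    \<open>Q\<close> at l, and the default value 0 of the quotient is the right one.\<close>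
  define S where "S j l n = P j l * Q l n / m l" for j l n
  have S0: "0 \<le> S j l n" if "j \<in> J" "l \<in> J" "n \<in> J" for j l n
    using P(1) Q(1) m0 that by (simp add: S_def)
  have S1: "(\<Sum>n\<in>J. S j l n) = P j l" if "j \<in> J" "l \<in> J" for j l
  proof -
    have "(\<Sum>n\<in>J. S j l n) = P j l * (\<Sum>n\<in>J. Q l n) / m l"
      by (simp add: S_def sum_distrib_left sum_divide_distrib)
    then show ?thesis using Q(2)[OF that(2)] zP[OF that] by (auto simp: m_def)
  qed
  have S2: "(\<Sum>j\<in>J. S j l n) = Q l n" if "l \<in> J" "n \<in> J" for l n
  proof -
    have "(\<Sum>j\<in>J. S j l n) = (\<Sum>j\<in>J. P j l) * Q l n / m l"
      by (simp add: S_def sum_distrib_right sum_divide_distrib)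
    then show ?thesis using P(3)[OF that(1)] zQ[OF that(2,1)] by (auto simp: m_def)
  qed
  have "(W2 X \<mu>1 \<mu>3)\<^sup>2 \<le> (\<Sum>j\<in>J. \<Sum>n\<in>J. (\<Sum>l\<in>J. S j l n) * (mdist X j n + 2 * \<delta>)\<^sup>2)"
  proof (rule matrix_W2[OF X \<phi> P2(1,3)])
    fix j assume j: "j \<in> J"
    have "(\<Sum>n\<in>J. \<Sum>l\<in>J. S j l n) = (\<Sum>l\<in>J. \<Sum>n\<in>J. S j l n)" by (rule sum.swap)
    then show "(\<Sum>n\<in>J. \<Sum>l\<in>J. S j l n) = (\<integral>x. \<phi> j x \<partial>\<mu>1)" using S1 P(2) j by simp
  next
    fix n assume n: "n \<in> J"
    have "(\<Sum>j\<in>J. \<Sum>l\<in>J. S j l n) = (\<Sum>l\<in>J. \<Sum>j\<in>J. S j l n)" by (rule sum.swap)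
    then show "(\<Sum>j\<in>J. \<Sum>l\<in>J. S j l n) = (\<integral>x. \<phi> n x \<partial>\<mu>3)" using S2 Q(3) n by simp
  qed (use S0 in \<open>auto intro!: sum_nonneg\<close>)
  also have "\<dots> \<le> (\<Sum>j\<in>J. \<Sum>n\<in>J. \<Sum>l\<in>J. S j l n *
      ((A + B) * ((mdist X j l + \<delta>)\<^sup>2 / A + (mdist X l n + \<delta>)\<^sup>2 / B)))"
    unfolding sum_distrib_right
  proof (intro sum_mono mult_left_mono S0)
    fix j n l assume jnl: "j \<in> J" "n \<in> J" "l \<in> J"
    then have "mdist X j n \<le> mdist X j l + mdist X l n" using F(2) by (intro mdist_triangle) auto
    then have "(mdist X j n + 2 * \<delta>)\<^sup>2 \<le> ((mdist X j l + \<delta>) + (mdist X l n + \<delta>))\<^sup>2"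
      using \<delta>(1) by (intro power_mono) auto
    also have "\<dots> \<le> (A + B) * ((mdist X j l + \<delta>)\<^sup>2 / A + (mdist X l n + \<delta>)\<^sup>2 / B)"
      by (rule square_sum_le_weighted[OF AB(1,2)])
    finally show "(mdist X j n + 2 * \<delta>)\<^sup>2 \<le> (A + B) * ((mdist X j l + \<delta>)\<^sup>2 / A + (mdist X l n + \<delta>)\<^sup>2 / B)" .
  qed
  also have "\<dots> = (A + B) * ((\<Sum>j\<in>J. \<Sum>l\<in>J. \<Sum>n\<in>J. S j l n * (mdist X j l + \<delta>)\<^sup>2) / A
      + (\<Sum>j\<in>J. \<Sum>n\<in>J. \<Sum>l\<in>J. S j l n * (mdist X l n + \<delta>)\<^sup>2) / B)"
    by (subst sum.swap[of _ J J, where g="\<lambda>l n. S j l n * (mdist X j l + \<delta>)\<^sup>2" for j])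
       (simp add: sum_distrib_left sum_divide_distrib sum.distrib algebra_simps)
  also have "(\<Sum>j\<in>J. \<Sum>l\<in>J. \<Sum>n\<in>J. S j l n * (mdist X j l + \<delta>)\<^sup>2) = (\<Sum>j\<in>J. \<Sum>l\<in>J. P j l * (mdist X j l + \<delta>)\<^sup>2)"
    by (simp add: S1 flip: sum_distrib_right)
  also have "(\<Sum>j\<in>J. \<Sum>n\<in>J. \<Sum>l\<in>J. S j l n * (mdist X l n + \<delta>)\<^sup>2) = (\<Sum>n\<in>J. \<Sum>j\<in>J. \<Sum>l\<in>J. S j l n * (mdist X l n + \<delta>)\<^sup>2)"
    by (rule sum.swap)
  also have "\<dots> = (\<Sum>n\<in>J. \<Sum>l\<in>J. \<Sum>j\<in>J. S j l n * (mdist X l n + \<delta>)\<^sup>2)"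
    by (intro sum.cong refl sum.swap)
  also have "\<dots> = (\<Sum>n\<in>J. \<Sum>l\<in>J. Q l n * (mdist X l n + \<delta>)\<^sup>2)"
    by (simp add: S2 flip: sum_distrib_right)
  also have "\<dots> = (\<Sum>l\<in>J. \<Sum>n\<in>J. Q l n * (mdist X l n + \<delta>)\<^sup>2)"
    by (rule sum.swap)
  also have "(A + B) * ((\<Sum>j\<in>J. \<Sum>l\<in>J. P j l * (mdist X j l + \<delta>)\<^sup>2) / A
      + (\<Sum>l\<in>J. \<Sum>n\<in>J. Q l n * (mdist X l n + \<delta>)\<^sup>2) / B) \<le> (A + B) * (A\<^sup>2 / A + B\<^sup>2 / B)"
    using P4 Q4 AB by (intro mult_left_mono add_mono divide_right_mono) auto
  also have "\<dots> = (A + B)\<^sup>2" using AB by (simp add: power2_eq_square)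
  finally have "W2 X \<mu>1 \<mu>3 \<le> A + B" using AB by (rule_tac power2_le_imp_le) auto
  then show "W2 X \<mu>1 \<mu>3 \<le> W2 X \<mu>1 \<mu>2 + W2 X \<mu>2 \<mu>3 + e'" by (simp add: A_def B_def e_def)
qed

section \<open>Push-forward along almost isometric Borel maps\<close>

lemma distr_P2:
  assumes "\<alpha> \<in> P2 X1" "f \<in> measurable (borel_of X1) (borel_of X2)"
  shows "distr \<alpha> (borel_of X2) f \<in> P2 X2"
  using assms(2) P2_D[OF assms(1)] prob_space.prob_space_distr[OF P2_D(1)[OF assms(1)], of f "borel_of X2"]
  by (simp add: P2_def measurable_cong_sets[OF P2_D(2)[OF assms(1)] refl])

text \<open>A coupling is pushed forward by f on both factors. Squaring d + \<epsilon> adds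
  \<epsilon> (2 d + \<epsilon>), which the diameter bound \<open>D\<close> makes uniform. Only
  measurability of f enters, not continuity.\<close>

lemma W2_distr_le:
  assumes X: "compact_space (mtopology_of X1)" "compact_space (mtopology_of X2)"
    and f: "f \<in> measurable (borel_of X1) (borel_of X2)"
      "\<And>x y. x \<in> mspace X1 \<Longrightarrow> y \<in> mspace X1 \<Longrightarrow> mdist X2 (f x) (f y) \<le> mdist X1 x y + \<epsilon>"
    and D: "\<And>x y. x \<in> mspace X1 \<Longrightarrow> y \<in> mspace X1 \<Longrightarrow> mdist X1 x y \<le> D"
    and P2: "\<alpha> \<in> P2 X1" "\<beta> \<in> P2 X1" and \<epsilon>: "0 \<le> \<epsilon>"
  shows "(W2 X2 (distr \<alpha> (borel_of X2) f) (distr \<beta> (borel_of X2) f))\<^sup>2 \<le> (W2 X1 \<alpha> \<beta>)\<^sup>2 + \<epsilon> * (2 * D + \<epsilon>)"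
proof (rule field_le_epsilon)
  fix e :: real assume e: "0 < e"
  obtain \<pi> where \<pi>: "\<pi> \<in> couplings X1 \<alpha> \<beta>" "cost X1 \<pi> < (W2 X1 \<alpha> \<beta>)\<^sup>2 + e"
    using W2_squared_approx[OF P2 e] by auto
  interpret prob_space \<pi> by (rule couplings_prob_space[OF \<pi>(1) P2(1)])
  let ?B1 = "borel_of X1" and ?B2 = "borel_of X2"
  define F where "F = (\<lambda>p. (f (fst p), f (snd p)))"
  have F: "F \<in> measurable \<pi> (?B2 \<Otimes>\<^sub>M ?B2)"
    using f(1) unfolding F_def couplings_measurable[OF \<pi>(1)] by measurable
  have fs: "fst \<in> measurable \<pi> ?B1" "snd \<in> measurable \<pi> ?B1" by (simp_all add: couplings_measurable[OF \<pi>(1)])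
  define \<pi>' where "\<pi>' = distr \<pi> (?B2 \<Otimes>\<^sub>M ?B2) F"
  have "distr \<pi>' ?B2 fst = distr (distr \<pi> ?B1 fst) ?B2 f"
    unfolding \<pi>'_def using F f(1) fs by (simp add: distr_distr) (simp add: F_def comp_def)
  moreover have "distr \<pi>' ?B2 snd = distr (distr \<pi> ?B1 snd) ?B2 f"
    unfolding \<pi>'_def using F f(1) fs by (simp add: distr_distr) (simp add: F_def comp_def)
  ultimately have \<pi>': "\<pi>' \<in> couplings X2 (distr \<alpha> ?B2 f) (distr \<beta> ?B2 f)"
    by (simp add: couplings_def couplings_D[OF \<pi>(1)]) (simp add: \<pi>'_def)
  have "cost X2 \<pi>' = (\<integral>p. (mdist X2 (f (fst p)) (f (snd p)))\<^sup>2 \<partial>\<pi>)"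
    unfolding \<pi>'_def using F mdist_measurable[OF X(2)]
    by (subst integral_distr) (auto simp: case_prod_beta' F_def)
  also have "\<dots> \<le> (\<integral>p. (mdist X1 (fst p) (snd p))\<^sup>2 + \<epsilon> * (2 * D + \<epsilon>) \<partial>\<pi>)"
  proof (rule integral_mono')
    show "integrable \<pi> (\<lambda>p. (mdist X1 (fst p) (snd p))\<^sup>2 + \<epsilon> * (2 * D + \<epsilon>))"
      using cost_integrable[OF X(1) \<pi>(1) P2(1)] by (intro Bochner_Integration.integrable_add) (auto simp: case_prod_beta')
    fix p assume "p \<in> space \<pi>"
    then have p: "fst p \<in> mspace X1" "snd p \<in> mspace X1"
      unfolding couplings_D(2)[OF \<pi>(1)] by (simp_all add: mem_Times_iff)
    let ?d = "mdist X1 (fst p) (snd p)"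
    have "(mdist X2 (f (fst p)) (f (snd p)))\<^sup>2 \<le> (?d + \<epsilon>)\<^sup>2" using f(2)[OF p] by (intro power_mono) auto
    also have "\<dots> = ?d\<^sup>2 + \<epsilon> * (2 * ?d + \<epsilon>)" by (simp add: power2_eq_square algebra_simps)
    also have "\<dots> \<le> ?d\<^sup>2 + \<epsilon> * (2 * D + \<epsilon>)" using D[OF p] \<epsilon> by (intro add_left_mono mult_left_mono) auto
    finally show "(mdist X2 (f (fst p)) (f (snd p)))\<^sup>2 \<le> ?d\<^sup>2 + \<epsilon> * (2 * D + \<epsilon>)" .
    then show "0 \<le> ?d\<^sup>2 + \<epsilon> * (2 * D + \<epsilon>)" by (rule order_trans[OF zero_le_power2])
  qed
  also have "\<dots> = cost X1 \<pi> + \<epsilon> * (2 * D + \<epsilon>)"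
    using cost_integrable[OF X(1) \<pi>(1) P2(1)] by (simp add: case_prod_beta' prob_space)
  finally show "(W2 X2 (distr \<alpha> ?B2 f) (distr \<beta> ?B2 f))\<^sup>2 \<le> (W2 X1 \<alpha> \<beta>)\<^sup>2 + \<epsilon> * (2 * D + \<epsilon>) + e"
    using W2_squared_le[OF \<pi>'] \<pi>(2) by simp
qed

section \<open>Weak compactness\<close>

text \<open>The terms are dominated by a geometric series of ratio 1/3 whose tail from index n
  onwards is 3^(-n).\<close>

lemma ternary_tail_bound:
  fixes c :: "nat \<Rightarrow> real"
  assumes "\<And>i. \<bar>c i\<bar> \<le> 2 / 3 ^ Suc i"
  shows "summable c" "\<bar>\<Sum>i. c (i + n)\<bar> \<le> 1 / 3 ^ n"
proof -
  have g: "(\<lambda>i. 2 / 3 ^ Suc (i + n)) sums (1 / 3 ^ n :: real)" for n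
  proof -
    have "(\<lambda>i. (2 / 3 ^ Suc n) * (1 / 3) ^ i) sums ((2 / 3 ^ Suc n) * (1 / (1 - 1 / 3)) :: real)"
      by (intro sums_mult geometric_sums) auto
    moreover have "(\<lambda>i. (2 / 3 ^ Suc n) * (1 / 3) ^ i) = (\<lambda>i. 2 / 3 ^ Suc (i + n) :: real)"
      by (simp add: fun_eq_iff power_add power_divide mult_ac)
    ultimately show ?thesis by simp
  qed
  show "summable c"
    by (rule summable_comparison_test'[OF sums_summable[OF g[of 0]], of 0]) (simp only: real_norm_def add_0_right assms)
  have "norm \<bar>c (i + n)\<bar> \<le> 2 / 3 ^ Suc (i + n)" for i
    by (simp only: real_norm_def abs_idempotent assms)
  then have s: "summable (\<lambda>i. \<bar>c (i + n)\<bar>)"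
    by (rule summable_comparison_test'[OF sums_summable[OF g[of n]], of 0])
  have "\<bar>\<Sum>i. c (i + n)\<bar> \<le> (\<Sum>i. \<bar>c (i + n)\<bar>)"
    by (rule summable_rabs[OF s])
  also have "\<dots> \<le> (\<Sum>i. 2 / 3 ^ Suc (i + n))"
    by (rule suminf_le[OF assms s sums_summable[OF g[of n]]])
  also have "\<dots> = 1 / 3 ^ n" by (rule sums_unique[OF g[of n], symmetric])
  finally show "\<bar>\<Sum>i. c (i + n)\<bar> \<le> 1 / 3 ^ n" .
qed

text \<open>The first differing digit contributes 2/3^(m+1), while all later digits together
  contribute at most half of that. In base 2 the tail could cancel the leading difference, hence the
  digits 0 and 2 in base 3.\<close>

lemma ternary_first_difference:
  fixes b b' :: "nat \<Rightarrow> real"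
  assumes "\<And>i. b i \<in> {0, 1}" "\<And>i. b' i \<in> {0, 1}" "b m \<noteq> b' m" "\<And>i. i < m \<Longrightarrow> b i = b' i"
  shows "1 / 3 ^ Suc m \<le> \<bar>(\<Sum>i. 2 * b i / 3 ^ Suc i) - (\<Sum>i. 2 * b' i / 3 ^ Suc i)\<bar>"
proof -
  define c where "c i = 2 * b i / 3 ^ Suc i - 2 * b' i / 3 ^ Suc i" for i
  have c: "\<bar>c i\<bar> \<le> 2 / 3 ^ Suc i" for i
    using assms(1)[of i] assms(2)[of i] by (auto simp: c_def)
  have bd: "\<bar>2 * x / 3 ^ Suc i\<bar> \<le> 2 / 3 ^ Suc i" if "x \<in> {0, 1}" for x :: real and i
    using that by auto
  have 1: "summable (\<lambda>i. 2 * b i / 3 ^ Suc i)" "summable (\<lambda>i. 2 * b' i / 3 ^ Suc i)"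
    by (intro ternary_tail_bound(1) bd assms)+
  have "(\<Sum>i. 2 * b i / 3 ^ Suc i) - (\<Sum>i. 2 * b' i / 3 ^ Suc i) = (\<Sum>i. c i)"
    unfolding c_def by (rule suminf_diff[OF 1])
  also have "\<dots> = (\<Sum>i. c (i + Suc m)) + (\<Sum>i<Suc m. c i)"
    by (rule suminf_split_initial_segment[OF ternary_tail_bound(1)[OF c]])
  also have "(\<Sum>i<Suc m. c i) = c m"
    using assms(4) by (simp add: c_def)
  finally have eq: "(\<Sum>i. 2 * b i / 3 ^ Suc i) - (\<Sum>i. 2 * b' i / 3 ^ Suc i) = (\<Sum>i. c (i + Suc m)) + c m" .
  have "\<bar>c m\<bar> = 2 / 3 ^ Suc m"
    using assms(1)[of m] assms(2)[of m] assms(3) by (auto simp: c_def)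
  then have "\<bar>c m\<bar> = 2 * (1 / 3 ^ Suc m)" by simp
  then show ?thesis
    unfolding eq using ternary_tail_bound(2)[OF c, of "Suc m"] by linarith
qed

text \<open>The binary digits of the code of a point record which balls of a countable family contain it.\<close>

lemma borel_code:
  assumes X: "compact_space (mtopology_of X)" and ne: "mspace X \<noteq> {}"
  obtains s :: "'a \<Rightarrow> real" where "s \<in> borel_measurable (borel_of X)" "\<forall>x. 0 \<le> s x \<and> s x \<le> 1"
    "\<forall>e>0. \<exists>d>0. \<forall>x\<in>mspace X. \<forall>y\<in>mspace X. \<bar>s x - s y\<bar> < d \<longrightarrow> mdist X x y < e"
proof -
  interpret Metric_space "mspace X" "mdist X" by simp
  have tb: "mtotally_bounded (mspace X)"
    using X by (simp add: mtopology_of_def compact_space_eq_mcomplete_mtotally_bounded)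
  have "\<exists>C. finite C \<and> C \<subseteq> mspace X \<and> mspace X \<subseteq> (\<Union>x\<in>C. mball x (1 / Suc p))" for p
    using tb unfolding mtotally_bounded_def by simp
  then obtain C where C: "\<And>p. finite (C p)" "\<And>p. C p \<subseteq> mspace X" "\<And>p. mspace X \<subseteq> (\<Union>x\<in>C p. mball x (1 / Suc p))"
    by metis
  define T where "T = (SIGMA p:(UNIV::nat set). C p)"
  have "countable T" unfolding T_def using C(1) by (intro countable_SIGMA) (auto intro: countable_finite)
  moreover have "T \<noteq> {}"
  proof -
    obtain x where "x \<in> mspace X" using ne by auto
    then have "C 0 \<noteq> {}" using C(3)[of 0] by auto
    then show ?thesis by (auto simp: T_def)
  qed
  ultimately obtain t :: "nat \<Rightarrow> nat \<times> 'a" where t: "range t = T"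
    using range_from_nat_into by metis
  define b :: "nat \<Rightarrow> 'a \<Rightarrow> real" where "b i x = (if mdist X x (snd (t i)) < 1 / Suc (fst (t i)) then 1 else 0)" for i x
  have b01: "b i x \<in> {0, 1}" for i x by (simp add: b_def)
  \<comment> \<open>This is a point of the Cantor set: a ball that contains x contributes the
    ternary digit 2, any other ball the digit 0.\<close>
  define s where "s x = (\<Sum>i. 2 * b i x / 3 ^ Suc i)" for x
  have tX: "snd (t i) \<in> mspace X" for i
  proof -
    have "t i \<in> T" using t by auto
    then have "snd (t i) \<in> C (fst (t i))" by (auto simp: T_def)
    then show ?thesis using C(2) by blast
  qed
  have bm: "b i \<in> borel_measurable (borel_of X)" for i
    unfolding b_def using cont_measurable[OF cont_mdist[OF tX[of i]]] by measurable
  have bb: "\<bar>2 * b i x / 3 ^ Suc i\<bar> \<le> 2 / 3 ^ Suc i" for i x by (simp add: b_def)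
  have "s \<in> borel_measurable (borel_of X)"
    unfolding s_def using bm by (intro borel_measurable_suminf) simp
  moreover have "0 \<le> s x \<and> s x \<le> 1" for x
  proof
    show "0 \<le> s x" unfolding s_def by (intro suminf_nonneg ternary_tail_bound(1)[OF bb]) (simp add: b_def)
    show "s x \<le> 1" unfolding s_def using ternary_tail_bound(2)[of "\<lambda>i. 2 * b i x / 3 ^ Suc i" 0, OF bb] by simp
  qed
  \<comment> \<open>The code itself jumps at the boundaries of balls, but its inverse is uniformly
    continuous: nearby codes share their initial digits, hence membership in a small ball.\<close>
  moreover have "\<exists>d>0. \<forall>x\<in>mspace X. \<forall>y\<in>mspace X. \<bar>s x - s y\<bar> < d \<longrightarrow> mdist X x y < e" if e: "0 < e" for e
  proof -
    obtain p :: nat where p: "2 / e < Suc p" using reals_Archimedean2[of "2 / e"] by (metis less_trans of_nat_less_iff lessI)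
    have "\<exists>i. t i = (p, c)" if "c \<in> C p" for c
    proof -
      have "(p, c) \<in> range t" using that t by (auto simp: T_def)
      then show ?thesis by auto
    qed
    then obtain k where k: "\<And>c. c \<in> C p \<Longrightarrow> t (k c) = (p, c)" by metis
    \<comment> \<open>All balls of level p are listed up to position \<open>m\<close>, so agreement
      of the digits up to \<open>m\<close> puts y into the same ball of radius 1/(p+1) as x.\<close>
    define m where "m = Max (insert 0 (k ` C p))"
    have km: "k c \<le> m" if "c \<in> C p" for c unfolding m_def using C(1) that by (intro Max_ge) auto
    have "mdist X x y < e" if xy: "x \<in> mspace X" "y \<in> mspace X" "\<bar>s x - s y\<bar> < 1 / 3 ^ Suc m" for x y
    proof -
      have agree: "b i x = b i y" if "i \<le> m" for i
      proof (rule ccontr)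
        assume ne: "b i x \<noteq> b i y"
        define j where "j = (LEAST j. b j x \<noteq> b j y)"
        have j: "b j x \<noteq> b j y" unfolding j_def by (rule LeastI[where P="\<lambda>j. b j x \<noteq> b j y", OF ne])
        have jl: "b i x = b i y" if "i < j" for i using not_less_Least[of i "\<lambda>j. b j x \<noteq> b j y"] that unfolding j_def by auto
        have "j \<le> m" using Least_le[of "\<lambda>j. b j x \<noteq> b j y", OF ne] \<open>i \<le> m\<close> unfolding j_def by simp
        have "1 / 3 ^ Suc j \<le> \<bar>s x - s y\<bar>"
          unfolding s_def by (rule ternary_first_difference[of "\<lambda>i. b i x" "\<lambda>i. b i y", OF b01 b01 j jl])
        moreover have "1 / 3 ^ Suc m \<le> (1 / 3 ^ Suc j :: real)"
          using \<open>j \<le> m\<close> by (intro divide_left_mono power_increasing) auto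
        ultimately show False using xy(3) by linarith
      qed
      obtain c where c: "c \<in> C p" "mdist X c x < 1 / Suc p" using subsetD[OF C(3)[of p] xy(1)] by auto
      then have "b (k c) x = 1" by (simp add: b_def k mdist_commute)
      then have "b (k c) y = 1" using agree[OF km[OF c(1)]] by simp
      then have "mdist X y c < 1 / Suc p" using c by (simp add: b_def k split: if_splits)
      moreover have "c \<in> mspace X" using c(1) C(2) by auto
      ultimately have "mdist X x y < 2 / Suc p"
        using mdist_triangle[of x X c y] xy c by (simp add: mdist_commute)
      also have "\<dots> < e" using p e by (simp add: field_simps)
      finally show ?thesis .
    qed
    then show ?thesis by (intro exI[of _ "1 / 3 ^ Suc m"]) auto
  qed
  ultimately show ?thesis using that by blast
qed

lemma P2_mspace_nonempty: "\<mu> \<in> P2 X \<Longrightarrow> mspace X \<noteq> {}"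
  using P2_D(1,3) prob_space.not_empty by metis

text \<open>Helly's theorem gives a limit on the real line of the measures transported by the code. The limit
  is carried by the closure of the set of codes, to which the inverse of the code extends.\<close>

lemma P2_sequentially_compact:
  assumes X: "compact_space (mtopology_of X)" and \<mu>: "\<And>n. \<mu> n \<in> P2 X"
  obtains r :: "nat \<Rightarrow> nat" and \<mu>' where "strict_mono r" "\<mu>' \<in> P2 X" "weak_star_conv X (\<lambda>k. \<mu> (r k)) \<mu>'"
proof -
  obtain x0 where x0: "x0 \<in> mspace X" using P2_mspace_nonempty[OF \<mu>] by blast
  obtain s :: "'a \<Rightarrow> real" where sm: "s \<in> borel_measurable (borel_of X)" and s01: "\<forall>x. 0 \<le> s x \<and> s x \<le> 1"
    and su: "\<forall>e>0. \<exists>d>0. \<forall>x\<in>mspace X. \<forall>y\<in>mspace X. \<bar>s x - s y\<bar> < d \<longrightarrow> mdist X x y < e"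
    using borel_code[OF X P2_mspace_nonempty[OF \<mu>]] by blast
  have inj: "inj_on s (mspace X)"
  proof (rule inj_onI, rule ccontr)
    fix x y assume xy: "x \<in> mspace X" "y \<in> mspace X" "s x = s y" "x \<noteq> y"
    then have "0 < mdist X x y" by (simp add: order_less_le)
    then show False using su xy by (metis abs_zero diff_self less_irrefl)
  qed
  define S where "S = s ` mspace X"
  define K where "K = closure S"
  \<comment> \<open>Completeness of the compact space \<open>X\<close> lets the uniformly continuous
    inverse of the code extend from the set of codes to its closure \<open>K\<close>.\<close>
  have "uniformly_continuous_map (submetric euclidean_metric S) X (inv_into (mspace X) s)"
    unfolding uniformly_continuous_map_def
  proof (intro conjI allI impI)
    show "inv_into (mspace X) s \<in> mspace (submetric euclidean_metric S) \<rightarrow> mspace X"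
      by (auto simp: S_def inv_into_into)
    fix e :: real assume "0 < e"
    then obtain d where d: "d > 0" "\<forall>x\<in>mspace X. \<forall>y\<in>mspace X. \<bar>s x - s y\<bar> < d \<longrightarrow> mdist X x y < e" using su by blast
    show "\<exists>\<delta>>0. \<forall>x\<in>mspace (submetric euclidean_metric S). \<forall>y\<in>mspace (submetric euclidean_metric S).
        mdist (submetric euclidean_metric S) y x < \<delta> \<longrightarrow> mdist X (inv_into (mspace X) s y) (inv_into (mspace X) s x) < e"
      using d by (intro exI[of _ d]) (auto simp: S_def dist_real_def inv_into_f_f[OF inj])
  qed
  moreover have "mcomplete_of X"
    using X Metric_space.compact_space_imp_mcomplete[OF Metric_space_mspace_mdist] by (simp add: mcomplete_of_def mtopology_of_def)
  ultimately obtain \<phi> where \<phi>: "uniformly_continuous_map (submetric euclidean_metric (mtopology_of euclidean_metric closure_of S)) X \<phi>"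
    "\<And>x. x \<in> S \<Longrightarrow> \<phi> x = inv_into (mspace X) s x"
    using uniformly_continuous_map_extends_to_closure_of by blast
  have \<phi>c: "continuous_map (top_of_set K) (mtopology_of X) \<phi>"
    using uniformly_continuous_imp_continuous_map[OF \<phi>(1)] by (simp add: mtopology_of_submetric K_def)
  have \<phi>s: "\<phi> (s x) = x" if "x \<in> mspace X" for x
    using that \<phi>(2)[of "s x"] inv_into_f_f[OF inj] by (simp add: S_def)
  have clK: "closed K" and sK: "s x \<in> K" if "x \<in> mspace X" for x
    using that closure_subset[of S] by (auto simp: K_def S_def)
  have clK: "closed K" by (simp add: K_def)
  define \<nu> where "\<nu> n = distr (\<mu> n) borel s" for n
  have sm': "s \<in> measurable (\<mu> n) borel" for n
    using sm by (simp add: measurable_cong_sets[OF P2_D(2)[OF \<mu>] refl])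
  have rd: "real_distribution (\<nu> n)" for n
    using prob_space.prob_space_distr[OF P2_D(1)[OF \<mu>] sm'] by (auto simp: \<nu>_def real_distribution_def real_distribution_axioms_def)
  have "tight \<nu>"
    unfolding tight_def
  proof (intro conjI allI impI rd)
    fix e :: real assume e: "0 < e"
    \<comment> \<open>Tightness is formulated with half-open intervals and codes may equal 0, so the
      left end has to lie below 0.\<close>
    have "measure (\<nu> n) {-1<..1} = 1" for n
    proof -
      have "- 1 < s x" for x using s01[rule_format, of x] by linarith
      then have "s -` {-1<..1} \<inter> space (\<mu> n) = space (\<mu> n)" using s01 by auto
      then show ?thesis unfolding \<nu>_def
        by (subst measure_distr[OF sm']) (auto simp: prob_space.prob_space[OF P2_D(1)[OF \<mu>]])
    qed
    then show "\<exists>a b. a < b \<and> (\<forall>n. measure (\<nu> n) {a<..b} > 1 - e)"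
      using e by (intro exI[of _ "-1"] exI[of _ 1]) auto
  qed
  then obtain r M where r: "strict_mono (r :: nat \<Rightarrow> nat)" and M: "real_distribution M" "weak_conv_m (\<nu> \<circ> id \<circ> r) M"
    using tight_imp_convergent_subsubsequence[of \<nu> id] by (auto simp: strict_mono_def)
  interpret M: real_distribution M by (rule M)
  have conv: "(\<lambda>k. \<integral>x. G (s x) \<partial>\<mu> (r k)) \<longlonglongrightarrow> (\<integral>x. G x \<partial>M)"
    if G: "continuous_on UNIV G" "\<And>x. \<bar>G x\<bar> \<le> B" for G :: "real \<Rightarrow> real" and B
  proof -
    have "(\<lambda>k. integral\<^sup>L ((\<nu> \<circ> id \<circ> r) k) G) \<longlonglongrightarrow> integral\<^sup>L M G"
    proof (rule weak_conv_imp_integral_bdd_continuous_conv[OF _ M(1) M(2)])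
      show "real_distribution ((\<nu> \<circ> id \<circ> r) n)" for n using rd by simp
      show "isCont G x" for x using G(1) by (simp add: continuous_on_eq_continuous_at)
      show "norm (G x) \<le> B" for x using G(2) by simp
    qed
    moreover have "integral\<^sup>L (\<nu> n) G = (\<integral>x. G (s x) \<partial>\<mu> n)" for n
      unfolding \<nu>_def using G(1) by (intro integral_distr sm') (rule borel_measurable_continuous_onI)
    ultimately show ?thesis by simp
  qed
  \<comment> \<open>The truncated distance to \<open>K\<close> is bounded and continuous and has
    integral 0 for each transported measure, hence also for the limit.\<close>
  have MK: "AE x in M. x \<in> K"
  proof -
    have Sne: "K \<noteq> {}" using sK[OF x0] by auto
    let ?f = "\<lambda>x. min 1 (infdist x K)"
    have c: "continuous_on UNIV ?f" by (intro continuous_intros)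
    have "(\<lambda>k. \<integral>x. ?f (s x) \<partial>\<mu> (r k)) \<longlonglongrightarrow> (\<integral>x. ?f x \<partial>M)"
      by (rule conv[OF c, of 1]) (auto simp: infdist_nonneg)
    moreover have "(\<integral>x. ?f (s x) \<partial>\<mu> n) = (\<integral>x. 0 \<partial>\<mu> n)" for n
      using sK P2_D(3)[OF \<mu>] by (intro Bochner_Integration.integral_cong) auto
    ultimately have "(\<integral>x. ?f x \<partial>M) = 0" by (simp add: LIMSEQ_const_iff)
    moreover have "integrable M ?f"
      using borel_measurable_continuous_onI[OF c]
      by (intro M.integrable_const_bound[where B=1]) (auto simp: infdist_nonneg)
    ultimately have "AE x in M. ?f x = 0"
      using integral_nonneg_eq_0_iff_AE[of M ?f] by (auto simp: infdist_nonneg)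
    then show ?thesis
    proof eventually_elim
      case (elim x)
      then have "infdist x K = 0" by (simp add: min_def split: if_splits)
      then show ?case using in_closed_iff_infdist_zero[OF clK Sne] by simp
    qed
  qed
  \<comment> \<open>The constant value off the closed set \<open>K\<close> makes the map total and
    Borel; the limit measure does not charge the complement of \<open>K\<close>.\<close>
  define \<phi>' where "\<phi>' x = (if x \<in> K then \<phi> x else x0)" for x
  have \<phi>X: "\<phi>' x \<in> mspace X" for x
    using \<phi>c x0 by (auto simp: \<phi>'_def continuous_map_def Pi_iff)
  have \<phi>m: "\<phi>' \<in> measurable borel (borel_of X)"
    unfolding borel_of_def
  proof (rule measurable_sigma_sets)
    show "sets (sigma (mspace X) {U. openin (mtopology_of X) U}) = sigma_sets (mspace X) {U. openin (mtopology_of X) U}"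
      using openin_subset[of "mtopology_of X"] by (intro sets_measure_of) auto
    show "{U. openin (mtopology_of X) U} \<subseteq> Pow (mspace X)" using openin_subset[of "mtopology_of X"] by auto
    show "\<phi>' \<in> space borel \<rightarrow> mspace X" using \<phi>X by auto
    fix U assume "U \<in> {U. openin (mtopology_of X) U}"
    then have "openin (top_of_set K) {x \<in> topspace (top_of_set K). \<phi> x \<in> U}"
      using \<phi>c by (intro openin_continuous_map_preimage) auto
    then obtain O' where O': "open O'" "{x \<in> K. \<phi> x \<in> U} = K \<inter> O'" by (auto simp: openin_open)
    have "\<phi>' -` U \<inter> space borel = (K \<inter> O') \<union> (if x0 \<in> U then - K else {})"
    proof (rule set_eqI)
      fix x
      have "(x \<in> K \<and> \<phi> x \<in> U) = (x \<in> K \<and> x \<in> O')" using O'(2) by blast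
      then show "x \<in> \<phi>' -` U \<inter> space borel \<longleftrightarrow> x \<in> (K \<inter> O') \<union> (if x0 \<in> U then - K else {})"
        by (cases "x \<in> K") (simp_all add: \<phi>'_def)
    qed
    also have "\<dots> \<in> sets borel" using clK O'(1) by auto
    finally show "\<phi>' -` U \<inter> space borel \<in> sets borel" .
  qed
  have \<phi>m': "\<phi>' \<in> measurable M (borel_of X)" using \<phi>m by simp
  define \<mu>' where "\<mu>' = distr M (borel_of X) \<phi>'"
  have "\<mu>' \<in> P2 X" using M.prob_space_distr[OF \<phi>m'] by (simp add: P2_def \<mu>'_def)
  moreover have "weak_star_conv X (\<lambda>k. \<mu> (r k)) \<mu>'"
    unfolding weak_star_conv_def
  proof (intro allI impI)
    fix g assume g: "contr X g"
    obtain B where B: "B \<ge> 0" "\<And>x. x \<in> mspace X \<Longrightarrow> \<bar>g x\<bar> \<le> B" using cont_bounded[OF X g] by blast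
    have "continuous_on K (g \<circ> \<phi>)"
      using continuous_map_compose[OF \<phi>c g] by simp
    moreover have "norm ((g \<circ> \<phi>) x) \<le> B" if "x \<in> K" for x
      using B(2)[OF \<phi>X[of x]] that by (simp add: \<phi>'_def)
    \<comment> \<open>Convergence of real distributions is tested against functions on the whole
      line, so the test function, read on \<open>K\<close> through the inverse code, is extended
      with the same bound.\<close>
    ultimately obtain G where G: "continuous_on UNIV G" "\<And>x. x \<in> K \<Longrightarrow> G x = (g \<circ> \<phi>) x" "\<And>x. norm (G x) \<le> B"
      using Tietze[of K "g \<circ> \<phi>" UNIV B] clK B(1) by auto
    have "(\<lambda>k. \<integral>x. G (s x) \<partial>\<mu> (r k)) \<longlonglongrightarrow> (\<integral>x. G x \<partial>M)"
      by (rule conv[OF G(1), of B]) (use G(3) in auto)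
    moreover have "(\<integral>x. G (s x) \<partial>\<mu> n) = (\<integral>x. g x \<partial>\<mu> n)" for n
      using P2_D(3)[OF \<mu>] sK \<phi>s G(2) by (intro Bochner_Integration.integral_cong) auto
    moreover have "(\<integral>x. G x \<partial>M) = (\<integral>x. g (\<phi>' x) \<partial>M)"
    proof (rule integral_cong_AE)
      show "AE x in M. G x = g (\<phi>' x)" using MK by eventually_elim (auto simp: G(2) \<phi>'_def)
    qed (use borel_measurable_continuous_onI[OF G(1)] measurable_compose[OF \<phi>m' cont_measurable[OF g]] in auto)
    moreover have "\<dots> = (\<integral>x. g x \<partial>\<mu>')"
      unfolding \<mu>'_def by (rule integral_distr[symmetric, OF \<phi>m' cont_measurable[OF g]])
    ultimately show "(\<lambda>k. \<integral>x. g x \<partial>\<mu> (r k)) \<longlonglongrightarrow> (\<integral>x. g x \<partial>\<mu>')" by simp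
  qed
  ultimately show ?thesis using that r by blast
qed

section \<open>Regularity\<close>

text \<open>Sets that can be squeezed between a closed and an open set with small gap form a
  sigma-algebra. It contains the open sets because these are increasing unions of closed sets in a
  metric space.\<close>

lemma borel_regular:
  assumes M: "finite_measure M" "sets M = sets (borel_of X)" and A: "A \<in> sets M" and e: "0 < (e::real)"
  obtains K U where "closedin (mtopology_of X) K" "openin (mtopology_of X) U" "K \<subseteq> A" "A \<subseteq> U" "measure M (U - K) < e"
proof -
  interpret finite_measure M by (rule M)
  let ?T = "mtopology_of X"
  have op: "U \<in> sets M" if "openin ?T U" for U using openin_sets_borel_of[OF that] M(2) by simp
  have cl: "K \<in> sets M" if "closedin ?T K" for K using closedin_sets_borel_of[OF that] M(2) by simp
  have "A \<in> sigma_sets (mspace X) {U. openin ?T U}"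
    using A M(2) openin_subset[of ?T] unfolding borel_of_def by (subst (asm) sets_measure_of) auto
  then have "\<forall>e>0. \<exists>K U. closedin ?T K \<and> openin ?T U \<and> K \<subseteq> A \<and> A \<subseteq> U \<and> measure M (U - K) < e"
  proof induction
    case (Basic A)
    then have A: "openin ?T A" by simp
    show ?case
    proof (intro allI impI)
      fix e :: real assume e: "0 < e"
      have "fsigma_in ?T A"
        using A by (intro open_imp_fsigma_in) (auto simp: mtopology_of_def Metric_space.metrizable_space_mtopology)
      then obtain C where C: "\<And>n. closedin ?T (C n)" "\<And>n. C n \<subseteq> C (Suc n)" "\<Union> (range C) = A"
        unfolding fsigma_in_ascending by auto
      have "(\<lambda>n. measure M (C n)) \<longlonglongrightarrow> measure M (\<Union> (range C))"
        using C cl by (intro finite_Lim_measure_incseq) (auto simp: incseq_Suc_iff)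
      then have "\<forall>\<^sub>F n in sequentially. measure M A - e < measure M (C n)"
        using e C(3) by (intro order_tendstoD(1)) auto
      then obtain n where n: "measure M A - e < measure M (C n)" by (auto simp: eventually_sequentially)
      have "C n \<subseteq> A" using C(3) by auto
      then have "measure M (A - C n) = measure M A - measure M (C n)" using op[OF A] cl[OF C(1)] by (intro finite_measure_Diff)
      then show "\<exists>K U. closedin ?T K \<and> openin ?T U \<and> K \<subseteq> A \<and> A \<subseteq> U \<and> measure M (U - K) < e"
        using n C(1)[of n] A \<open>C n \<subseteq> A\<close> by (intro exI[of _ "C n"] exI[of _ A]) auto
    qed
  next
    case Empty
    then show ?case by (auto intro!: exI[of _ "{}"])
  next
    case (Compl A)
    have As: "A \<subseteq> mspace X" using Compl(1) openin_subset[of ?T] by (intro sigma_sets_into_sp[of "{U. openin ?T U}"]) auto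
    show ?case
    proof (intro allI impI)
      fix e :: real assume "0 < e"
      then obtain K U where KU: "closedin ?T K" "openin ?T U" "K \<subseteq> A" "A \<subseteq> U" "measure M (U - K) < e"
        using Compl(2)[rule_format, of e] by blast
      have "(mspace X - K) - (mspace X - U) = U - K" using openin_subset[OF KU(2)] by auto
      moreover have "closedin ?T (mspace X - U)" "openin ?T (mspace X - K)"
        using KU(1,2) by (metis closedin_topspace closedin_diff topspace_mtopology_of, metis openin_topspace openin_diff topspace_mtopology_of)
      moreover have "mspace X - U \<subseteq> mspace X - A" "mspace X - A \<subseteq> mspace X - K" using KU(3,4) by auto
      ultimately show "\<exists>K U. closedin ?T K \<and> openin ?T U \<and> K \<subseteq> mspace X - A \<and> mspace X - A \<subseteq> U \<and> measure M (U - K) < e"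
        using KU(5) by metis
    qed
  next
    case (Union A)
    show ?case
    proof (intro allI impI)
      fix e :: real assume e: "0 < e"
      \<comment> \<open>The tolerances add up to e/2; the other half is kept for replacing the
        infinite union of closed sets by a finite one.\<close>
      define R where "R i p \<longleftrightarrow> closedin ?T (fst p) \<and> openin ?T (snd p) \<and> fst p \<subseteq> A i \<and> A i \<subseteq> snd p \<and>
        measure M (snd p - fst p) < e / 2 * (1 / 2) ^ Suc i" for i p
      have "\<exists>p. R i p" for i
      proof -
        have "0 < e / 2 * (1 / 2) ^ Suc i" using e by simp
        from Union(2)[of i, rule_format, OF this] obtain K U where "R i (K, U)" unfolding R_def by auto
        then show ?thesis ..
      qed
      then obtain p where R: "\<And>i. R i (p i)" by metis
      define K where "K i = fst (p i)" for i
      define U where "U i = snd (p i)" for i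
      have KU: "\<And>i. closedin ?T (K i)" "\<And>i. openin ?T (U i)" "\<And>i. K i \<subseteq> A i" "\<And>i. A i \<subseteq> U i"
        "\<And>i. measure M (U i - K i) < e / 2 * (1 / 2) ^ Suc i"
        using R unfolding R_def K_def U_def by blast+
      let ?V = "\<Union>i. U i"
      have VD: "?V - (\<Union>i. K i) \<subseteq> (\<Union>i. U i - K i)" by auto
      have sums: "(\<lambda>i. e / 2 * (1 / 2) ^ Suc i) sums (e / 2 * 1)" by (intro sums_mult power_half_series)
      have sm: "summable (\<lambda>i. measure M (U i - K i))"
        by (rule summable_comparison_test'[OF sums_summable[OF sums], of 0]) (simp only: real_norm_def abs_of_nonneg[OF measure_nonneg] less_imp_le[OF KU(5)])
      have D: "measure M (?V - (\<Union>i. K i)) \<le> e / 2"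
      proof -
        have "measure M (?V - (\<Union>i. K i)) \<le> measure M (\<Union>i. U i - K i)"
          by (intro finite_measure_mono VD sets.countable_UN sets.Diff image_subsetI op[OF KU(2)] cl[OF KU(1)])
        also have "\<dots> \<le> (\<Sum>i. measure M (U i - K i))"
          by (intro finite_measure_subadditive_countably sm image_subsetI sets.Diff op[OF KU(2)] cl[OF KU(1)])
        also have "\<dots> \<le> (\<Sum>i. e / 2 * (1 / 2) ^ Suc i)"
          by (rule suminf_le[OF less_imp_le[OF KU(5)] sm sums_summable[OF sums]])
        also have "\<dots> = e / 2" using sums_unique[OF sums] by simp
        finally show ?thesis .
      qed
      \<comment> \<open>An infinite union of closed sets need not be closed. Continuity from above
        gives a finite union whose gap is still below \<open>e\<close>.\<close>
      have "(\<lambda>n. measure M (?V - (\<Union>i\<le>n. K i))) \<longlonglongrightarrow> measure M (\<Inter>n. ?V - (\<Union>i\<le>n. K i))"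
        using op[OF KU(2)] cl[OF KU(1)] by (intro finite_Lim_measure_decseq) (auto simp: decseq_def)
      moreover have "(\<Inter>n. ?V - (\<Union>i\<le>n. K i)) = ?V - (\<Union>i. K i)" by auto
      ultimately have "\<forall>\<^sub>F n in sequentially. measure M (?V - (\<Union>i\<le>n. K i)) < e"
        using D e by (intro order_tendstoD(2)[where y="measure M (?V - (\<Union>i. K i))"]) auto
      then obtain n where n: "measure M (?V - (\<Union>i\<le>n. K i)) < e" by (auto simp: eventually_sequentially)
      have "closedin ?T (\<Union>i\<le>n. K i)" using KU(1) by (intro closedin_Union) auto
      moreover have "openin ?T ?V" using KU(2) by (intro openin_Union) auto
      moreover have "(\<Union>i\<le>n. K i) \<subseteq> (\<Union>i. A i)" "(\<Union>i. A i) \<subseteq> ?V" using KU(3,4) by blast+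
      ultimately show "\<exists>K U. closedin ?T K \<and> openin ?T U \<and> K \<subseteq> \<Union> (range A) \<and> \<Union> (range A) \<subseteq> U \<and> measure M (U - K) < e"
        using n by blast
    qed
  qed
  then show ?thesis using e that by blast
qed

section \<open>Continuous test functions determine a measure\<close>

lemma urysohn:
  assumes "closedin (mtopology_of X) K" "closedin (mtopology_of X) L" "K \<inter> L = {}"
  obtains h where "contr X h" "\<forall>x\<in>mspace X. 0 \<le> h x \<and> h x \<le> 1" "\<forall>x\<in>K. h x = 1" "\<forall>x\<in>L. h x = 0"
proof -
  have "normal_space (mtopology_of X)"
    by (simp add: mtopology_of_def Metric_space.normal_space_mtopology)
  then obtain h where h: "continuous_map (mtopology_of X) (top_of_set {0..1::real}) h" "h ` L \<subseteq> {0}" "h ` K \<subseteq> {1}"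
    using Urysohn_lemma[of "mtopology_of X" L K 0 1] assms by (auto simp: disjnt_def)
  have "contr X h" using h(1) by (simp add: continuous_map_in_subtopology)
  moreover have "\<forall>x\<in>mspace X. 0 \<le> h x \<and> h x \<le> 1"
    using h(1) by (auto simp: continuous_map_in_subtopology Pi_iff image_subset_iff)
  moreover have "\<forall>x\<in>K. h x = 1" "\<forall>x\<in>L. h x = 0" using h by auto
  ultimately show ?thesis by (rule that)
qed

text \<open>A Urysohn function that is 1 on a closed set approximating A from inside for \<mu>, and
  0 off an open set approximating A from outside for \<mu>', transfers the measure from one side to
  the other. Equality follows by exchanging the roles.\<close>

lemma P2_le_if_integrals_eq:
  assumes X: "compact_space (mtopology_of X)" and P2: "\<mu> \<in> P2 X" "\<mu>' \<in> P2 X"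
    and eq: "\<And>g. contr X g \<Longrightarrow> (\<integral>x. g x \<partial>\<mu>) = (\<integral>x. g x \<partial>\<mu>')" and A: "A \<in> sets (borel_of X)"
  shows "measure \<mu> A \<le> measure \<mu>' A"
proof (rule field_le_epsilon)
  fix e :: real assume e: "0 < e"
  interpret a: prob_space \<mu> by (rule P2_D(1)[OF P2(1)])
  interpret b: prob_space \<mu>' by (rule P2_D(1)[OF P2(2)])
  have s: "sets \<mu> = sets (borel_of X)" "sets \<mu>' = sets (borel_of X)" using P2_D(2)[OF P2(1)] P2_D(2)[OF P2(2)] .
  obtain K U where K: "closedin (mtopology_of X) K" "openin (mtopology_of X) U" "K \<subseteq> A" "A \<subseteq> U" "measure \<mu> (U - K) < e / 2"
    by (rule borel_regular[of \<mu> X A "e / 2"]) (use A s e in \<open>auto simp: a.finite_measure_axioms\<close>)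
  obtain K' U' where K': "closedin (mtopology_of X) K'" "openin (mtopology_of X) U'" "K' \<subseteq> A" "A \<subseteq> U'" "measure \<mu>' (U' - K') < e / 2"
    by (rule borel_regular[of \<mu>' X A "e / 2"]) (use A s e in \<open>auto simp: b.finite_measure_axioms\<close>)
  have m: "K \<in> sets \<mu>" "U \<in> sets \<mu>" "K' \<in> sets \<mu>'" "U' \<in> sets \<mu>'" "A \<in> sets \<mu>" "A \<in> sets \<mu>'" "K \<in> sets \<mu>'" "U' \<in> sets \<mu>"
    using K K' A s closedin_sets_borel_of openin_sets_borel_of by auto
  have "closedin (mtopology_of X) (mspace X - U')"
    using K'(2) by (metis closedin_topspace closedin_diff topspace_mtopology_of)
  moreover have "K \<inter> (mspace X - U') = {}" using K(3) K'(4) by auto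
  ultimately obtain h where h: "contr X h" "\<forall>x\<in>mspace X. 0 \<le> h x \<and> h x \<le> 1" "\<forall>x\<in>K. h x = 1"
    "\<forall>x\<in>mspace X - U'. h x = 0"
    using urysohn[OF K(1)] by blast
  have iU: "integrable \<mu>' (indicator U' :: 'a \<Rightarrow> real)"
    using m by (simp add: integrable_indicator_iff b.emeasure_eq_measure)
  have i: "integrable \<mu> h" "integrable \<mu>' h" using cont_integrable[OF X _ h(1)] P2 by auto
  have "measure \<mu> A \<le> measure \<mu> (U - K) + measure \<mu> K"
  proof -
    have "A \<subseteq> (U - K) \<union> K" using K(4) by auto
    then have "measure \<mu> A \<le> measure \<mu> ((U - K) \<union> K)" using m by (intro a.finite_measure_mono) auto
    also have "\<dots> \<le> measure \<mu> (U - K) + measure \<mu> K" using m by (intro measure_Un_le) auto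
    finally show ?thesis .
  qed
  also have "measure \<mu> K = (\<integral>x. indicator K x \<partial>\<mu>)" using m by simp
  also have "\<dots> \<le> (\<integral>x. h x \<partial>\<mu>)"
    using h i m P2_D(3)[OF P2(1)] by (intro integral_mono') (auto simp: indicator_def)
  also have "\<dots> = (\<integral>x. h x \<partial>\<mu>')" by (rule eq[OF h(1)])
  also have "\<dots> \<le> (\<integral>x. indicator U' x \<partial>\<mu>')"
    using h(2,4) P2_D(3)[OF P2(2)] by (intro integral_mono[OF i(2) iU]) (auto simp: indicator_def)
  also have "\<dots> = measure \<mu>' U'" using m by simp
  also have "\<dots> \<le> measure \<mu>' (U' - K') + measure \<mu>' A"
  proof -
    have "U' \<subseteq> (U' - K') \<union> A" using K'(3) by auto
    then have "measure \<mu>' U' \<le> measure \<mu>' ((U' - K') \<union> A)" using m by (intro b.finite_measure_mono) auto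
    also have "\<dots> \<le> measure \<mu>' (U' - K') + measure \<mu>' A" using m by (intro measure_Un_le) auto
    finally show ?thesis .
  qed
  finally show "measure \<mu> A \<le> measure \<mu>' A + e" using K(5) K'(5) by simp
qed

text \<open>Couplings of arbitrarily small cost force equal integrals of each continuous g, since |g
  x - g y| is at most e/2 plus a constant times the squared distance. The infimum need not be known
  to be attained.\<close>

lemma W2_eq_0_imp_eq:
  assumes X: "compact_space (mtopology_of X)" and P2: "\<mu> \<in> P2 X" "\<mu>' \<in> P2 X" and W: "W2 X \<mu> \<mu>' = 0"
  shows "\<mu> = \<mu>'"
proof -
  have eq: "(\<integral>x. g x \<partial>\<mu>) = (\<integral>x. g x \<partial>\<mu>')" if g: "contr X g" for g
  proof -
    have "\<bar>(\<integral>x. g x \<partial>\<mu>) - (\<integral>x. g x \<partial>\<mu>')\<bar> \<le> 0"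
    proof (rule field_le_epsilon)
      fix e :: real assume e: "0 < e"
      obtain B where B: "B \<ge> 0" "\<And>x. x \<in> mspace X \<Longrightarrow> \<bar>g x\<bar> \<le> B" using cont_bounded[OF X g] by blast
      obtain d where d: "d > 0" "\<And>x y. x \<in> mspace X \<Longrightarrow> y \<in> mspace X \<Longrightarrow> mdist X x y < d \<Longrightarrow> \<bar>g x - g y\<bar> < e / 2"
        using cont_uniformly[OF X g, of "e / 2"] e by auto
      \<comment> \<open>For pairs at distance at least \<open>d\<close> this constant makes c d^2
        equal to 2 B, the largest possible oscillation of g; closer pairs are covered by uniform
        continuity.\<close>
      define c where "c = 2 * B / d\<^sup>2"
      have c: "0 \<le> c" using B d by (simp add: c_def)
      obtain \<pi> where \<pi>: "\<pi> \<in> couplings X \<mu> \<mu>'" "cost X \<pi> < 0 + e / (2 * (c + 1))"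
        using W2_squared_approx[OF P2, of "e / (2 * (c + 1))"] e c W by auto
      interpret prob_space \<pi> by (rule couplings_prob_space[OF \<pi>(1) P2(1)])
      have gm: "g \<in> borel_measurable (borel_of X)" by (rule cont_measurable[OF g])
      have fs: "fst \<in> measurable \<pi> (borel_of X)" "snd \<in> measurable \<pi> (borel_of X)"
        by (simp_all add: couplings_measurable[OF \<pi>(1)])
      have i: "integrable \<pi> (\<lambda>p. g (fst p))" "integrable \<pi> (\<lambda>p. g (snd p))"
        using cont_integrable[OF X _ g] P2 fs gm couplings_D(3,4)[OF \<pi>(1)] by (metis integrable_distr)+
      have "(\<integral>x. g x \<partial>\<mu>) = (\<integral>p. g (fst p) \<partial>\<pi>)" "(\<integral>x. g x \<partial>\<mu>') = (\<integral>p. g (snd p) \<partial>\<pi>)"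
        using fs gm couplings_D(3,4)[OF \<pi>(1)] by (metis integral_distr)+
      then have "\<bar>(\<integral>x. g x \<partial>\<mu>) - (\<integral>x. g x \<partial>\<mu>')\<bar> = \<bar>\<integral>p. g (fst p) - g (snd p) \<partial>\<pi>\<bar>" using i by simp
      also have "\<dots> \<le> (\<integral>p. \<bar>g (fst p) - g (snd p)\<bar> \<partial>\<pi>)" by (rule integral_abs_bound)
      also have "\<dots> \<le> (\<integral>p. e / 2 + c * (mdist X (fst p) (snd p))\<^sup>2 \<partial>\<pi>)"
      proof (rule integral_mono)
        show "integrable \<pi> (\<lambda>p. \<bar>g (fst p) - g (snd p)\<bar>)" using i by auto
        show "integrable \<pi> (\<lambda>p. e / 2 + c * (mdist X (fst p) (snd p))\<^sup>2)"
          using cost_integrable[OF X \<pi>(1) P2(1)] by (simp add: case_prod_beta')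
        fix p assume "p \<in> space \<pi>"
        then have p: "fst p \<in> mspace X" "snd p \<in> mspace X"
          unfolding couplings_D(2)[OF \<pi>(1)] by (simp_all add: mem_Times_iff)
        show "\<bar>g (fst p) - g (snd p)\<bar> \<le> e / 2 + c * (mdist X (fst p) (snd p))\<^sup>2"
        proof (cases "mdist X (fst p) (snd p) < d")
          case True
          then show ?thesis using d(2)[OF p True] c by (smt (verit) mult_nonneg_nonneg zero_le_power2)
        next
          case False
          then have "d\<^sup>2 \<le> (mdist X (fst p) (snd p))\<^sup>2" using d(1) by (intro power_mono) auto
          then have "c * d\<^sup>2 \<le> c * (mdist X (fst p) (snd p))\<^sup>2" using c by (rule mult_left_mono)
          moreover have "c * d\<^sup>2 = 2 * B" using d(1) by (simp add: c_def)
          ultimately show ?thesis using B(2)[OF p(1)] B(2)[OF p(2)] e by linarith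
        qed
      qed
      also have "\<dots> = e / 2 + c * cost X \<pi>"
        using cost_integrable[OF X \<pi>(1) P2(1)] by (simp add: case_prod_beta' prob_space)
      also have "\<dots> \<le> e / 2 + c * (e / (2 * (c + 1)))" using \<pi>(2) c by (intro add_left_mono mult_left_mono) auto
      also have "\<dots> \<le> 0 + e" using c e by (simp add: field_simps)
      finally show "\<bar>(\<integral>x. g x \<partial>\<mu>) - (\<integral>x. g x \<partial>\<mu>')\<bar> \<le> 0 + e" .
    qed
    then show ?thesis by simp
  qed
  interpret a: prob_space \<mu> by (rule P2_D(1)[OF P2(1)])
  interpret b: prob_space \<mu>' by (rule P2_D(1)[OF P2(2)])
  show ?thesis
  proof (rule measure_eqI)
    show "sets \<mu> = sets \<mu>'" using P2_D(2)[OF P2(1)] P2_D(2)[OF P2(2)] by simp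
    fix A assume "A \<in> sets \<mu>"
    then have A: "A \<in> sets (borel_of X)" using P2_D(2)[OF P2(1)] by simp
    have "measure \<mu> A = measure \<mu>' A"
      using P2_le_if_integrals_eq[OF X P2 eq A] P2_le_if_integrals_eq[OF X P2(2,1) eq[symmetric] A] by simp
    then show "emeasure \<mu> A = emeasure \<mu>' A" by (simp add: a.emeasure_eq_measure b.emeasure_eq_measure)
  qed
qed

section \<open>Affine minorants of convex functions\<close>

definition admissible :: "(real \<Rightarrow> real) \<Rightarrow> bool" where
  "admissible U \<longleftrightarrow> continuous_on {0..} U \<and> convex_on {0..} U \<and> U 0 = 0"

text \<open>The pairs (a, b) form the epigraph of the Legendre transform of U taken over [0,
  \<infinity>).\<close>

definition minorant :: "(real \<Rightarrow> real) \<Rightarrow> real \<Rightarrow> real \<Rightarrow> bool" where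
  "minorant U a b \<longleftrightarrow> (\<forall>r\<ge>0. a * r - b \<le> U r)"

lemma minorant_nonneg: "admissible U \<Longrightarrow> minorant U a b \<Longrightarrow> 0 \<le> b"
  unfolding minorant_def admissible_def by (drule spec[of _ 0]) simp

lemma minorant_convex: "convex {p. minorant U (fst p) (snd p)}"
proof (rule convexI)
  fix p q :: "real \<times> real" and u v :: real
  assume pq: "p \<in> {p. minorant U (fst p) (snd p)}" "q \<in> {p. minorant U (fst p) (snd p)}" and uv: "0 \<le> u" "0 \<le> v" "u + v = 1"
  have "(u * fst p + v * fst q) * r - (u * snd p + v * snd q) \<le> U r" if "0 \<le> r" for r
  proof -
    have "u * (fst p * r - snd p) + v * (fst q * r - snd q) \<le> u * U r + v * U r"
      using pq uv that by (intro add_mono mult_left_mono) (auto simp: minorant_def)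
    also have "\<dots> = U r" using uv by (simp flip: distrib_right)
    finally show ?thesis by (simp add: algebra_simps)
  qed
  then show "u *\<^sub>R p + v *\<^sub>R q \<in> {p. minorant U (fst p) (snd p)}" by (simp add: minorant_def)
qed

lemma minorant_sum:
  assumes "finite J" "\<And>j. j \<in> J \<Longrightarrow> minorant U (a j) (b j)" "\<And>j. j \<in> J \<Longrightarrow> 0 \<le> w j" "(\<Sum>j\<in>J. w j) = 1"
  shows "minorant U (\<Sum>j\<in>J. w j * a j) (\<Sum>j\<in>J. w j * b j)"
  unfolding minorant_def
proof (intro allI impI)
  fix r :: real assume r: "0 \<le> r"
  have "(\<Sum>j\<in>J. w j * a j) * r - (\<Sum>j\<in>J. w j * b j) = (\<Sum>j\<in>J. w j * (a j * r - b j))"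
    by (simp add: sum_distrib_left sum_distrib_right sum_subtractf algebra_simps)
  also have "\<dots> \<le> (\<Sum>j\<in>J. w j * U r)"
    using assms r by (intro sum_mono mult_left_mono) (auto simp: minorant_def)
  also have "\<dots> = U r" using assms(4) by (simp flip: sum_distrib_right)
  finally show "(\<Sum>j\<in>J. w j * a j) * r - (\<Sum>j\<in>J. w j * b j) \<le> U r" .
qed

text \<open>The slope is the right derivative, written as an infimum of difference quotients.
  Positivity of q matters: at 0 the right derivative can be -\<infinity>.\<close>

lemma support_line:
  assumes "admissible U" "0 < q"
  obtains D where "minorant U D (D * q - U q)"
proof -
  define D where "D = Inf ((\<lambda>t. (U q - U t) / (q - t)) ` ({q<..} \<inter> {0..}))"
  have "U q + D * (y - q) \<le> U y" if "0 \<le> y" for y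
    unfolding D_def using assms that by (intro convex_le_Inf_differential) (auto simp: admissible_def)
  then have "minorant U D (D * q - U q)" by (auto simp: minorant_def algebra_simps)
  then show ?thesis by (rule that)
qed

text \<open>Support lines at the positive rationals recover U on all of [0, \<infinity>), also at
  irrational points and at 0, where there may be no support line. Countability allows suprema to be
  handled by sequences and measurable selections.\<close>

lemma minorant_family:
  assumes U: "admissible U"
  obtains a b :: "nat \<Rightarrow> real" where "\<forall>n. minorant U (a n) (b n)"
    "\<forall>r\<ge>0. \<forall>e>0. \<exists>n. U r - e < a n * r - b n"
proof -
  define Q where "Q = \<rat> \<inter> {0::real<..}"
  have "1 \<in> Q" by (simp add: Q_def)
  then have Q: "countable Q" "Q \<noteq> {}" unfolding Q_def by (auto intro: countable_subset[OF _ countable_rat])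
  define q where "q = from_nat_into Q"
  have q: "range q = Q" unfolding q_def by (rule range_from_nat_into[OF Q(2,1)])
  have qpos: "0 < q n" for n
  proof -
    have "q n \<in> Q" using q by auto
    then show ?thesis by (simp add: Q_def)
  qed
  have "\<exists>D. minorant U D (D * q n - U (q n))" for n using support_line[OF U qpos] by metis
  then obtain D where D: "\<And>n. minorant U (D n) (D n * q n - U (q n))" by metis
  have "\<exists>n. U r - e < D n * r - (D n * q n - U (q n))" if r: "0 \<le> r" and e: "0 < e" for r e
  proof -
    \<comment> \<open>An affine function satisfies l(r) = 2 l(p) - l(2 p - r). For the support line
      at p this is at least \<open>h p\<close>, by contact at p and minorisation at the reflected
      point, and \<open>h p\<close> tends to U r as p decreases to r.\<close>
    define h where "h p = 2 * U p - U (2 * p - r)" for p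
    have cU: "continuous_on {0..} U" using U by (simp add: admissible_def)
    have "continuous_on {r..} h" unfolding h_def using r
      by (intro continuous_on_diff continuous_on_mult continuous_on_const continuous_on_compose2[OF cU] continuous_on_id) auto
    moreover have "h r = U r" by (simp add: h_def)
    ultimately obtain \<eta> where \<eta>: "\<eta> > 0" "\<And>p. p \<in> {r..} \<Longrightarrow> dist p r < \<eta> \<Longrightarrow> dist (h p) (U r) < e"
      using e unfolding continuous_on_iff by (metis atLeast_iff order_refl)
    obtain p where p: "p \<in> \<rat>" "r < p" "p < r + \<eta>" using Rats_dense_in_real[of r "r + \<eta>"] \<eta>(1) by auto
    then have "p \<in> Q" using r by (simp add: Q_def)
    then obtain n where n: "p = q n" using q by auto
    have "dist (h p) (U r) < e" using p by (intro \<eta>(2)) (auto simp: dist_real_def)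
    then have hp: "U r - e < h p" by (auto simp: dist_real_def)
    have "D n * (2 * p - r) - (D n * p - U p) \<le> U (2 * p - r)" using D[of n] r p by (auto simp: minorant_def n)
    then have "h p \<le> D n * r - (D n * p - U p)" by (simp add: h_def algebra_simps)
    then show ?thesis using hp n by (intro exI[of _ n]) simp
  qed
  then show ?thesis using that[of D "\<lambda>n. D n * q n - U (q n)"] D by blast
qed

text \<open>From below, U r / r is at least a n - b n / r. From above, a line that is nearly optimal
  at r has b n nonnegative, so its slope nearly bounds U r / r. The supremum may be infinite, hence
  the extended reals.\<close>

lemma slope_at_infinity_tendsto:
  assumes U: "admissible U" and a: "\<And>n. minorant U (a n) (b n)" "\<And>r e. 0 \<le> r \<Longrightarrow> 0 < e \<Longrightarrow> \<exists>n. U r - e < a n * r - b n"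
  shows "slope_at_infinity U = (SUP n. ereal (a n))"
  unfolding slope_at_infinity_def
proof (rule tendsto_Lim)
  let ?S = "SUP n. ereal (a n)"
  show "((\<lambda>r. ereal (U r / r)) \<longlongrightarrow> ?S) at_top"
  proof (rule order_tendstoI)
    fix y assume "y < ?S"
    then obtain n where n: "y < ereal (a n)" by (auto simp: less_SUP_iff)
    have "((\<lambda>r. ereal (a n - b n / r)) \<longlongrightarrow> ereal (a n - 0)) at_top"
      by (intro tendsto_ereal tendsto_diff tendsto_const tendsto_divide_0[OF tendsto_const] filterlim_at_top_imp_at_infinity filterlim_ident)
    then have "\<forall>\<^sub>F r in at_top. y < ereal (a n - b n / r)" using n by (intro order_tendstoD) auto
    then show "\<forall>\<^sub>F r in at_top. y < ereal (U r / r)"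
      using eventually_gt_at_top[of 0]
    proof eventually_elim
      case (elim r)
      have "(a n * r - b n) / r \<le> U r / r" using a(1)[of n] elim(2) by (intro divide_right_mono) (auto simp: minorant_def)
      then have "a n - b n / r \<le> U r / r" using elim(2) by (simp add: diff_divide_distrib)
      then show ?case using elim(1) by (meson ereal_less_eq(3) less_le_trans)
    qed
  next
    fix y assume y: "?S < y"
    have "ereal (U r / r) \<le> ?S" if rpos: "0 < r" for r
    proof (rule ereal_le_epsilon2)
      fix e :: real assume e: "0 < e"
      \<comment> \<open>The tolerance is scaled by r so that it becomes \<open>e\<close> after
        division by r.\<close>
      obtain n where n: "U r - e * r < a n * r - b n" using a(2)[of r "e * r"] rpos e by auto
      have "U r < (a n + e) * r" using n minorant_nonneg[OF U a(1)[of n]] by (simp add: algebra_simps)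
      then have "U r / r \<le> a n + e" using rpos by (simp add: pos_divide_le_eq)
      then have "ereal (U r / r) \<le> ereal (a n) + ereal e" by simp
      also have "\<dots> \<le> ?S + ereal e" by (intro add_right_mono SUP_upper) auto
      finally show "ereal (U r / r) \<le> ?S + ereal e" .
    qed
    then show "\<forall>\<^sub>F r in at_top. ereal (U r / r) < y"
      using y by (intro eventually_mono[OF eventually_gt_at_top[of 0]]) (auto intro: le_less_trans)
  qed
qed simp

text \<open>Prepending the given pair to a generating family leaves it a generating family, so its
  slope is one of those whose supremum is the slope at infinity.\<close>

lemma minorant_le_slope:
  assumes U: "admissible U" and m: "minorant U c d"
  shows "ereal c \<le> slope_at_infinity U"
proof -
  obtain a b :: "nat \<Rightarrow> real" where ab: "\<forall>n. minorant U (a n) (b n)" "\<forall>r\<ge>0. \<forall>e>0. \<exists>n. U r - e < a n * r - b n"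
    by (rule minorant_family[OF U])
  define a' where "a' n = (case n of 0 \<Rightarrow> c | Suc n \<Rightarrow> a n)" for n
  define b' where "b' n = (case n of 0 \<Rightarrow> d | Suc n \<Rightarrow> b n)" for n
  have "slope_at_infinity U = (SUP n. ereal (a' n))"
  proof (rule slope_at_infinity_tendsto[OF U])
    show "minorant U (a' n) (b' n)" for n using ab(1) m by (auto simp: a'_def b'_def split: nat.splits)
    show "\<exists>n. U r - e < a' n * r - b' n" if re: "0 \<le> r" "0 < e" for r e
    proof -
      obtain n where "U r - e < a n * r - b n" using ab(2) re by blast
      then show ?thesis by (intro exI[of _ "Suc n"]) (simp add: a'_def b'_def)
    qed
  qed
  also have "ereal c \<le> \<dots>" by (rule SUP_upper2[of 0]) (auto simp: a'_def)
  finally show ?thesis .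
qed

section \<open>Lebesgue decompositions\<close>

text \<open>A \<nu>-null set N of largest \<mu>-measure carries the singular part. The rest of \<mu>
  is absolutely continuous, and Radon-Nikodym provides its density.\<close>

lemma lebesgue_decomposition_exists:
  assumes \<mu>: "finite_measure \<mu>" and \<nu>: "finite_measure \<nu>" and s: "sets \<mu> = sets \<nu>"
  shows "\<exists>\<rho> \<mu>s. lebesgue_decomposition \<nu> \<mu> \<rho> \<mu>s"
proof -
  interpret m: finite_measure \<mu> by (rule \<mu>)
  interpret n: finite_measure \<nu> by (rule \<nu>)
  have sp: "space \<mu> = space \<nu>" using s by (rule sets_eq_imp_space_eq)
  define c where "c = (SUP N\<in>null_sets \<nu>. measure \<mu> N)"
  have bdd: "bdd_above (measure \<mu> ` null_sets \<nu>)"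
    by (rule bdd_aboveI2[where M="measure \<mu> (space \<mu>)"]) (rule m.bounded_measure)
  have ne: "null_sets \<nu> \<noteq> {}" using null_sets.empty_sets by auto
  have "\<exists>N\<in>null_sets \<nu>. c - 1 / Suc n < measure \<mu> N" for n
    using less_cSUP_iff[OF ne bdd, of "c - 1 / Suc n"] by (simp add: c_def)
  then obtain Nn where Nn: "\<And>n. Nn n \<in> null_sets \<nu>" "\<And>n. c - 1 / Suc n < measure \<mu> (Nn n)" by metis
  define N where "N = (\<Union>n. Nn n)"
  have N0: "N \<in> null_sets \<nu>" unfolding N_def using Nn(1) by (intro null_sets_UN)
  have Ns: "N \<in> sets \<nu>" "N \<in> sets \<mu>" using N0 s by auto
  have "c \<le> measure \<mu> N"
  proof (rule LIMSEQ_le_const2)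
    have "(\<lambda>n. 1 / real (Suc n)) \<longlonglongrightarrow> 0" by (rule LIMSEQ_Suc[OF lim_const_over_n])
    then show "(\<lambda>n. c - 1 / Suc n) \<longlonglongrightarrow> c" using tendsto_diff[OF tendsto_const, of _ 0 sequentially c] by simp
    have "c - 1 / Suc n \<le> measure \<mu> N" for n
    proof -
      have "measure \<mu> (Nn n) \<le> measure \<mu> N" using Ns unfolding N_def by (intro m.finite_measure_mono) auto
      then show ?thesis using Nn(2)[of n] by simp
    qed
    then show "\<exists>m. \<forall>n\<ge>m. c - 1 / Suc n \<le> measure \<mu> N" by blast
  qed
  \<comment> \<open>A \<nu>-null set with positive \<mu>-measure outside N could be added to N,
    exceeding the supremum \<open>c\<close>.\<close>
  have null: "measure \<mu> (A - N) = 0" if A: "A \<in> null_sets \<nu>" for A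
  proof -
    have As: "A \<in> sets \<mu>" using A s by auto
    have "measure \<mu> (N \<union> A) \<le> c" unfolding c_def using N0 A by (intro cSUP_upper bdd) auto
    moreover have "measure \<mu> (N \<union> A) = measure \<mu> N + measure \<mu> (A - N)"
      using m.finite_measure_Union[of N "A - N"] Ns As by (auto simp: Un_Diff_cancel)
    ultimately show ?thesis using \<open>c \<le> measure \<mu> N\<close> measure_nonneg[of \<mu> "A - N"] by linarith
  qed
  define \<mu>s where "\<mu>s = density \<mu> (indicator N)"
  define \<mu>a where "\<mu>a = density \<mu> (indicator (space \<mu> - N))"
  have ea: "emeasure \<mu>a A = emeasure \<mu> (A - N)" if "A \<in> sets \<mu>" for A
  proof -
    have "emeasure \<mu>a A = (\<integral>\<^sup>+x. indicator (space \<mu> - N) x * indicator A x \<partial>\<mu>)"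
      unfolding \<mu>a_def using Ns that by (intro emeasure_density) auto
    also have "\<dots> = (\<integral>\<^sup>+x. indicator (A - N) x \<partial>\<mu>)" by (intro nn_integral_cong) (auto simp: indicator_def)
    finally show ?thesis using Ns that by simp
  qed
  have es: "emeasure \<mu>s A = emeasure \<mu> (A \<inter> N)" if "A \<in> sets \<mu>" for A
  proof -
    have "emeasure \<mu>s A = (\<integral>\<^sup>+x. indicator N x * indicator A x \<partial>\<mu>)"
      unfolding \<mu>s_def using Ns that by (intro emeasure_density) auto
    also have "\<dots> = (\<integral>\<^sup>+x. indicator (A \<inter> N) x \<partial>\<mu>)" by (intro nn_integral_cong) (auto simp: indicator_def)
    finally show ?thesis using Ns that by simp
  qed
  have fa: "finite_measure \<mu>a"
    using ea[OF sets.top] by (intro finite_measureI) (simp add: \<mu>a_def m.emeasure_eq_measure)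
  have "absolutely_continuous \<nu> \<mu>a"
    unfolding absolutely_continuous_def
  proof
    fix A assume A: "A \<in> null_sets \<nu>"
    then have As: "A \<in> sets \<mu>" using s by auto
    show "A \<in> null_sets \<mu>a"
      using null[OF A] ea[OF As] As by (auto simp: null_sets_def m.emeasure_eq_measure \<mu>a_def)
  qed
  then obtain f where f: "f \<in> borel_measurable \<nu>" "density \<nu> f = \<mu>a"
    using n.Radon_Nikodym_finite_measure[OF fa] s by (auto simp: \<mu>a_def)
  have "(\<integral>\<^sup>+x. f x \<partial>\<nu>) = emeasure \<mu>a (space \<nu>)"
    unfolding f(2)[symmetric] using f(1) by (simp add: emeasure_density)
  then have "(\<integral>\<^sup>+x. f x \<partial>\<nu>) \<noteq> \<infinity>"
    using finite_measure.emeasure_finite[OF fa] by simp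
  \<comment> \<open>The Radon-Nikodym density may take the value \<infinity>; finiteness of the
    measure confines this to a null set, so a real-valued version exists.\<close>
  then have fin: "AE x in \<nu>. f x \<noteq> \<infinity>" using f(1) by (intro nn_integral_PInf_AE)
  have de: "density \<nu> (\<lambda>x. ennreal (enn2real (f x))) = \<mu>a"
    unfolding f(2)[symmetric] using f(1) fin by (intro density_cong) (auto elim!: eventually_mono simp: less_top)
  have "lebesgue_decomposition \<nu> \<mu> (\<lambda>x. enn2real (f x)) \<mu>s"
    unfolding lebesgue_decomposition_def de
  proof (intro conjI ballI bexI[of _ N] N0)
    show "(\<lambda>x. enn2real (f x)) \<in> borel_measurable \<nu>" using f(1) by measurable
    show "sets \<mu>s = sets \<nu>" by (simp add: \<mu>s_def s)
    show "emeasure \<mu>s (space \<nu> - N) = 0" using es[of "space \<nu> - N"] Ns sp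
      by (metis Diff_disjoint Int_commute emeasure_empty sets.compl_sets)
    fix A assume "A \<in> sets \<nu>"
    then have A: "A \<in> sets \<mu>" using s by simp
    have "emeasure \<mu> (A - N) + emeasure \<mu> (A \<inter> N) = emeasure \<mu> ((A - N) \<union> (A \<inter> N))"
      using A Ns by (intro plus_emeasure) auto
    also have "(A - N) \<union> (A \<inter> N) = A" by auto
    finally have "emeasure \<mu> A = emeasure \<mu> (A - N) + emeasure \<mu> (A \<inter> N)" ..
    then show "emeasure \<mu> A = emeasure \<mu>a A + emeasure \<mu>s A" by (simp add: ea[OF A] es[OF A])
  qed simp
  then show ?thesis by blast
qed

lemma integral_density_indicator:
  fixes a :: "'a \<Rightarrow> real"
  assumes "N \<in> sets M" "a \<in> borel_measurable M"
  shows "(\<integral>x. a x \<partial>density M (indicator N)) = (\<integral>x. indicator N x *\<^sub>R a x \<partial>M)"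
proof -
  have "density M (indicator N) = density M (\<lambda>x. ennreal (indicator N x))"
    by (simp add: ennreal_indicator)
  also have "(\<integral>x. a x \<partial>\<dots>) = (\<integral>x. indicator N x *\<^sub>R a x \<partial>M)"
    using assms by (intro integral_density) auto
  finally show ?thesis .
qed

text \<open>The functional uses a decomposition picked by choice, so integrals have to split for
  every one. The singular part is \<mu> restricted to N and the absolutely continuous part is \<mu>
  restricted to the complement, since each part vanishes where the other is carried.\<close>

lemma lebesgue_decomposition_integral:
  assumes fm: "finite_measure \<mu>" "finite_measure \<nu>" and s: "sets \<mu> = sets \<nu>"
    and L: "lebesgue_decomposition \<nu> \<mu> \<rho> \<mu>s"
  obtains N where "N \<in> null_sets \<nu>" "emeasure \<mu>s (space \<nu> - N) = 0" "finite_measure \<mu>s" "integrable \<nu> \<rho>"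
    "\<forall>a\<in>borel_measurable \<nu>. \<forall>B. (\<forall>x\<in>space \<nu>. \<bar>a x\<bar> \<le> (B::real)) \<longrightarrow>
       integrable \<nu> (\<lambda>x. \<rho> x * a x) \<and> integrable \<mu>s a \<and> (\<integral>x. a x \<partial>\<mu>) = (\<integral>x. \<rho> x * a x \<partial>\<nu>) + (\<integral>x. a x \<partial>\<mu>s)"
proof -
  interpret m: finite_measure \<mu> by (rule fm)
  interpret n: finite_measure \<nu> by (rule fm)
  have sp: "space \<mu> = space \<nu>" using s by (rule sets_eq_imp_space_eq)
  let ?D = "density \<nu> (\<lambda>x. ennreal (\<rho> x))"
  have \<rho>[measurable]: "\<rho> \<in> borel_measurable \<nu>" and \<rho>0: "\<And>x. x \<in> space \<nu> \<Longrightarrow> 0 \<le> \<rho> x" and ss: "sets \<mu>s = sets \<nu>"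
    and em: "\<And>A. A \<in> sets \<nu> \<Longrightarrow> emeasure \<mu> A = emeasure ?D A + emeasure \<mu>s A"
    using L by (auto simp: lebesgue_decomposition_def)
  obtain N where N: "N \<in> null_sets \<nu>" "emeasure \<mu>s (space \<nu> - N) = 0"
    using L by (auto simp: lebesgue_decomposition_def)
  have Ns[measurable]: "N \<in> sets \<nu>" "N \<in> sets \<mu>" using N s by auto
  have Nc: "space \<nu> - N \<in> sets \<mu>" using sets.compl_sets[OF Ns(1)] s by simp
  have sps: "space \<mu>s = space \<nu>" using ss by (rule sets_eq_imp_space_eq)
  have D0: "emeasure ?D A = 0" if "A \<in> null_sets \<nu>" for A
  proof -
    have "absolutely_continuous \<nu> ?D" by (rule absolutely_continuousI_density) measurable
    then show ?thesis using that unfolding absolutely_continuous_def by (auto dest: subsetD)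
  qed
  have s0: "emeasure \<mu>s (A - N) = 0" if "A \<in> sets \<nu>" for A
  proof -
    have "emeasure \<mu>s (A - N) \<le> emeasure \<mu>s (space \<nu> - N)"
      using that Ns ss sets.sets_into_space[OF that] by (intro emeasure_mono) auto
    then show ?thesis using N(2) by simp
  qed
  have sA: "emeasure \<mu>s (A \<inter> N) = emeasure \<mu>s A" if "A \<in> sets \<nu>" for A
    using plus_emeasure[of "A - N" \<mu>s "A \<inter> N"] that Ns ss s0[OF that]
    by (metis Diff_disjoint Int_Diff_disjoint Int_Diff_Un Int_commute add_0 sets.Diff sets.Int sup_commute)
  have DA: "emeasure ?D (A - N) = emeasure ?D A" if A: "A \<in> sets \<nu>" for A
  proof -
    have "emeasure ?D (A \<inter> N) = 0" using N(1) A by (intro D0) (auto intro: null_set_Int1)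
    then show ?thesis using plus_emeasure[of "A - N" ?D "A \<inter> N"] A Ns
      by (metis Diff_disjoint Int_Diff_disjoint Int_Diff_Un Int_commute add.right_neutral sets.Diff sets.Int sets_density sup_commute)
  qed
  have ds: "\<mu>s = density \<mu> (indicator N)"
  proof (rule measure_eqI)
    fix A assume "A \<in> sets \<mu>s"
    then have A: "A \<in> sets \<nu>" "A \<in> sets \<mu>" using s ss by auto
    have "emeasure (density \<mu> (indicator N)) A = (\<integral>\<^sup>+x. indicator N x * indicator A x \<partial>\<mu>)"
      using A by (intro emeasure_density) auto
    also have "\<dots> = (\<integral>\<^sup>+x. indicator (A \<inter> N) x \<partial>\<mu>)" by (intro nn_integral_cong) (auto simp: indicator_def)
    also have "\<dots> = emeasure \<mu> (A \<inter> N)" using A by simp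
    also have "\<dots> = emeasure \<mu>s A" using em[of "A \<inter> N"] A D0[of "A \<inter> N"] N(1) sA[OF A(1)] by (auto intro: null_set_Int1)
    finally show "emeasure \<mu>s A = emeasure (density \<mu> (indicator N)) A" by simp
  qed (simp add: ss s)
  have dD: "?D = density \<mu> (indicator (space \<nu> - N))"
  proof (rule measure_eqI)
    fix A assume "A \<in> sets ?D"
    then have A: "A \<in> sets \<nu>" "A \<in> sets \<mu>" using s by auto
    have "emeasure (density \<mu> (indicator (space \<nu> - N))) A = (\<integral>\<^sup>+x. indicator (space \<nu> - N) x * indicator A x \<partial>\<mu>)"
      using A Ns sp by (intro emeasure_density) (auto simp flip: sp)
    also have "\<dots> = (\<integral>\<^sup>+x. indicator (A - N) x \<partial>\<mu>)" by (intro nn_integral_cong) (auto simp: indicator_def sp)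
    also have "\<dots> = emeasure \<mu> (A - N)" using A by simp
    also have "\<dots> = emeasure ?D A" using em[of "A - N"] A s0[OF A(1)] DA[OF A(1)] by simp
    finally show "emeasure ?D A = emeasure (density \<mu> (indicator (space \<nu> - N))) A" by simp
  qed (simp add: s)
  have fs: "finite_measure \<mu>s"
    using em[OF sets.top] by (intro finite_measureI) (metis ennreal_add_eq_top infinity_ennreal_def m.emeasure_finite sps)
  have "emeasure ?D (space \<nu>) \<noteq> \<infinity>"
    using em[OF sets.top] by (metis ennreal_add_eq_top infinity_ennreal_def m.emeasure_finite)
  moreover have "emeasure ?D (space \<nu>) = (\<integral>\<^sup>+x. ennreal (\<rho> x) \<partial>\<nu>)"
    by (subst emeasure_density) (auto intro!: nn_integral_cong)
  ultimately have i\<rho>: "integrable \<nu> \<rho>" using \<rho>0 by (intro integrableI_nonneg) (auto simp: less_top)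
  have int: "integrable \<nu> (\<lambda>x. \<rho> x * a x) \<and> integrable \<mu>s a \<and> (\<integral>x. a x \<partial>\<mu>) = (\<integral>x. \<rho> x * a x \<partial>\<nu>) + (\<integral>x. a x \<partial>\<mu>s)"
    if a: "a \<in> borel_measurable \<nu>" and aB: "\<And>x. x \<in> space \<nu> \<Longrightarrow> \<bar>a x\<bar> \<le> B" for a and B :: real
  proof (intro conjI)
    have am: "a \<in> borel_measurable \<mu>" "a \<in> borel_measurable \<mu>s"
      using a by (simp_all add: measurable_cong_sets[OF s refl] measurable_cong_sets[OF ss refl])
    show "integrable \<mu>s a" using am aB sps by (intro finite_measure.integrable_const_bound[OF fs, of _ B]) auto
    have ia: "integrable \<mu> a" using am aB sp by (intro m.integrable_const_bound[of _ B]) auto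
    show i\<rho>a: "integrable \<nu> (\<lambda>x. \<rho> x * a x)"
    proof (rule Bochner_Integration.integrable_bound[of \<nu> "\<lambda>x. \<rho> x * B"])
      show "integrable \<nu> (\<lambda>x. \<rho> x * B)" using i\<rho> by simp
      show "AE x in \<nu>. norm (\<rho> x * a x) \<le> norm (\<rho> x * B)"
        using aB \<rho>0 by (intro AE_I2) (auto simp: abs_mult intro!: mult_left_mono order_trans[OF _ abs_ge_self])
    qed (use a in auto)
    have "(\<integral>x. a x \<partial>\<mu>s) = (\<integral>x. indicator N x *\<^sub>R a x \<partial>\<mu>)"
      unfolding ds by (rule integral_density_indicator[OF Ns(2) am(1)])
    moreover have "(\<integral>x. \<rho> x * a x \<partial>\<nu>) = (\<integral>x. a x \<partial>?D)"
      using a \<rho>0 by (subst integral_density) auto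
    moreover have "(\<integral>x. a x \<partial>?D) = (\<integral>x. indicator (space \<nu> - N) x *\<^sub>R a x \<partial>\<mu>)"
      unfolding dD by (rule integral_density_indicator[OF Nc am(1)])
    moreover have "(\<integral>x. a x \<partial>\<mu>) = (\<integral>x. indicator (space \<nu> - N) x *\<^sub>R a x + indicator N x *\<^sub>R a x \<partial>\<mu>)"
      using sp by (intro Bochner_Integration.integral_cong) (auto simp: indicator_def)
    moreover have "integrable \<mu> (\<lambda>x. indicator (space \<nu> - N) x *\<^sub>R a x)" "integrable \<mu> (\<lambda>x. indicator N x *\<^sub>R a x)"
      by (rule integrable_mult_indicator[OF Nc ia], rule integrable_mult_indicator[OF Ns(2) ia])
    ultimately show "(\<integral>x. a x \<partial>\<mu>) = (\<integral>x. \<rho> x * a x \<partial>\<nu>) + (\<integral>x. a x \<partial>\<mu>s)" by simp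
  qed
  show ?thesis
    by (rule that[OF N fs i\<rho>], intro ballI allI impI, rule int, assumption, rule bspec)
qed

section \<open>Dual description of the functionals\<close>

lemma ext_integral_mono: "(\<And>x. x \<in> space \<nu> \<Longrightarrow> f x \<le> g x) \<Longrightarrow> ext_integral \<nu> f \<le> ext_integral \<nu> g"
  unfolding ext_integral_def
  by (intro ereal_minus_mono) (auto simp: less_eq_ennreal.rep_eq[symmetric] intro!: nn_integral_mono ennreal_leI)

lemma ext_integral_integrable:
  assumes "integrable \<nu> f" shows "ext_integral \<nu> f = ereal (\<integral>x. f x \<partial>\<nu>)"
proof -
  have f: "(\<integral>\<^sup>+x. ennreal (f x) \<partial>\<nu>) < \<infinity>" "(\<integral>\<^sup>+x. ennreal (- f x) \<partial>\<nu>) < \<infinity>"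
    using assms by (auto simp: real_integrable_def less_top)
  then show ?thesis
    unfolding ext_integral_def real_lebesgue_integral_def[OF assms]
    by (cases "\<integral>\<^sup>+x. ennreal (f x) \<partial>\<nu>"; cases "\<integral>\<^sup>+x. ennreal (- f x) \<partial>\<nu>") (auto simp: enn2ereal_ennreal)
qed

text \<open>Monotone convergence, read backwards: if all integrals stayed below \<open>c\<close>,
  the limit would be integrable with integral at most \<open>c\<close>.\<close>

lemma ext_integral_le_SUP:
  assumes g: "\<And>k. integrable \<nu> (g k)" "\<And>k x. x \<in> space \<nu> \<Longrightarrow> g k x \<le> g (Suc k) x"
    "\<And>x. x \<in> space \<nu> \<Longrightarrow> (\<lambda>k. g k x) \<longlonglongrightarrow> f x" and c: "ereal c < ext_integral \<nu> f"
  obtains k where "c < (\<integral>x. g k x \<partial>\<nu>)"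
proof -
  have "\<exists>k. c < (\<integral>x. g k x \<partial>\<nu>)"
  proof (rule ccontr)
    assume "\<not> ?thesis"
    then have le: "(\<integral>x. g k x \<partial>\<nu>) \<le> c" for k by (auto simp: not_less)
    have "incseq (\<lambda>k. \<integral>x. g k x \<partial>\<nu>)" using g by (intro incseq_SucI integral_mono) auto
    then obtain l where l: "(\<lambda>k. \<integral>x. g k x \<partial>\<nu>) \<longlonglongrightarrow> l" "\<And>k. (\<integral>x. g k x \<partial>\<nu>) \<le> l"
      using incseq_convergent[of "\<lambda>k. \<integral>x. g k x \<partial>\<nu>" c] le by auto
    have mono: "AE x in \<nu>. mono (\<lambda>k. g k x)" using g(2) by (intro AE_I2) (auto simp: mono_iff_le_Suc)
    have lim: "AE x in \<nu>. (\<lambda>k. g k x) \<longlonglongrightarrow> f x" using g(3) by (intro AE_I2)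
    have meas: "f \<in> borel_measurable \<nu>" 
      by (rule borel_measurable_LIMSEQ_real[OF g(3) borel_measurable_integrable[OF g(1)]])
    have "integrable \<nu> f" "(\<integral>x. f x \<partial>\<nu>) = l"
      using integrable_monotone_convergence[OF g(1) mono lim l(1) meas] integral_monotone_convergence[OF g(1) mono lim l(1) meas] .
    then have "ext_integral \<nu> f = ereal l" by (simp add: ext_integral_integrable)
    moreover have "l \<le> c" using l(1) le by (intro LIMSEQ_le_const2) auto
    ultimately show False using c by simp
  qed
  then show ?thesis using that by blast
qed

lemma U_functional_decomposition:
  assumes "finite_measure \<mu>" "finite_measure \<nu>" "sets \<mu> = sets \<nu>"
  obtains \<rho> \<mu>s where "lebesgue_decomposition \<nu> \<mu> \<rho> \<mu>s"
    "U_functional U \<nu> \<mu> = ext_integral \<nu> (\<lambda>x. U (\<rho> x)) + slope_at_infinity U * enn2ereal (emeasure \<mu>s (space \<mu>s))"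
proof -
  obtain p where "(case p of (\<rho>, \<mu>s) \<Rightarrow> lebesgue_decomposition \<nu> \<mu> \<rho> \<mu>s)"
    using lebesgue_decomposition_exists[OF assms] by auto
  then have "case (SOME (\<rho>, \<mu>s). lebesgue_decomposition \<nu> \<mu> \<rho> \<mu>s) of (\<rho>, \<mu>s) \<Rightarrow> lebesgue_decomposition \<nu> \<mu> \<rho> \<mu>s"
    by (rule someI)
  moreover obtain \<rho> \<mu>s where p: "(SOME (\<rho>, \<mu>s). lebesgue_decomposition \<nu> \<mu> \<rho> \<mu>s) = (\<rho>, \<mu>s)" by (metis surj_pair)
  ultimately have "lebesgue_decomposition \<nu> \<mu> \<rho> \<mu>s" by simp
  moreover have "U_functional U \<nu> \<mu> = ext_integral \<nu> (\<lambda>x. U (\<rho> x)) + slope_at_infinity U * enn2ereal (emeasure \<mu>s (space \<mu>s))"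
    by (simp add: U_functional_def p)
  ultimately show ?thesis by (rule that)
qed

lemma U_functional_ge:
  assumes U: "admissible U" and \<mu>: "prob_space \<mu>" and \<nu>: "prob_space \<nu>" and s: "sets \<mu> = sets \<nu>"
    and a: "a \<in> borel_measurable \<nu>" "\<And>x. x \<in> space \<nu> \<Longrightarrow> \<bar>a x\<bar> \<le> B"
    and b: "b \<in> borel_measurable \<nu>" "\<And>x. x \<in> space \<nu> \<Longrightarrow> \<bar>b x\<bar> \<le> B"
    and ab: "\<And>x. x \<in> space \<nu> \<Longrightarrow> minorant U (a x) (b x)"
  shows "ereal ((\<integral>x. a x \<partial>\<mu>) - (\<integral>x. b x \<partial>\<nu>)) \<le> U_functional U \<nu> \<mu>"
proof -
  interpret m: prob_space \<mu> by (rule \<mu>)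
  interpret n: prob_space \<nu> by (rule \<nu>)
  obtain \<rho> \<mu>s where L: "lebesgue_decomposition \<nu> \<mu> \<rho> \<mu>s"
    and Ueq: "U_functional U \<nu> \<mu> = ext_integral \<nu> (\<lambda>x. U (\<rho> x)) + slope_at_infinity U * enn2ereal (emeasure \<mu>s (space \<mu>s))"
    by (rule U_functional_decomposition[OF m.finite_measure_axioms n.finite_measure_axioms s])
  obtain N where N: "N \<in> null_sets \<nu>" "emeasure \<mu>s (space \<nu> - N) = 0" "finite_measure \<mu>s" "integrable \<nu> \<rho>"
    "\<forall>a\<in>borel_measurable \<nu>. \<forall>B. (\<forall>x\<in>space \<nu>. \<bar>a x\<bar> \<le> (B::real)) \<longrightarrow>
       integrable \<nu> (\<lambda>x. \<rho> x * a x) \<and> integrable \<mu>s a \<and> (\<integral>x. a x \<partial>\<mu>) = (\<integral>x. \<rho> x * a x \<partial>\<nu>) + (\<integral>x. a x \<partial>\<mu>s)"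
    by (rule lebesgue_decomposition_integral[OF m.finite_measure_axioms n.finite_measure_axioms s L])
  interpret fs: finite_measure \<mu>s by (rule N(3))
  have \<rho>0: "\<And>x. x \<in> space \<nu> \<Longrightarrow> 0 \<le> \<rho> x" and ss: "sets \<mu>s = sets \<nu>" using L by (auto simp: lebesgue_decomposition_def)
  have sps: "space \<mu>s = space \<nu>" using ss by (rule sets_eq_imp_space_eq)
  have I: "integrable \<nu> (\<lambda>x. \<rho> x * a x)" "integrable \<mu>s a" "(\<integral>x. a x \<partial>\<mu>) = (\<integral>x. \<rho> x * a x \<partial>\<nu>) + (\<integral>x. a x \<partial>\<mu>s)"
    using N(5) a by blast+
  have ib: "integrable \<nu> b" using b by (intro n.integrable_const_bound[of _ B]) auto
  have "ereal (\<integral>x. \<rho> x * a x - b x \<partial>\<nu>) = ext_integral \<nu> (\<lambda>x. \<rho> x * a x - b x)"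
    using I(1) ib by (intro ext_integral_integrable[symmetric]) auto
  also have "\<dots> \<le> ext_integral \<nu> (\<lambda>x. U (\<rho> x))"
    using ab \<rho>0 by (intro ext_integral_mono) (auto simp: minorant_def mult.commute)
  finally have 1: "ereal (\<integral>x. \<rho> x * a x - b x \<partial>\<nu>) \<le> ext_integral \<nu> (\<lambda>x. U (\<rho> x))" .
  have sl: "ereal (a x) \<le> slope_at_infinity U" if "x \<in> space \<nu>" for x
    using minorant_le_slope[OF U ab[OF that]] .
  have 2: "ereal (\<integral>x. a x \<partial>\<mu>s) \<le> slope_at_infinity U * enn2ereal (emeasure \<mu>s (space \<mu>s))"
  \<comment> \<open>With zero singular mass the right-hand side is 0 by convention, even for
    infinite slope; with positive mass and infinite slope it is \<infinity>.\<close>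
  proof (cases "measure \<mu>s (space \<mu>s) = 0")
    case True
    then have e0: "emeasure \<mu>s (space \<mu>s) = 0" by (simp add: fs.emeasure_eq_measure)
    then have "AE x in \<mu>s. a x = 0" by (intro AE_I[of _ _ "space \<mu>s"]) auto
    then have "(\<integral>x. a x \<partial>\<mu>s) = (\<integral>x. 0 \<partial>\<mu>s)" using I(2) by (intro integral_cong_AE) auto
    then show ?thesis by (simp add: e0 zero_ennreal.rep_eq)
  next
    case False
    then have mpos: "0 < measure \<mu>s (space \<mu>s)" by (simp add: zero_less_measure_iff)
    have eq: "enn2ereal (emeasure \<mu>s (space \<mu>s)) = ereal (measure \<mu>s (space \<mu>s))"
      by (simp add: fs.emeasure_eq_measure enn2ereal_ennreal)
    show ?thesis
    proof (cases "slope_at_infinity U")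
      case (real S)
      have "(\<integral>x. a x \<partial>\<mu>s) \<le> (\<integral>x. S \<partial>\<mu>s)"
        using sl I(2) sps real by (intro integral_mono) auto
      then show ?thesis by (simp add: eq real mult.commute)
    next
      case PInf
      then show ?thesis using mpos by (simp add: eq)
    next
      case MInf
      obtain x where "x \<in> space \<nu>" using n.not_empty by auto
      then show ?thesis using sl MInf by fastforce
    qed
  qed
  have "(\<integral>x. a x \<partial>\<mu>) - (\<integral>x. b x \<partial>\<nu>) = (\<integral>x. \<rho> x * a x - b x \<partial>\<nu>) + (\<integral>x. a x \<partial>\<mu>s)"
    using I ib by simp
  then show ?thesis unfolding Ueq using add_mono[OF 1 2] by simp
qed

section \<open>Near-optimal minorant pairs\<close>

lemma ereal_less_add_split:
  fixes x y :: ereal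
  assumes "ereal c < x + y" "x \<noteq> -\<infinity>" "y \<noteq> -\<infinity>"
  obtains c1 c2 where "ereal c1 < x" "ereal c2 < y" "c < c1 + c2"
proof (cases x)
  case (real x')
  show ?thesis
  proof (cases y)
    case (real y')
    then have "c < x' + y'" using assms \<open>x = ereal x'\<close> by simp
    then show ?thesis using that[of "x' - (x' + y' - c) / 3" "y' - (x' + y' - c) / 3"] \<open>x = ereal x'\<close> real
      by (auto simp: field_simps)
  next
    case PInf
    then show ?thesis using that[of "x' - 1" "c - x' + 2"] real by auto
  qed (use assms in auto)
next
  case PInf
  show ?thesis
  proof (cases y)
    case (real y')
    then show ?thesis using that[of "c - y' + 2" "y' - 1"] PInf by auto
  next
    case PInf
    then show ?thesis using that[of "c + 1" 0] \<open>x = \<infinity>\<close> by auto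
  qed (use assms in auto)
qed (use assms in auto)

text \<open>Each new value is blended in with a Urysohn function that is 1 on the new closed set and
  0 on the earlier ones. Convexity of \<open>S\<close> keeps the blend in \<open>S\<close>; in the
  application \<open>S\<close> consists of bounded minorant pairs.\<close>

lemma closed_interpolation:
  fixes v :: "nat \<Rightarrow> real \<times> real" and m :: nat
  assumes S: "convex S" "S \<noteq> {}" and v: "\<forall>j<m. v j \<in> S"
    and K: "\<forall>j<m. closedin (mtopology_of X) (K j)" "\<forall>i<m. \<forall>j<m. i \<noteq> j \<longrightarrow> K i \<inter> K j = {}"
  shows "\<exists>a b. contr X a \<and> contr X b \<and> (\<forall>x\<in>mspace X. (a x, b x) \<in> S) \<and> (\<forall>j<m. \<forall>x\<in>K j. (a x, b x) = v j)"
  using v K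
proof (induction m)
  case 0
  obtain p where "p \<in> S" using S(2) by auto
  then show ?case by (intro exI[of _ "\<lambda>_. fst p"] exI[of _ "\<lambda>_. snd p"]) auto
next
  case (Suc m)
  then obtain a b where ab: "contr X a" "contr X b" "\<forall>x\<in>mspace X. (a x, b x) \<in> S" "\<forall>j<m. \<forall>x\<in>K j. (a x, b x) = v j"
    by auto
  have "closedin (mtopology_of X) (\<Union>j<m. K j)" using Suc.prems(2) by (intro closedin_Union) auto
  moreover have "K m \<inter> K j = {}" if "j < m" for j using Suc.prems(3) that by auto
  then have "K m \<inter> (\<Union>j<m. K j) = {}" by blast
  ultimately obtain h where h: "contr X h" "\<forall>x\<in>mspace X. 0 \<le> h x \<and> h x \<le> 1" "\<forall>x\<in>K m. h x = 1" "\<forall>x\<in>(\<Union>j<m. K j). h x = 0"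
    using urysohn[of X "K m" "\<Union>j<m. K j"] Suc.prems(2) by blast
  define a' where "a' x = h x * fst (v m) + (1 - h x) * a x" for x
  define b' where "b' x = h x * snd (v m) + (1 - h x) * b x" for x
  have "contr X a'" "contr X b'"
    unfolding a'_def b'_def using ab(1,2) h(1)
    by (intro continuous_map_add continuous_map_real_mult continuous_map_diff; simp)+
  moreover have "(a' x, b' x) \<in> S" if "x \<in> mspace X" for x
  proof -
    have "h x *\<^sub>R v m + (1 - h x) *\<^sub>R (a x, b x) \<in> S"
      using S(1) Suc.prems(1) ab(3) h(2) that by (intro convexD) auto
    then show ?thesis by (simp add: a'_def b'_def scaleR_prod_def)
  qed
  moreover have "(a' x, b' x) = v j" if "j < Suc m" "x \<in> K j" for j x
  proof (cases "j = m")
    case True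
    then show ?thesis using that h(3) by (simp add: a'_def b'_def)
  next
    case False
    then have "j < m" using that by simp
    then have "h x = 0" "(a x, b x) = v j" using h(4) ab(4) that by auto
    then show ?thesis by (simp add: a'_def b'_def)
  qed
  ultimately show ?case by blast
qed

lemma integral_diff_le:
  assumes \<mu>: "\<mu> \<in> P2 X" and f: "f \<in> borel_measurable (borel_of X)" "\<And>x. x \<in> mspace X \<Longrightarrow> \<bar>f x\<bar> \<le> M"
    and g: "g \<in> borel_measurable (borel_of X)" "\<And>x. x \<in> mspace X \<Longrightarrow> \<bar>g x\<bar> \<le> (M :: real)"
    and L: "L \<in> sets (borel_of X)" "\<And>x. x \<in> L \<Longrightarrow> f x = g x" "measure \<mu> (mspace X - L) \<le> e" and M: "0 \<le> M"
  shows "\<bar>(\<integral>x. f x \<partial>\<mu>) - (\<integral>x. g x \<partial>\<mu>)\<bar> \<le> 2 * M * e"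
proof -
  interpret prob_space \<mu> by (rule P2_D(1)[OF \<mu>])
  have i: "integrable \<mu> f" "integrable \<mu> g" using P2_integrable_bounded[OF \<mu> f] P2_integrable_bounded[OF \<mu> g] by simp_all
  have Ls: "mspace X - L \<in> sets \<mu>"
    using sets.compl_sets[OF L(1)] P2_D(2)[OF \<mu>] by simp
  have ii: "integrable \<mu> (\<lambda>x. 2 * M * indicator (mspace X - L) x)"
    using Ls by (intro integrable_mult_right) (simp add: integrable_indicator_iff emeasure_eq_measure)
  have "\<bar>(\<integral>x. f x \<partial>\<mu>) - (\<integral>x. g x \<partial>\<mu>)\<bar> = \<bar>\<integral>x. f x - g x \<partial>\<mu>\<bar>" using i by simp
  also have "\<dots> \<le> (\<integral>x. \<bar>f x - g x\<bar> \<partial>\<mu>)" by (rule integral_abs_bound)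
  also have "\<dots> \<le> (\<integral>x. 2 * M * indicator (mspace X - L) x \<partial>\<mu>)"
  proof (rule integral_mono[OF _ ii])
    show "integrable \<mu> (\<lambda>x. \<bar>f x - g x\<bar>)" using i by auto
    fix x assume "x \<in> space \<mu>"
    then have x: "x \<in> mspace X" by (simp add: P2_D(3)[OF \<mu>])
    then show "\<bar>f x - g x\<bar> \<le> 2 * M * indicator (mspace X - L) x"
      using f(2)[OF x] g(2)[OF x] L(2)[of x] by (cases "x \<in> L") (auto simp: indicator_def)
  qed
  also have "\<dots> = 2 * M * measure \<mu> (mspace X - L)" using Ls by simp
  also have "\<dots> \<le> 2 * M * e" using L(3) M by (intro mult_left_mono) auto
  finally show ?thesis .
qed

text \<open>Off a \<nu>-null set N carrying the singular part, the best of finitely many lines is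
  selected at \<rho> x. On N a line of slope close to the slope at infinity is used, which does not
  affect integrals with respect to \<nu>.\<close>

lemma U_functional_simple_minorant:
  assumes U: "admissible U" and P2: "\<mu> \<in> P2 X" "\<nu> \<in> P2 X" and c: "ereal c < U_functional U \<nu> \<mu>"
  obtains a b :: "nat \<Rightarrow> real" and I :: "'a \<Rightarrow> nat" and m where "\<forall>n. minorant U (a n) (b n)"
    "I \<in> measurable (borel_of X) (count_space UNIV)" "\<forall>x\<in>mspace X. I x < m"
    "c < (\<integral>x. a (I x) \<partial>\<mu>) - (\<integral>x. b (I x) \<partial>\<nu>)"
proof -
  interpret m: prob_space \<mu> by (rule P2_D(1)[OF P2(1)])
  interpret n: prob_space \<nu> by (rule P2_D(1)[OF P2(2)])
  have s: "sets \<mu> = sets \<nu>" and s\<nu>: "sets \<nu> = sets (borel_of X)" using P2_D(2)[OF P2(1)] P2_D(2)[OF P2(2)] by auto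
  have sp: "space \<nu> = mspace X" by (rule P2_D(3)[OF P2(2)])
  obtain \<rho> \<mu>s where L: "lebesgue_decomposition \<nu> \<mu> \<rho> \<mu>s"
    and Ueq: "U_functional U \<nu> \<mu> = ext_integral \<nu> (\<lambda>x. U (\<rho> x)) + slope_at_infinity U * enn2ereal (emeasure \<mu>s (space \<mu>s))"
    by (rule U_functional_decomposition[OF m.finite_measure_axioms n.finite_measure_axioms s])
  obtain N where N: "N \<in> null_sets \<nu>" "emeasure \<mu>s (space \<nu> - N) = 0" "finite_measure \<mu>s" "integrable \<nu> \<rho>"
    "\<forall>a\<in>borel_measurable \<nu>. \<forall>B. (\<forall>x\<in>space \<nu>. \<bar>a x\<bar> \<le> (B::real)) \<longrightarrow>
       integrable \<nu> (\<lambda>x. \<rho> x * a x) \<and> integrable \<mu>s a \<and> (\<integral>x. a x \<partial>\<mu>) = (\<integral>x. \<rho> x * a x \<partial>\<nu>) + (\<integral>x. a x \<partial>\<mu>s)"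
    by (rule lebesgue_decomposition_integral[OF m.finite_measure_axioms n.finite_measure_axioms s L])
  interpret fs: finite_measure \<mu>s by (rule N(3))
  have \<rho>0: "\<And>x. x \<in> space \<nu> \<Longrightarrow> 0 \<le> \<rho> x" and ss: "sets \<mu>s = sets \<nu>" and \<rho>m[measurable]: "\<rho> \<in> borel_measurable \<nu>"
    using L by (auto simp: lebesgue_decomposition_def)
  have sps: "space \<mu>s = space \<nu>" using ss by (rule sets_eq_imp_space_eq)
  have Ns[measurable]: "N \<in> sets \<nu>" using N(1) by auto
  obtain a b :: "nat \<Rightarrow> real" where ab: "\<forall>n. minorant U (a n) (b n)" "\<forall>r\<ge>0. \<forall>e>0. \<exists>n. U r - e < a n * r - b n"
    by (rule minorant_family[OF U])
  have slope: "slope_at_infinity U = (SUP n. ereal (a n))"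
    using ab by (intro slope_at_infinity_tendsto[OF U, where b=b]) auto
  define l where "l n r = a n * r - b n" for n r
  have lU: "l n (\<rho> x) \<le> U (\<rho> x)" if "x \<in> space \<nu>" for n x
    using ab(1) \<rho>0[OF that] by (simp add: minorant_def l_def)
  define i where "i k x = rec_nat 0 (\<lambda>k i. if l i (\<rho> x) < l (Suc k) (\<rho> x) then Suc k else i) k" for k :: nat and x
  have i0: "i 0 x = 0" and iS: "i (Suc k) x = (if l (i k x) (\<rho> x) < l (Suc k) (\<rho> x) then Suc k else i k x)" for k x
    by (simp_all add: i_def)
  have im[measurable]: "i k \<in> measurable \<nu> (count_space UNIV)" for k
  proof (induction k)
    case 0
    have "i 0 = (\<lambda>_. 0)" by (simp add: fun_eq_iff i0)
    then show ?case by simp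
  next
    case (Suc k)
    note Suc[measurable]
    have "i (Suc k) = (\<lambda>x. if a (i k x) * \<rho> x - b (i k x) < a (Suc k) * \<rho> x - b (Suc k) then Suc k else i k x)"
      by (simp add: fun_eq_iff iS l_def)
    then show ?case by (simp only:) measurable
  qed
  have ik: "i k x \<le> k" for k x by (induction k) (auto simp: i0 iS)
  define G where "G k x = l (i k x) (\<rho> x)" for k x
  have Gmono: "G k x \<le> G (Suc k) x" for k x by (simp add: G_def iS)
  have Gge: "l n (\<rho> x) \<le> G k x" if "n \<le> k" for n k x
    using that
  proof (induction k)
    case 0
    then show ?case by (simp add: G_def i0)
  next
    case (Suc k)
    then show ?case using Gmono[of k x] by (cases "n = Suc k") (auto simp: G_def iS)
  qed
  have Gint: "integrable \<nu> (G k)" for k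
  proof (rule Bochner_Integration.integrable_bound)
    show "integrable \<nu> (\<lambda>x. \<Sum>n\<le>k. \<bar>a n\<bar> * \<rho> x + \<bar>b n\<bar>)" using N(4) by simp
    show "G k \<in> borel_measurable \<nu>" unfolding G_def l_def by measurable
    show "AE x in \<nu>. norm (G k x) \<le> norm (\<Sum>n\<le>k. \<bar>a n\<bar> * \<rho> x + \<bar>b n\<bar>)"
    proof (rule AE_I2)
      fix x assume x: "x \<in> space \<nu>"
      have "\<bar>G k x\<bar> \<le> \<bar>a (i k x)\<bar> * \<rho> x + \<bar>b (i k x)\<bar>"
        using abs_triangle_ineq4[of "a (i k x) * \<rho> x" "b (i k x)"] \<rho>0[OF x] by (simp add: G_def l_def abs_mult)
      also have "\<dots> \<le> (\<Sum>n\<le>k. \<bar>a n\<bar> * \<rho> x + \<bar>b n\<bar>)"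
        using \<rho>0[OF x] ik[of k x] by (intro member_le_sum) auto
      finally show "norm (G k x) \<le> norm (\<Sum>n\<le>k. \<bar>a n\<bar> * \<rho> x + \<bar>b n\<bar>)" by simp
    qed
  qed
  have Glim: "(\<lambda>k. G k x) \<longlonglongrightarrow> U (\<rho> x)" if x: "x \<in> space \<nu>" for x
  proof (rule LIMSEQ_I)
    fix e :: real assume "0 < e"
    then obtain n where n: "U (\<rho> x) - e < l n (\<rho> x)" using ab(2) \<rho>0[OF x] unfolding l_def by blast
    have "norm (G k x - U (\<rho> x)) < e" if "n \<le> k" for k
      using n Gge[OF that, of x] lU[OF x, of "i k x"] by (simp add: G_def)
    then show "\<exists>no. \<forall>k\<ge>no. norm (G k x - U (\<rho> x)) < e" by blast
  qed
  let ?m = "measure \<mu>s (space \<mu>s)"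
  have eqm: "enn2ereal (emeasure \<mu>s (space \<mu>s)) = ereal ?m"
    by (simp add: fs.emeasure_eq_measure enn2ereal_ennreal)
  have "ereal (\<integral>x. G 0 x \<partial>\<nu>) \<le> ext_integral \<nu> (\<lambda>x. U (\<rho> x))"
    unfolding ext_integral_integrable[OF Gint, symmetric] using lU by (intro ext_integral_mono) (simp add: G_def)
  then have n1: "ext_integral \<nu> (\<lambda>x. U (\<rho> x)) \<noteq> -\<infinity>" by auto
  have a0: "ereal (a 0) \<le> slope_at_infinity U" using minorant_le_slope[OF U] ab(1) by blast
  have n2: "slope_at_infinity U * ereal ?m \<noteq> -\<infinity>"
    using a0 zero_less_measure_iff[of \<mu>s "space \<mu>s"] by (cases "slope_at_infinity U") auto
  obtain c1 c2 where c12: "ereal c1 < ext_integral \<nu> (\<lambda>x. U (\<rho> x))" "ereal c2 < slope_at_infinity U * ereal ?m" "c < c1 + c2"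
    using ereal_less_add_split[OF c[unfolded Ueq eqm] n1 n2] by blast
  obtain k where k: "c1 < (\<integral>x. G k x \<partial>\<nu>)"
    by (rule ext_integral_le_SUP[OF Gint Gmono Glim c12(1)])
  \<comment> \<open>If there is no singular mass, any index works, since slope times 0 is 0 also for
    infinite slope.\<close>
  have "\<exists>n. c2 < a n * ?m"
  proof (cases "?m = 0")
    case True
    then show ?thesis using c12(2) by (simp flip: zero_ereal_def)
  next
    case False
    then have mp: "0 < ?m" by (simp add: zero_less_measure_iff)
    have "ereal (c2 / ?m) < slope_at_infinity U"
      using c12(2) mp a0 by (cases "slope_at_infinity U") (auto simp: pos_divide_less_eq)
    then obtain n where "c2 / ?m < a n" unfolding slope by (auto simp: less_SUP_iff)
    then show ?thesis using mp by (auto simp: pos_divide_less_eq)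
  qed
  then obtain n where n: "c2 < a n * ?m" by blast
  define I where "I x = (if x \<in> N then n else i k x)" for x
  have Im[measurable]: "I \<in> measurable \<nu> (count_space UNIV)" unfolding I_def by measurable
  define m where "m = Suc (max n k)"
  have Ilt: "I x < m" for x using ik[of k x] by (auto simp: I_def m_def)
  have fin_bd: "\<bar>f (I x)\<bar> \<le> (\<Sum>j<m. \<bar>f j\<bar>)" for f :: "nat \<Rightarrow> real" and x
    using Ilt[of x] by (intro member_le_sum) auto
  have am: "(\<lambda>x. a (I x)) \<in> borel_measurable \<nu>" and bm: "(\<lambda>x. b (I x)) \<in> borel_measurable \<nu>" by measurable
  have A: "integrable \<nu> (\<lambda>x. \<rho> x * a (I x))" "integrable \<mu>s (\<lambda>x. a (I x))"
    "(\<integral>x. a (I x) \<partial>\<mu>) = (\<integral>x. \<rho> x * a (I x) \<partial>\<nu>) + (\<integral>x. a (I x) \<partial>\<mu>s)"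
    using N(5)[rule_format, OF am, of "\<Sum>j<m. \<bar>a j\<bar>"] fin_bd[of a] by auto
  have ib: "integrable \<nu> (\<lambda>x. b (I x))"
    using fin_bd[of b] bm by (intro n.integrable_const_bound[of _ "\<Sum>j<m. \<bar>b j\<bar>"]) auto
  have "AE x in \<mu>s. x \<in> N"
  proof (rule AE_I[OF _ N(2)])
    show "{x \<in> space \<mu>s. x \<notin> N} \<subseteq> space \<nu> - N" using sps by auto
    show "space \<nu> - N \<in> sets \<mu>s" using Ns ss by auto
  qed
  then have "AE x in \<mu>s. a (I x) = a n" by eventually_elim (simp add: I_def)
  then have "(\<integral>x. a (I x) \<partial>\<mu>s) = (\<integral>x. a n \<partial>\<mu>s)" using A(2) by (intro integral_cong_AE) auto
  then have s1: "(\<integral>x. a (I x) \<partial>\<mu>s) = a n * ?m" by simp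
  have "AE x in \<nu>. x \<notin> N" using N(1) by (rule AE_not_in)
  then have "AE x in \<nu>. \<rho> x * a (I x) - b (I x) = G k x" by eventually_elim (simp add: I_def G_def l_def)
  then have "(\<integral>x. \<rho> x * a (I x) - b (I x) \<partial>\<nu>) = (\<integral>x. G k x \<partial>\<nu>)" using A(1) ib Gint by (intro integral_cong_AE) auto
  then have "(\<integral>x. a (I x) \<partial>\<mu>) - (\<integral>x. b (I x) \<partial>\<nu>) = (\<integral>x. G k x \<partial>\<nu>) + a n * ?m"
    using A(1) ib by (simp add: A(3) s1)
  then have "c < (\<integral>x. a (I x) \<partial>\<mu>) - (\<integral>x. b (I x) \<partial>\<nu>)" using k n c12(3) by simp
  moreover have "I \<in> measurable (borel_of X) (count_space UNIV)" using Im by (simp add: measurable_cong_sets[OF s\<nu> refl])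
  moreover have "\<forall>x\<in>mspace X. I x < m" using Ilt by simp
  ultimately show ?thesis by (rule_tac that[OF ab(1)])
qed

text \<open>A Lusin-type argument: the level sets of the finite-valued selection are approximated
  from inside by disjoint closed sets, for \<mu> and \<nu> at once, and the values are interpolated
  continuously between them without leaving the set of minorant pairs.\<close>

lemma U_functional_less:
  assumes X: "compact_space (mtopology_of X)" and U: "admissible U" and P2: "\<mu> \<in> P2 X" "\<nu> \<in> P2 X"
    and c: "ereal c < U_functional U \<nu> \<mu>"
  obtains a b where "contr X a" "contr X b" "\<forall>x\<in>mspace X. minorant U (a x) (b x)"
    "c < (\<integral>x. a x \<partial>\<mu>) - (\<integral>x. b x \<partial>\<nu>)"
proof -
  interpret m: prob_space \<mu> by (rule P2_D(1)[OF P2(1)])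
  interpret n: prob_space \<nu> by (rule P2_D(1)[OF P2(2)])
  have s: "sets \<mu> = sets (borel_of X)" "sets \<nu> = sets (borel_of X)" using P2_D(2)[OF P2(1)] P2_D(2)[OF P2(2)] .
  obtain a b :: "nat \<Rightarrow> real" and I :: "'a \<Rightarrow> nat" and m where ab: "\<forall>n. minorant U (a n) (b n)"
    and I: "I \<in> measurable (borel_of X) (count_space UNIV)" "\<forall>x\<in>mspace X. I x < m"
    and cI: "c < (\<integral>x. a (I x) \<partial>\<mu>) - (\<integral>x. b (I x) \<partial>\<nu>)"
    by (rule U_functional_simple_minorant[OF U P2 c])
  define M where "M = (\<Sum>j<m. \<bar>a j\<bar> + \<bar>b j\<bar>)"
  have M0: "0 \<le> M" by (auto simp: M_def intro!: sum_nonneg)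
  have Mj: "\<bar>a j\<bar> \<le> M" "\<bar>b j\<bar> \<le> M" if "j < m" for j
    using member_le_sum[of j "{..<m}" "\<lambda>j. \<bar>a j\<bar> + \<bar>b j\<bar>"] that by (auto simp: M_def)
  define d where "d = (\<integral>x. a (I x) \<partial>\<mu>) - (\<integral>x. b (I x) \<partial>\<nu>) - c"
  have d: "0 < d" using cI by (simp add: d_def)
  \<comment> \<open>Outside the closed sets the functions differ by at most 2 M, so each of the two
    integrals changes by at most 2 M e. The summand 1 guards against M = 0.\<close>
  define e where "e = d / (4 * M + 1)"
  have e: "0 < e" "4 * M * e < d" using d M0 by (auto simp: e_def field_simps)
  have m0: "0 < m" using I(2) P2_mspace_nonempty[OF P2(1)] by auto
  define A where "A j = I -` {j} \<inter> mspace X" for j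
  have As: "A j \<in> sets (borel_of X)" for j
    using measurable_sets[OF I(1), of "{j}"] by (simp add: A_def)
  have em: "0 < e / m" using e m0 by simp
  have "\<exists>K. closedin (mtopology_of X) K \<and> K \<subseteq> A j \<and> measure \<mu> (A j - K) \<le> e / m \<and> measure \<nu> (A j - K) \<le> e / m" for j
  proof -
    obtain K U where K: "closedin (mtopology_of X) K" "openin (mtopology_of X) U" "K \<subseteq> A j" "A j \<subseteq> U" "measure \<mu> (U - K) < e / m"
      by (rule borel_regular[OF m.finite_measure_axioms s(1) _ em, of "A j"]) (use As s in auto)
    obtain K' U' where K': "closedin (mtopology_of X) K'" "openin (mtopology_of X) U'" "K' \<subseteq> A j" "A j \<subseteq> U'" "measure \<nu> (U' - K') < e / m"
      by (rule borel_regular[OF n.finite_measure_axioms s(2) _ em, of "A j"]) (use As s in auto)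
    have "measure \<mu> (A j - (K \<union> K')) \<le> measure \<mu> (U - K)"
      using K s closedin_sets_borel_of[of X] openin_sets_borel_of[of X] by (intro m.finite_measure_mono) auto
    moreover have "measure \<nu> (A j - (K \<union> K')) \<le> measure \<nu> (U' - K')"
      using K' s closedin_sets_borel_of[of X] openin_sets_borel_of[of X] by (intro n.finite_measure_mono) auto
    ultimately show ?thesis using K K' by (intro exI[of _ "K \<union> K'"]) auto
  qed
  then obtain K where K: "\<And>j. closedin (mtopology_of X) (K j)" "\<And>j. K j \<subseteq> A j"
    "\<And>j. measure \<mu> (A j - K j) \<le> e / m" "\<And>j. measure \<nu> (A j - K j) \<le> e / m" by metis
  define L where "L = (\<Union>j<m. K j)"
  have Ls: "L \<in> sets (borel_of X)" unfolding L_def using K(1) closedin_sets_borel_of by auto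
  have LX: "mspace X - L \<subseteq> (\<Union>j<m. A j - K j)" using I(2) by (auto simp: L_def A_def)
  have mL: "measure \<kappa> (mspace X - L) \<le> e" if \<kappa>: "\<kappa> \<in> P2 X" and le: "\<And>j. measure \<kappa> (A j - K j) \<le> e / m" for \<kappa>
  proof -
    interpret prob_space \<kappa> by (rule P2_D(1)[OF \<kappa>])
    have "A j - K j \<in> sets \<kappa>" for j using As[of j] closedin_sets_borel_of[OF K(1)] P2_D(2)[OF \<kappa>] by auto
    then have "measure \<kappa> (mspace X - L) \<le> (\<Sum>j<m. measure \<kappa> (A j - K j))"
      using LX by (intro order_trans[OF finite_measure_mono[OF LX] finite_measure_subadditive_finite]) auto
    also have "\<dots> \<le> (\<Sum>j<m. e / m)" using le by (intro sum_mono)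
    finally show ?thesis using m0 by simp
  qed
  \<comment> \<open>Intersecting with a box preserves convexity and gives the interpolated functions
    the same bound \<open>M\<close> as the selected values.\<close>
  let ?S = "{p. minorant U (fst p) (snd p)} \<inter> ({-M..M} \<times> {-M..M})"
  have "\<exists>a' b'. contr X a' \<and> contr X b' \<and> (\<forall>x\<in>mspace X. (a' x, b' x) \<in> ?S) \<and> (\<forall>j<m. \<forall>x\<in>K j. (a' x, b' x) = (a j, b j))"
  proof (rule closed_interpolation)
    show "convex ?S" by (intro convex_Int minorant_convex convex_Times convex_real_interval)
    show in_S: "\<forall>j<m. (a j, b j) \<in> ?S" using ab Mj by (auto simp: abs_le_iff minus_le_iff)
    then show "?S \<noteq> {}" using m0 by blast
    show "\<forall>j<m. closedin (mtopology_of X) (K j)" using K(1) by simp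
    show "\<forall>i<m. \<forall>j<m. i \<noteq> j \<longrightarrow> K i \<inter> K j = {}"
    proof (intro allI impI)
      fix i j :: nat assume "i \<noteq> j"
      then have "A i \<inter> A j = {}" by (auto simp: A_def)
      then show "K i \<inter> K j = {}" using K(2)[of i] K(2)[of j] by blast
    qed
  qed
  then obtain a' b' where ab': "contr X a'" "contr X b'" "\<forall>x\<in>mspace X. (a' x, b' x) \<in> ?S" "\<forall>j<m. \<forall>x\<in>K j. (a' x, b' x) = (a j, b j)"
    by blast
  have eqL: "a' x = a (I x)" "b' x = b (I x)" if xL: "x \<in> L" for x
  proof -
    obtain j where j: "j < m" "x \<in> K j" using xL by (auto simp: L_def)
    then have "I x = j" using K(2) by (auto simp: A_def)
    then show "a' x = a (I x)" "b' x = b (I x)" using ab'(4) j by auto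
  qed
  have M': "\<bar>a' x\<bar> \<le> M" "\<bar>b' x\<bar> \<le> M" if "x \<in> mspace X" for x
    using ab'(3) that by (auto simp: abs_le_iff)
  have MI: "\<bar>a (I x)\<bar> \<le> M" "\<bar>b (I x)\<bar> \<le> M" if "x \<in> mspace X" for x
    using Mj I(2) that by auto
  have meas: "(\<lambda>x. a (I x)) \<in> borel_measurable (borel_of X)" "(\<lambda>x. b (I x)) \<in> borel_measurable (borel_of X)"
    using I(1) by measurable
  have 1: "\<bar>(\<integral>x. a' x \<partial>\<mu>) - (\<integral>x. a (I x) \<partial>\<mu>)\<bar> \<le> 2 * M * e"
    by (rule integral_diff_le[OF P2(1) cont_measurable[OF ab'(1)] M'(1) meas(1) MI(1) Ls eqL(1) mL[OF P2(1) K(3)] M0])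
  have 2: "\<bar>(\<integral>x. b' x \<partial>\<nu>) - (\<integral>x. b (I x) \<partial>\<nu>)\<bar> \<le> 2 * M * e"
    by (rule integral_diff_le[OF P2(2) cont_measurable[OF ab'(2)] M'(2) meas(2) MI(2) Ls eqL(2) mL[OF P2(2) K(4)] M0])
  have "c < (\<integral>x. a' x \<partial>\<mu>) - (\<integral>x. b' x \<partial>\<nu>)"
    using 1 2 e(2) unfolding d_def by linarith
  moreover have "\<forall>x\<in>mspace X. minorant U (a' x) (b' x)" using ab'(3) by auto
  ultimately show ?thesis using that ab'(1,2) by blast
qed

text \<open>Jensen's inequality through the dual description, without identifying a Lebesgue
  decomposition of \<mu>. Pointwise, a minorant pair gives at most the sum of \<psi> j (a r j - b),
  because b is nonnegative and the \<psi> j sum to at most 1.\<close>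

lemma U_functional_mixture_le:
  assumes X: "compact_space (mtopology_of X)" and U: "admissible U" and \<nu>: "\<nu> \<in> P2 X" and \<mu>P: "\<mu> \<in> P2 X" and J: "finite J"
    and \<psi>: "\<And>j. j \<in> J \<Longrightarrow> \<psi> j \<in> borel_measurable (borel_of X)" "\<And>j x. j \<in> J \<Longrightarrow> x \<in> mspace X \<Longrightarrow> 0 \<le> \<psi> j x"
      "\<And>x. x \<in> mspace X \<Longrightarrow> (\<Sum>j\<in>J. \<psi> j x) \<le> 1"
    and r: "\<And>j. j \<in> J \<Longrightarrow> 0 \<le> r j"
    and \<mu>: "\<mu> = density \<nu> (\<lambda>x. ennreal (\<Sum>j\<in>J. r j * \<psi> j x))"
  shows "U_functional U \<nu> \<mu> \<le> ereal (\<Sum>j\<in>J. (\<integral>x. \<psi> j x \<partial>\<nu>) * U (r j))"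
proof (rule ccontr)
  assume "\<not> ?thesis"
  then have less: "ereal (\<Sum>j\<in>J. (\<integral>x. \<psi> j x \<partial>\<nu>) * U (r j)) < U_functional U \<nu> \<mu>" by simp
  obtain a b where ab: "contr X a" "contr X b" "\<forall>x\<in>mspace X. minorant U (a x) (b x)"
    "(\<Sum>j\<in>J. (\<integral>x. \<psi> j x \<partial>\<nu>) * U (r j)) < (\<integral>x. a x \<partial>\<mu>) - (\<integral>x. b x \<partial>\<nu>)"
    by (rule U_functional_less[OF X U \<mu>P \<nu> less])
  note n = P2_D[OF \<nu>]
  have m: "\<psi> j \<in> borel_measurable \<nu>" if "j \<in> J" for j
    using \<psi>(1)[OF that] by (simp add: measurable_cong_sets[OF n(2) refl])
  have \<psi>1: "\<psi> j x \<le> 1" if "j \<in> J" "x \<in> mspace X" for j x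
    using member_le_sum[of j J "\<lambda>j. \<psi> j x"] \<psi>(2,3) that J by fastforce
  have i\<psi>: "integrable \<nu> (\<psi> j)" if "j \<in> J" for j
    using P2_integrable_bounded[OF \<nu> \<psi>(1)[OF that], of 1] \<psi>(2) \<psi>1 that by auto
  obtain B where B: "B \<ge> 0" "\<And>x. x \<in> mspace X \<Longrightarrow> \<bar>a x\<bar> \<le> B" using cont_bounded[OF X ab(1)] by blast
  have am: "a \<in> borel_measurable \<nu>" by (rule cont_measurable_P2[OF \<nu> ab(1)])
  have i\<psi>a: "integrable \<nu> (\<lambda>x. \<psi> j x * a x)" if "j \<in> J" for j
  proof (rule P2_integrable_bounded[OF \<nu>])
    show "(\<lambda>x. \<psi> j x * a x) \<in> borel_measurable (borel_of X)"
      using \<psi>(1)[OF that] cont_measurable[OF ab(1)] by (rule borel_measurable_times)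
    show "\<bar>\<psi> j x * a x\<bar> \<le> 1 * B" if "x \<in> mspace X" for x
      using \<psi>(2) \<psi>1 B(2) that \<open>j \<in> J\<close> unfolding abs_mult by (intro mult_mono) auto
  qed
  have ib: "integrable \<nu> b" by (rule cont_integrable[OF X \<nu> ab(2)])
  have "(\<integral>x. a x \<partial>\<mu>) = (\<integral>x. (\<Sum>j\<in>J. r j * \<psi> j x) *\<^sub>R a x \<partial>\<nu>)"
    unfolding \<mu> using am m r \<psi>(2) n(3) by (intro integral_density AE_I2) (auto intro!: sum_nonneg)
  also have "\<dots> = (\<integral>x. (\<Sum>j\<in>J. r j * (\<psi> j x * a x)) \<partial>\<nu>)"
    by (simp add: sum_distrib_right mult.assoc)
  finally have "(\<integral>x. a x \<partial>\<mu>) - (\<integral>x. b x \<partial>\<nu>) = (\<integral>x. (\<Sum>j\<in>J. r j * (\<psi> j x * a x)) - b x \<partial>\<nu>)"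
    using ib i\<psi>a by simp
  also have "\<dots> \<le> (\<integral>x. (\<Sum>j\<in>J. \<psi> j x * U (r j)) \<partial>\<nu>)"
  proof (rule integral_mono)
    show "integrable \<nu> (\<lambda>x. (\<Sum>j\<in>J. r j * (\<psi> j x * a x)) - b x)" using ib i\<psi>a by simp
    show "integrable \<nu> (\<lambda>x. \<Sum>j\<in>J. \<psi> j x * U (r j))" using i\<psi> by simp
    fix x assume "x \<in> space \<nu>"
    then have x: "x \<in> mspace X" by (simp add: n)
    then have mi: "minorant U (a x) (b x)" using ab(3) by blast
    have "(\<Sum>j\<in>J. r j * (\<psi> j x * a x)) - b x \<le> (\<Sum>j\<in>J. r j * (\<psi> j x * a x)) - (\<Sum>j\<in>J. \<psi> j x) * b x"
      using minorant_nonneg[OF U mi] \<psi>(3)[OF x] mult_right_mono[of "\<Sum>j\<in>J. \<psi> j x" 1 "b x"] by simp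
    also have "\<dots> = (\<Sum>j\<in>J. \<psi> j x * (a x * r j - b x))"
      by (simp add: sum_distrib_left sum_distrib_right sum_subtractf algebra_simps)
    also have "\<dots> \<le> (\<Sum>j\<in>J. \<psi> j x * U (r j))"
      using mi \<psi>(2) x r by (intro sum_mono mult_left_mono) (auto simp: minorant_def)
    finally show "(\<Sum>j\<in>J. r j * (\<psi> j x * a x)) - b x \<le> (\<Sum>j\<in>J. \<psi> j x * U (r j))" .
  qed
  also have "\<dots> = (\<Sum>j\<in>J. (\<integral>x. \<psi> j x \<partial>\<nu>) * U (r j))" using i\<psi> by simp
  finally show False using ab(4) by simp
qed

text \<open>The opposite Jensen estimate: minorants that are nearly optimal at the cell ratios are
  blended by the partition of unity into one continuous minorant pair. Hypothesis \<open>z\<close>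
  makes the ratio times the \<nu>-mass equal to the \<mu>-mass also in cells without
  \<nu>-mass.\<close>

lemma U_functional_partition_ge:
  assumes X: "compact_space (mtopology_of X)" and U: "admissible U" and P2: "\<mu> \<in> P2 X" "\<nu> \<in> P2 X"
    and \<phi>: "fine_partition X \<delta> J \<phi>"
    and z: "\<And>j. j \<in> J \<Longrightarrow> (\<integral>x. \<phi> j x \<partial>\<nu>) = 0 \<Longrightarrow> (\<integral>x. \<phi> j x \<partial>\<mu>) = 0"
  shows "ereal (\<Sum>j\<in>J. (\<integral>x. \<phi> j x \<partial>\<nu>) * U ((\<integral>x. \<phi> j x \<partial>\<mu>) / (\<integral>x. \<phi> j x \<partial>\<nu>))) \<le> U_functional U \<nu> \<mu>"
proof (rule ereal_le_epsilon2)
  fix e :: real assume e: "0 < e"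
  note F = fine_partition_D[OF \<phi>] and n = P2_D[OF P2(2)]
  define N where "N j = (\<integral>x. \<phi> j x \<partial>\<nu>)" for j
  define M where "M j = (\<integral>x. \<phi> j x \<partial>\<mu>)" for j
  have M0: "0 \<le> M j" and N0: "0 \<le> N j" if "j \<in> J" for j
    unfolding M_def N_def using F(4)[OF that] P2_D(3)[OF P2(1)] P2_D(3)[OF P2(2)]
    by (auto intro!: integral_nonneg_AE AE_I2)
  have "\<exists>a b. minorant U a b \<and> U (M j / N j) - e < a * (M j / N j) - b" if "j \<in> J" for j
  proof -
    obtain a b :: "nat \<Rightarrow> real" where ab: "\<forall>n. minorant U (a n) (b n)" "\<forall>r\<ge>0. \<forall>e>0. \<exists>n. U r - e < a n * r - b n"
      by (rule minorant_family[OF U])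
    then show ?thesis using e divide_nonneg_nonneg[OF M0[OF that] N0[OF that]] by blast
  qed
  then obtain a b where ab: "\<And>j. j \<in> J \<Longrightarrow> minorant U (a j) (b j)" "\<And>j. j \<in> J \<Longrightarrow> U (M j / N j) - e < a j * (M j / N j) - b j"
    by metis
  have "(\<Sum>j\<in>J. N j * U (M j / N j)) - e = (\<Sum>j\<in>J. N j * (U (M j / N j) - e))"
    using fine_partition_sum_integral[OF X \<phi> P2(2), of "\<lambda>_. 1"] P2_measure_space[OF P2(2)]
    by (simp add: right_diff_distrib sum_subtractf n N_def flip: sum_distrib_right)
  also have "\<dots> \<le> (\<Sum>j\<in>J. N j * (a j * (M j / N j) - b j))"
    using ab(2) N0 by (intro sum_mono mult_left_mono) (auto simp: less_imp_le)
  also have "\<dots> = (\<Sum>j\<in>J. a j * M j - b j * N j)"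
    using z by (intro sum.cong refl) (auto simp: N_def M_def right_diff_distrib)
  also have "\<dots> = (\<integral>x. (\<Sum>j\<in>J. \<phi> j x * a j) \<partial>\<mu>) - (\<integral>x. (\<Sum>j\<in>J. \<phi> j x * b j) \<partial>\<nu>)"
    using cont_integrable[OF X P2(1) F(3)] cont_integrable[OF X P2(2) F(3)]
    by (simp add: M_def N_def sum_subtractf mult.commute)
  finally have 1: "(\<Sum>j\<in>J. N j * U (M j / N j)) - e \<le> (\<integral>x. (\<Sum>j\<in>J. \<phi> j x * a j) \<partial>\<mu>) - (\<integral>x. (\<Sum>j\<in>J. \<phi> j x * b j) \<partial>\<nu>)" .
  have c: "contr X (\<lambda>x. \<Sum>j\<in>J. \<phi> j x * a j)" "contr X (\<lambda>x. \<Sum>j\<in>J. \<phi> j x * b j)"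
    using F(1,3) by (intro continuous_map_sum continuous_map_real_mult_right; simp)+
  obtain B where B: "\<And>x. x \<in> mspace X \<Longrightarrow> \<bar>\<Sum>j\<in>J. \<phi> j x * a j\<bar> \<le> B" using cont_bounded[OF X c(1)] by blast
  obtain B' where B': "\<And>x. x \<in> mspace X \<Longrightarrow> \<bar>\<Sum>j\<in>J. \<phi> j x * b j\<bar> \<le> B'" using cont_bounded[OF X c(2)] by blast
  have 2: "ereal ((\<integral>x. (\<Sum>j\<in>J. \<phi> j x * a j) \<partial>\<mu>) - (\<integral>x. (\<Sum>j\<in>J. \<phi> j x * b j) \<partial>\<nu>)) \<le> U_functional U \<nu> \<mu>"
  proof (rule U_functional_ge[OF U P2_D(1)[OF P2(1)] P2_D(1)[OF P2(2)], where B="max B B'"])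
    show "sets \<mu> = sets \<nu>" using P2_D(2)[OF P2(1)] n(2) by simp
    show "minorant U (\<Sum>j\<in>J. \<phi> j x * a j) (\<Sum>j\<in>J. \<phi> j x * b j)" if "x \<in> space \<nu>" for x
      using that n(3) F ab(1) by (intro minorant_sum) auto
  qed (use B B' n(3) cont_measurable_P2[OF P2(2)] c in \<open>auto simp: le_max_iff_disj\<close>)
  have "ereal (\<Sum>j\<in>J. N j * U (M j / N j)) = ereal ((\<Sum>j\<in>J. N j * U (M j / N j)) - e) + ereal e" by simp
  also have "\<dots> \<le> U_functional U \<nu> \<mu> + ereal e"
    using 1 by (intro add_right_mono order_trans[OF _ 2]) simp
  finally show "ereal (\<Sum>j\<in>J. (\<integral>x. \<phi> j x \<partial>\<nu>) * U ((\<integral>x. \<phi> j x \<partial>\<mu>) / (\<integral>x. \<phi> j x \<partial>\<nu>))) \<le> U_functional U \<nu> \<mu> + ereal e"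
    by (simp add: N_def M_def)
qed

lemma U_functional_not_MInf:
  assumes U: "admissible U" and P2: "\<mu> \<in> P2 X" "\<nu> \<in> P2 X"
  shows "U_functional U \<nu> \<mu> \<noteq> -\<infinity>"
proof -
  obtain D where "minorant U D (D * 1 - U 1)" using support_line[OF U zero_less_one] .
  then have "ereal ((\<integral>x. D \<partial>\<mu>) - (\<integral>x. D * 1 - U 1 \<partial>\<nu>)) \<le> U_functional U \<nu> \<mu>"
    using P2_D[OF P2(1)] P2_D[OF P2(2)]
    by (intro U_functional_ge[OF U, where B="max \<bar>D\<bar> \<bar>D * 1 - U 1\<bar>"]) auto
  then show ?thesis by auto
qed

text \<open>Adding a small multiple \<open>1 - \<theta>\<close> of the reference mass keeps the argument of \<open>U\<close> a convex
  combination of \<open>r\<close> and a number in \<open>[0, 2]\<close>, although the reference mass changes from \<open>n\<close> to \<open>n'\<close>.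
  The error is then controlled uniformly in \<open>r\<close>.\<close>

lemma perspective_le:
  assumes U: "admissible U" and \<theta>: "0 \<le> \<theta>" "\<theta> < 1" and n: "0 \<le> n" "0 \<le> n'" "n * (1 + \<theta>) \<le> 2 * n'"
    and r: "0 \<le> r" and B: "\<And>s. 0 \<le> s \<Longrightarrow> s \<le> 2 \<Longrightarrow> U s \<le> B" "0 \<le> B"
  shows "n' * U ((\<theta> * (n * r) + (1 - \<theta>) * n) / n') \<le> \<theta> * (n * U r) + (n' - \<theta> * n) * B"
proof (cases "n' = 0")
  case True
  then have "n = 0" using n \<theta> by (simp add: mult_le_0_iff)
  then show ?thesis using True by simp
next
  case False
  then have n': "0 < n'" using n by simp
  have "\<theta> * n < n'"
  proof (cases "n = 0")
    case False
    then have "\<theta> * n * 2 < n * (1 + \<theta>)" using \<theta> n by (simp add: algebra_simps)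
    then show ?thesis using n(3) by simp
  qed (use n' in simp)
  then have p: "0 < n' - \<theta> * n" by simp
  define c where "c = (1 - \<theta>) * n / (n' - \<theta> * n)"
  \<comment> \<open>Expanded, the second inequality is exactly the hypothesis n (1 + \<theta>) \<le>
    2 n'. This explains the form of the mass condition and the interval [0, 2].\<close>
  have "0 \<le> (1 - \<theta>) * n" "(1 - \<theta>) * n \<le> 2 * (n' - \<theta> * n)"
    using n \<theta> mult_right_mono[of \<theta> 1 n] by (simp_all add: algebra_simps)
  then have c: "0 \<le> c" "c \<le> 2" using p by (auto simp: c_def pos_divide_le_eq)
  \<comment> \<open>The argument of U equals t r + (1 - t) c, so convexity leaves only the value at
    c in [0, 2] to be bounded.\<close>
  define t where "t = \<theta> * n / n'"
  have t: "0 \<le> t" "t \<le> 1" using p n n' \<theta> by (auto simp: t_def field_simps)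
  have "(1 - t) * c = ((n' - \<theta> * n) * c) / n'" using n' by (simp add: t_def field_simps)
  also have "(n' - \<theta> * n) * c = (1 - \<theta>) * n" using p by (simp add: c_def)
  finally have eq: "(\<theta> * (n * r) + (1 - \<theta>) * n) / n' = t * r + (1 - t) * c"
    by (simp add: t_def add_divide_distrib)
  have "U ((1 - (1 - t)) *\<^sub>R r + (1 - t) *\<^sub>R c) \<le> (1 - (1 - t)) * U r + (1 - t) * U c"
    using U t r c by (intro convex_onD[of "{0..}"]) (auto simp: admissible_def)
  then have "U (t * r + (1 - t) * c) \<le> t * U r + (1 - t) * B"
    using B(1)[OF c] t by (simp add: order_trans[OF _ add_left_mono[OF mult_left_mono]])
  then have "n' * U (t * r + (1 - t) * c) \<le> n' * (t * U r + (1 - t) * B)" using n' by simp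
  also have "\<dots> = \<theta> * (n * U r) + (n' - \<theta> * n) * B" using n' by (simp add: t_def field_simps)
  finally show ?thesis by (simp add: eq)
qed

section \<open>Transplanting measures to the approximating spaces\<close>

definition transplant :: "'b set \<Rightarrow> ('b \<Rightarrow> 'b \<Rightarrow> real) \<Rightarrow> ('a \<Rightarrow> 'b) \<Rightarrow> 'a measure \<Rightarrow> ('b \<Rightarrow> real) \<Rightarrow> 'a measure" where
  "transplant J \<phi> f \<nu>' w =
     density \<nu>' (\<lambda>x. ennreal (\<Sum>j\<in>J. w j / (\<integral>x. \<phi> j (f x) \<partial>\<nu>') * \<phi> j (f x)))"

text \<open>One approximating space together with a partition fine enough for it. The condition
  \<open>mass\<close> allows n' to be smaller than n by a factor close to 1, and it holds trivially
  in cells of \<nu>-mass zero.\<close>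

locale transplantation =
  fixes X :: "'b metric" and \<nu> :: "'b measure" and Y :: "'a metric" and \<nu>' :: "'a measure"
    and f :: "'a \<Rightarrow> 'b" and \<epsilon> \<delta> \<theta> :: real and J :: "'b set" and \<phi> :: "'b \<Rightarrow> 'b \<Rightarrow> real"
  assumes X: "compact_space (mtopology_of X)" and Y: "compact_space (mtopology_of Y)"
    and \<nu>: "\<nu> \<in> P2 X" and \<nu>': "\<nu>' \<in> P2 Y"
    and f: "GH_approximation \<epsilon> Y X f" and \<phi>: "fine_partition X \<delta> J \<phi>" and \<delta>: "0 \<le> \<delta>"
    and \<theta>: "0 \<le> \<theta>" "\<theta> < 1"
    and mass: "\<And>j. j \<in> J \<Longrightarrow> (\<integral>x. \<phi> j x \<partial>\<nu>) * (1 + \<theta>) \<le> 2 * (\<integral>x. \<phi> j (f x) \<partial>\<nu>')"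
begin

abbreviation "n j \<equiv> \<integral>x. \<phi> j x \<partial>\<nu>"
abbreviation "n' j \<equiv> \<integral>x. \<phi> j (f x) \<partial>\<nu>'"

text \<open>The weights belong to \<open>\<theta> \<mu> + (1 - \<theta>) \<nu>\<close>.\<close>

definition weight :: "'b measure \<Rightarrow> 'b \<Rightarrow> real" where
  "weight \<mu> j = \<theta> * (\<integral>x. \<phi> j x \<partial>\<mu>) + (1 - \<theta>) * n j"

abbreviation "moved \<mu> \<equiv> transplant J \<phi> f \<nu>' (weight \<mu>)"

text \<open>The discrete trace of the support condition: cells without \<nu>-mass receive no weight,
  so no mass is lost to a division by zero in the transplanted density.\<close>

definition dominated :: "'b measure \<Rightarrow> bool" where
  "dominated \<mu> \<longleftrightarrow> \<mu> \<in> P2 X \<and> (\<forall>j\<in>J. n j = 0 \<longrightarrow> (\<integral>x. \<phi> j x \<partial>\<mu>) = 0)"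

lemmas F = fine_partition_D[OF \<phi>]

section \<open>Masses and weights of the cells\<close>

lemma f_measurable: "f \<in> measurable (borel_of Y) (borel_of X)"
  and f_dist: "x \<in> mspace Y \<Longrightarrow> y \<in> mspace Y \<Longrightarrow> \<bar>mdist X (f x) (f y) - mdist Y x y\<bar> \<le> \<epsilon>"
  using f by (auto simp: GH_approximation_def)

lemma f_in: "x \<in> mspace Y \<Longrightarrow> f x \<in> mspace X"
  using measurable_space[OF f_measurable, of x] by simp

lemma \<epsilon>_nonneg: "0 \<le> \<epsilon>"
proof -
  obtain y where "y \<in> mspace Y" using P2_mspace_nonempty[OF \<nu>'] by auto
  then show ?thesis using f_dist[of y y] abs_ge_zero order_trans by blast
qed

lemma comp_measurable: "contr X g \<Longrightarrow> (\<lambda>x. g (f x)) \<in> borel_measurable (borel_of Y)"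
  by (rule measurable_compose[OF f_measurable cont_measurable])

lemma comp_integrable: "contr X g \<Longrightarrow> integrable \<nu>' (\<lambda>x. g (f x))"
  using cont_bounded[OF X, of g] P2_integrable_bounded[OF \<nu>' comp_measurable] f_in by metis

lemma \<phi>f: "j \<in> J \<Longrightarrow> (\<lambda>x. \<phi> j (f x)) \<in> borel_measurable (borel_of Y)"
  "j \<in> J \<Longrightarrow> x \<in> mspace Y \<Longrightarrow> 0 \<le> \<phi> j (f x)" "j \<in> J \<Longrightarrow> x \<in> mspace Y \<Longrightarrow> \<phi> j (f x) \<le> 1"
  using comp_measurable F f_in by auto

lemma integral_\<phi>_nonneg: "\<mu> \<in> P2 X \<Longrightarrow> j \<in> J \<Longrightarrow> 0 \<le> (\<integral>x. \<phi> j x \<partial>\<mu>)"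
  using F(4) P2_D(3) by (intro integral_nonneg_AE AE_I2) blast

lemma n'_nonneg: "j \<in> J \<Longrightarrow> 0 \<le> n' j"
  using \<phi>f(2) P2_D(3)[OF \<nu>'] by (intro integral_nonneg_AE AE_I2) auto

lemma sum_integral_\<phi>: "\<mu> \<in> P2 X \<Longrightarrow> (\<Sum>j\<in>J. \<integral>x. \<phi> j x \<partial>\<mu>) = 1"
  using fine_partition_sum_integral[OF X \<phi>, of \<mu> "\<lambda>_. 1"] P2_measure_space[of \<mu> X] P2_D(3)[of \<mu> X] by simp

lemma sum_n': "(\<Sum>j\<in>J. n' j) = 1"
proof -
  have "(\<Sum>j\<in>J. n' j) = (\<integral>x. (\<Sum>j\<in>J. \<phi> j (f x)) \<partial>\<nu>')"
    using comp_integrable[OF F(3)] by (intro Bochner_Integration.integral_sum[symmetric]) auto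
  also have "\<dots> = (\<integral>x. 1 \<partial>\<nu>')"
    using F(7) f_in P2_D(3)[OF \<nu>'] by (intro Bochner_Integration.integral_cong) auto
  finally show ?thesis using P2_measure_space[OF \<nu>'] P2_D(3)[OF \<nu>'] by simp
qed

lemma weight_nonneg: "\<mu> \<in> P2 X \<Longrightarrow> j \<in> J \<Longrightarrow> 0 \<le> weight \<mu> j"
  using \<theta> integral_\<phi>_nonneg \<nu> by (simp add: weight_def)

lemma sum_weight: "\<mu> \<in> P2 X \<Longrightarrow> (\<Sum>j\<in>J. weight \<mu> j) = 1"
  using sum_integral_\<phi> \<nu> by (simp add: weight_def sum.distrib flip: sum_distrib_left)

lemma n_zero_if_n'_zero: "j \<in> J \<Longrightarrow> n' j = 0 \<Longrightarrow> n j = 0"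
  using mass[of j] integral_\<phi>_nonneg[OF \<nu>, of j] \<theta> by (simp add: mult_le_0_iff)

lemma weight_zero: "dominated \<mu> \<Longrightarrow> j \<in> J \<Longrightarrow> n' j = 0 \<Longrightarrow> weight \<mu> j = 0"
  using n_zero_if_n'_zero by (simp add: dominated_def weight_def)

text \<open>The matrix of a coupling of \<mu>0 and \<mu>1 is mixed with the diagonal matrix of the
  \<nu>-masses. The marginals of the mixture are the weights, and the diagonal part moves mass only
  within a cell. Mixing with \<nu> therefore adds only a small term to the cost bound.\<close>

lemma moved_W2:
  assumes d: "dominated \<mu>0" "dominated \<mu>1" and \<pi>: "\<pi> \<in> couplings X \<mu>0 \<mu>1"
    and D: "\<And>x y. x \<in> mspace X \<Longrightarrow> y \<in> mspace X \<Longrightarrow> mdist X x y \<le> D" "0 \<le> D"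
  shows "moved \<mu>0 \<in> P2 Y" "moved \<mu>1 \<in> P2 Y"
    "(W2 Y (moved \<mu>0) (moved \<mu>1))\<^sup>2 \<le> cost X \<pi> + (4 * \<delta> + \<epsilon>) * (2 * D + (4 * \<delta> + \<epsilon>)) + (2 * \<delta> + \<epsilon>)\<^sup>2"
proof -
  have \<mu>: "\<mu>0 \<in> P2 X" "\<mu>1 \<in> P2 X" using d by (auto simp: dominated_def)
  \<comment> \<open>Passing from two centres to points of their cells costs 2 \<delta>, and the
    distortion of the approximation costs \<epsilon>.\<close>
  define c where "c = 2 * \<delta> + \<epsilon>"
  have c: "0 \<le> c" using \<delta> \<epsilon>_nonneg by (simp add: c_def)
  obtain P where PM: "matrix_marginals J P (\<lambda>j. \<integral>x. \<phi> j x \<partial>\<mu>0) (\<lambda>l. \<integral>x. \<phi> l x \<partial>\<mu>1)" "\<forall>j\<in>J. \<forall>l\<in>J. P j l \<le> 1"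
    and P5: "(\<Sum>j\<in>J. \<Sum>l\<in>J. P j l * (mdist X j l + c)\<^sup>2) \<le> cost X \<pi> + (2 * \<delta> + c) * (2 * D + (2 * \<delta> + c))"
    by (rule coupling_matrix[OF X \<phi> \<mu> \<pi> D(1) c \<delta>])
  note P = matrix_marginals_D[OF PM(1)]
  define Q where "Q j l = \<theta> * P j l + (1 - \<theta>) * (if j = l then n j else 0)" for j l
  have Q0: "0 \<le> Q j l" if "j \<in> J" "l \<in> J" for j l
    using P(1)[OF that] \<theta> integral_\<phi>_nonneg[OF \<nu> that(1)]
    unfolding Q_def by (intro add_nonneg_nonneg mult_nonneg_nonneg) auto
  have Q1: "(\<Sum>l\<in>J. Q j l) = weight \<mu>0 j" if "j \<in> J" for j
    using P(2)[OF that] F(1) that by (simp add: Q_def weight_def sum.distrib sum.delta flip: sum_distrib_left)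
  have Q2: "(\<Sum>j\<in>J. Q j l) = weight \<mu>1 l" if "l \<in> J" for l
    using P(3)[OF that] F(1) that by (simp add: Q_def weight_def sum.distrib sum.delta flip: sum_distrib_left)
  have zQ: "Q j l = 0" if jl: "j \<in> J" "l \<in> J" and z: "n' j = 0 \<or> n' l = 0" for j l
    using z
  proof
    assume "n' j = 0"
    then have "(\<Sum>l\<in>J. Q j l) = 0" using Q1[OF jl(1)] weight_zero[OF d(1) jl(1)] by simp
    then show ?thesis using sum_nonneg_eq_0_iff[OF F(1), of "\<lambda>l. Q j l"] Q0 jl by auto
  next
    assume "n' l = 0"
    then have "(\<Sum>j\<in>J. Q j l) = 0" using Q2[OF jl(2)] weight_zero[OF d(2) jl(2)] by simp
    then show ?thesis using sum_nonneg_eq_0_iff[OF F(1), of "\<lambda>j. Q j l"] Q0 jl by auto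
  qed
  have one: "(\<Sum>j\<in>J. \<Sum>l\<in>J. Q j l) = 1" using Q1 sum_weight[OF \<mu>(1)] by simp
  have C: "mdist Y x y \<le> mdist X j l + c" if "j \<in> J" "l \<in> J" "x \<in> mspace Y" "y \<in> mspace Y" "\<phi> j (f x) \<noteq> 0" "\<phi> l (f y) \<noteq> 0" for j l x y
  proof -
    have jl: "j \<in> mspace X" "l \<in> mspace X" using that F(2) by auto
    have "mdist X (f x) j \<le> \<delta>" "mdist X (f y) l \<le> \<delta>" using F(6) f_in that by auto
    then have "mdist X (f x) (f y) \<le> mdist X j l + 2 * \<delta>"
      using mdist_triangle[of "f x" X j "f y"] mdist_triangle[of j X l "f y"] jl f_in that by (simp add: mdist_commute)
    then show ?thesis using f_dist[of x y] that by (simp add: c_def)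
  qed
  have t0: "moved \<mu>0 = density \<nu>' (\<lambda>x. ennreal (\<Sum>j\<in>J. (\<Sum>l\<in>J. Q j l) / n' j * \<phi> j (f x)))"
    unfolding transplant_def using Q1 by (simp cong: sum.cong)
  have t1: "moved \<mu>1 = density \<nu>' (\<lambda>x. ennreal (\<Sum>l\<in>J. (\<Sum>j\<in>J. Q j l) / n' l * \<phi> l (f x)))"
    unfolding transplant_def using Q2 by (simp cong: sum.cong)
  note mix = mixture_W2[where \<alpha>="\<lambda>j x. \<phi> j (f x)" and \<beta>="\<lambda>j x. \<phi> j (f x)" and C="\<lambda>j l. mdist X j l + c",
      OF Y \<nu>' \<nu>' F(1) \<phi>f \<phi>f Q0 one zQ zQ C t0 t1]
  show "moved \<mu>0 \<in> P2 Y" by (rule mix(1)) auto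
  show "moved \<mu>1 \<in> P2 Y" by (rule mix(2)) auto
  have "(W2 Y (moved \<mu>0) (moved \<mu>1))\<^sup>2 \<le> (\<Sum>j\<in>J. \<Sum>l\<in>J. Q j l * (mdist X j l + c)\<^sup>2)"
    by (rule mix(3)) auto
  also have "\<dots> = \<theta> * (\<Sum>j\<in>J. \<Sum>l\<in>J. P j l * (mdist X j l + c)\<^sup>2)
      + (1 - \<theta>) * (\<Sum>j\<in>J. \<Sum>l\<in>J. (if j = l then n j else 0) * (mdist X j l + c)\<^sup>2)"
    by (simp add: Q_def distrib_right sum.distrib sum_distrib_left mult.assoc)
  also have "(\<Sum>j\<in>J. \<Sum>l\<in>J. (if j = l then n j else 0) * (mdist X j l + c)\<^sup>2) = (\<Sum>j\<in>J. n j * c\<^sup>2)"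
  proof (rule sum.cong[OF refl])
    fix j assume j: "j \<in> J"
    have "(\<Sum>l\<in>J. (if j = l then n j else 0) * (mdist X j l + c)\<^sup>2) = (\<Sum>l\<in>J. if j = l then n j * c\<^sup>2 else 0)"
    proof (rule sum.cong[OF refl])
      have "mdist X j j = 0" using F(2) j by (metis mdist_zero subsetD)
      then show "(if j = l then n j else 0) * (mdist X j l + c)\<^sup>2 = (if j = l then n j * c\<^sup>2 else 0)" for l by auto
    qed
    then show "(\<Sum>l\<in>J. (if j = l then n j else 0) * (mdist X j l + c)\<^sup>2) = n j * c\<^sup>2"
      using F(1) j by simp
  qed
  also have "\<dots> = c\<^sup>2" using sum_integral_\<phi>[OF \<nu>] by (simp flip: sum_distrib_right)
  also have "\<theta> * (\<Sum>j\<in>J. \<Sum>l\<in>J. P j l * (mdist X j l + c)\<^sup>2) + (1 - \<theta>) * c\<^sup>2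
      \<le> (\<Sum>j\<in>J. \<Sum>l\<in>J. P j l * (mdist X j l + c)\<^sup>2) + c\<^sup>2"
    using \<theta> P(1) by (intro add_mono mult_left_le_one_le sum_nonneg mult_nonneg_nonneg) auto
  also have "\<dots> \<le> cost X \<pi> + (4 * \<delta> + \<epsilon>) * (2 * D + (4 * \<delta> + \<epsilon>)) + (2 * \<delta> + \<epsilon>)\<^sup>2"
    using P5 by (simp add: c_def)
  finally show "(W2 Y (moved \<mu>0) (moved \<mu>1))\<^sup>2 \<le> cost X \<pi> + (4 * \<delta> + \<epsilon>) * (2 * D + (4 * \<delta> + \<epsilon>)) + (2 * \<delta> + \<epsilon>)\<^sup>2" .
qed

lemma moved_P2:
  assumes d: "dominated \<mu>" shows "moved \<mu> \<in> P2 Y"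
proof -
  obtain D where D: "D \<ge> 0" "\<And>x y. x \<in> mspace X \<Longrightarrow> y \<in> mspace X \<Longrightarrow> mdist X x y \<le> D"
    using mdist_bounded[OF X] by blast
  show ?thesis
    using moved_W2(1)[OF d d couplings_nonempty D(2,1)] d by (auto simp: dominated_def)
qed

text \<open>Transplanted measures have a density with respect to \<nu>'. This is the support
  condition under which displacement convexity of the approximating space can be invoked.\<close>

lemma moved_supp: "measure_supp Y (moved \<mu>) \<subseteq> measure_supp Y \<nu>'"
proof
  fix x assume x: "x \<in> measure_supp Y (moved \<mu>)"
  have "0 < emeasure \<nu>' V" if V: "openin (mtopology_of Y) V" "x \<in> V" for V
  proof (rule ccontr)
    assume "\<not> ?thesis"
    then have "V \<in> null_sets \<nu>'"
      using openin_sets_borel_of[OF V(1)] P2_D(2)[OF \<nu>'] by (auto simp: null_sets_def)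
    moreover have "(\<lambda>x. ennreal (\<Sum>j\<in>J. weight \<mu> j / n' j * \<phi> j (f x))) \<in> borel_measurable \<nu>'"
      using comp_integrable[OF F(3)] by (intro measurable_compose[OF _ measurable_ennreal] borel_measurable_sum) auto
    ultimately have "V \<in> null_sets (moved \<mu>)"
      using absolutely_continuousI_density unfolding absolutely_continuous_def transplant_def by blast
    then have "emeasure (moved \<mu>) V = 0" by (rule null_setsD1)
    then show False using x V by (auto simp: measure_supp_def)
  qed
  then show "x \<in> measure_supp Y \<nu>'" using x by (auto simp: measure_supp_def)
qed

text \<open>The finite sum \<open>S\<close> links the two spaces: one Jensen estimate puts it below
  the functional on \<open>X\<close>, the other bounds the functional on \<open>Y\<close> from above
  by a perturbed sum. The remaining error (1 - \<theta>) B involves neither \<mu> nor the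
  partition.\<close>

lemma moved_U_functional:
  assumes U: "admissible U" and d: "dominated \<mu>" and B: "\<And>s. 0 \<le> s \<Longrightarrow> s \<le> 2 \<Longrightarrow> U s \<le> B" "0 \<le> B"
  obtains S where "ereal S \<le> U_functional U \<nu> \<mu>" "U_functional U \<nu>' (moved \<mu>) \<le> ereal (\<theta> * S + (1 - \<theta>) * B)"
proof
  have \<mu>: "\<mu> \<in> P2 X" using d by (simp add: dominated_def)
  define m where "m j = (\<integral>x. \<phi> j x \<partial>\<mu>)" for j
  let ?S = "\<Sum>j\<in>J. n j * U (m j / n j)"
  show "ereal ?S \<le> U_functional U \<nu> \<mu>"
    unfolding m_def using d by (intro U_functional_partition_ge[OF X U \<mu> \<nu> \<phi>]) (auto simp: dominated_def)
  have "U_functional U \<nu>' (moved \<mu>) \<le> ereal (\<Sum>j\<in>J. n' j * U (weight \<mu> j / n' j))"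
  proof (rule U_functional_mixture_le[OF Y U \<nu>' moved_P2[OF d] F(1), where \<psi>="\<lambda>j x. \<phi> j (f x)"])
    show "0 \<le> weight \<mu> j / n' j" if "j \<in> J" for j using weight_nonneg[OF \<mu> that] n'_nonneg[OF that] by simp
    show "(\<Sum>j\<in>J. \<phi> j (f x)) \<le> 1" if "x \<in> mspace Y" for x using F(7) f_in that by simp
    show "moved \<mu> = density \<nu>' (\<lambda>x. ennreal (\<Sum>j\<in>J. weight \<mu> j / n' j * \<phi> j (f x)))" by (simp add: transplant_def)
  qed (use \<phi>f in auto)
  also have "(\<Sum>j\<in>J. n' j * U (weight \<mu> j / n' j)) \<le> (\<Sum>j\<in>J. \<theta> * (n j * U (m j / n j)) + (n' j - \<theta> * n j) * B)"
  proof (rule sum_mono)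
    fix j assume j: "j \<in> J"
    have m0: "0 \<le> m j" "0 \<le> n j" unfolding m_def using integral_\<phi>_nonneg \<mu> \<nu> j by auto
    have "n j * (m j / n j) = m j" using d j by (auto simp: dominated_def m_def)
    then have w: "weight \<mu> j = \<theta> * (n j * (m j / n j)) + (1 - \<theta>) * n j" by (simp add: weight_def m_def)
    show "n' j * U (weight \<mu> j / n' j) \<le> \<theta> * (n j * U (m j / n j)) + (n' j - \<theta> * n j) * B"
      unfolding w using m0 by (intro perspective_le[OF U \<theta> m0(2) n'_nonneg[OF j] mass[OF j] _ B]) auto
  qed
  also have "\<dots> = \<theta> * ?S + ((\<Sum>j\<in>J. n' j) - \<theta> * (\<Sum>j\<in>J. n j)) * B"
    by (simp add: sum.distrib sum_distrib_left sum_subtractf flip: sum_distrib_right)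
  also have "\<dots> = \<theta> * ?S + (1 - \<theta>) * B" using sum_n' sum_integral_\<phi>[OF \<nu>] by simp
  finally show "U_functional U \<nu>' (moved \<mu>) \<le> ereal (\<theta> * ?S + (1 - \<theta>) * B)" by simp
qed

text \<open>Both integrals are compared with sums of g over the centres, at a cost of \<omega> each.
  The weights in the two sums differ by (1 - \<theta>) times the difference of two probability
  vectors.\<close>

lemma moved_weak:
  assumes d: "dominated \<mu>" and g: "contr X g" and G: "\<And>x. x \<in> mspace X \<Longrightarrow> \<bar>g x\<bar> \<le> G"
    and \<omega>: "\<And>x y. x \<in> mspace X \<Longrightarrow> y \<in> mspace X \<Longrightarrow> mdist X x y \<le> \<delta> \<Longrightarrow> \<bar>g x - g y\<bar> \<le> \<omega>"
  shows "\<bar>(\<integral>x. g (f x) \<partial>moved \<mu>) - (\<integral>x. g x \<partial>\<mu>)\<bar> \<le> 2 * \<omega> + 2 * (1 - \<theta>) * G"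
proof -
  have \<mu>: "\<mu> \<in> P2 X" using d by (simp add: dominated_def)
  define m where "m j = (\<integral>x. \<phi> j x \<partial>\<mu>)" for j
  have J: "j \<in> mspace X" if "j \<in> J" for j using F(2) that by auto
  have c\<phi>g: "contr X (\<lambda>x. \<phi> j x * g x)" if "j \<in> J" for j using F(3)[OF that] g by (rule continuous_map_real_mult)
  have fm: "(\<lambda>x. h (f x)) \<in> borel_measurable \<nu>'" if "contr X h" for h
    using comp_integrable[OF that] by auto
  have "(\<integral>x. g (f x) \<partial>moved \<mu>) = (\<integral>x. (\<Sum>j\<in>J. weight \<mu> j / n' j * \<phi> j (f x)) *\<^sub>R g (f x) \<partial>\<nu>')"
    unfolding transplant_def using fm F(3) g weight_nonneg[OF \<mu>] n'_nonneg \<phi>f(2) P2_D(3)[OF \<nu>']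
    by (intro integral_density AE_I2) (auto intro!: sum_nonneg)
  also have "\<dots> = (\<integral>x. (\<Sum>j\<in>J. weight \<mu> j / n' j * (\<phi> j (f x) * g (f x))) \<partial>\<nu>')"
    by (simp add: sum_distrib_right mult.assoc)
  also have "\<dots> = (\<Sum>j\<in>J. weight \<mu> j / n' j * (\<integral>x. \<phi> j (f x) * g (f x) \<partial>\<nu>'))"
    using comp_integrable[OF c\<phi>g] by simp
  finally have t: "(\<integral>x. g (f x) \<partial>moved \<mu>) = (\<Sum>j\<in>J. weight \<mu> j / n' j * (\<integral>x. \<phi> j (f x) * g (f x) \<partial>\<nu>'))" .
  have cl: "\<phi> j x * \<bar>g x - g j\<bar> \<le> \<phi> j x * \<omega>" if "j \<in> J" "x \<in> mspace X" for j x
  proof (cases "\<phi> j x = 0")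
    case False
    then show ?thesis using \<omega>[OF that(2) J[OF that(1)] F(6)[OF that False]] F(4)[OF that] by (intro mult_left_mono) auto
  qed simp
  \<comment> \<open>Stated for a general map and measure because it is used twice: with f and \<nu>'
    on \<open>Y\<close>, and with the identity and \<mu> on \<open>X\<close>.\<close>
  have ap: "\<bar>(\<integral>x. \<phi> j (h x) * g (h x) \<partial>\<kappa>) - (\<integral>x. \<phi> j (h x) \<partial>\<kappa>) * g j\<bar> \<le> (\<integral>x. \<phi> j (h x) \<partial>\<kappa>) * \<omega>"
    if j: "j \<in> J" and h: "\<And>x. x \<in> space \<kappa> \<Longrightarrow> h x \<in> mspace X"
      and i: "integrable \<kappa> (\<lambda>x. \<phi> j (h x) * g (h x))" "integrable \<kappa> (\<lambda>x. \<phi> j (h x))" for j and h :: "'c \<Rightarrow> 'b" and \<kappa>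
  proof -
    have i': "integrable \<kappa> (\<lambda>x. \<phi> j (h x) * (g (h x) - g j))" using i by (simp add: right_diff_distrib)
    have "(\<integral>x. \<phi> j (h x) * g (h x) \<partial>\<kappa>) - (\<integral>x. \<phi> j (h x) \<partial>\<kappa>) * g j = (\<integral>x. \<phi> j (h x) * (g (h x) - g j) \<partial>\<kappa>)"
      using i by (simp add: right_diff_distrib)
    also have "\<bar>\<dots>\<bar> \<le> (\<integral>x. \<bar>\<phi> j (h x) * (g (h x) - g j)\<bar> \<partial>\<kappa>)" by (rule integral_abs_bound)
    also have "\<dots> \<le> (\<integral>x. \<phi> j (h x) * \<omega> \<partial>\<kappa>)"
      using i cl[OF j] h F(4)[OF j] by (intro integral_mono[OF integrable_abs[OF i']]) (auto simp: abs_mult)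
    also have "\<dots> = (\<integral>x. \<phi> j (h x) \<partial>\<kappa>) * \<omega>" using i by simp
    finally show ?thesis .
  qed
  have a1: "\<bar>weight \<mu> j / n' j * (\<integral>x. \<phi> j (f x) * g (f x) \<partial>\<nu>') - weight \<mu> j * g j\<bar> \<le> weight \<mu> j * \<omega>" if j: "j \<in> J" for j
  proof (cases "n' j = 0")
    case True
    then show ?thesis using weight_zero[OF d j] by simp
  next
    case False
    then have n'p: "0 < n' j" using n'_nonneg[OF j] by simp
    have "\<bar>(\<integral>x. \<phi> j (f x) * g (f x) \<partial>\<nu>') - n' j * g j\<bar> \<le> n' j * \<omega>"
      using comp_integrable[OF c\<phi>g[OF j]] comp_integrable[OF F(3)[OF j]] f_in P2_D(3)[OF \<nu>'] by (intro ap j) auto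
    then have "weight \<mu> j / n' j * \<bar>(\<integral>x. \<phi> j (f x) * g (f x) \<partial>\<nu>') - n' j * g j\<bar> \<le> weight \<mu> j / n' j * (n' j * \<omega>)"
      using weight_nonneg[OF \<mu> j] n'p by (intro mult_left_mono) auto
    moreover have "weight \<mu> j / n' j * (\<integral>x. \<phi> j (f x) * g (f x) \<partial>\<nu>') - weight \<mu> j * g j
        = weight \<mu> j / n' j * ((\<integral>x. \<phi> j (f x) * g (f x) \<partial>\<nu>') - n' j * g j)"
      using n'p by (simp add: field_simps)
    ultimately show ?thesis using weight_nonneg[OF \<mu> j] n'p by (simp add: abs_mult)
  qed
  have a2: "\<bar>(\<integral>x. \<phi> j x * g x \<partial>\<mu>) - m j * g j\<bar> \<le> m j * \<omega>" if j: "j \<in> J" for j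
    unfolding m_def
    using ap[of j \<mu> "\<lambda>x. x"] cont_integrable[OF X \<mu> c\<phi>g[OF j]] cont_integrable[OF X \<mu> F(3)[OF j]] P2_D(3)[OF \<mu>] j by simp
  have b1: "\<bar>(\<integral>x. g (f x) \<partial>moved \<mu>) - (\<Sum>j\<in>J. weight \<mu> j * g j)\<bar> \<le> \<omega>"
  proof -
    have "\<bar>(\<integral>x. g (f x) \<partial>moved \<mu>) - (\<Sum>j\<in>J. weight \<mu> j * g j)\<bar> \<le> (\<Sum>j\<in>J. weight \<mu> j * \<omega>)"
      unfolding t sum_subtractf[symmetric] using a1 by (intro order_trans[OF sum_abs] sum_mono)
    then show ?thesis using sum_weight[OF \<mu>] by (simp flip: sum_distrib_right)
  qed
  have b2: "\<bar>(\<integral>x. g x \<partial>\<mu>) - (\<Sum>j\<in>J. m j * g j)\<bar> \<le> \<omega>"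
  proof -
    have "\<bar>(\<integral>x. g x \<partial>\<mu>) - (\<Sum>j\<in>J. m j * g j)\<bar> \<le> (\<Sum>j\<in>J. m j * \<omega>)"
      unfolding fine_partition_sum_integral[OF X \<phi> \<mu> g, symmetric] sum_subtractf[symmetric]
      using a2 by (intro order_trans[OF sum_abs] sum_mono)
    then show ?thesis using sum_integral_\<phi>[OF \<mu>] by (simp add: m_def flip: sum_distrib_right)
  qed
  have bG: "\<bar>\<Sum>j\<in>J. w j * g j\<bar> \<le> G" if w: "\<And>j. j \<in> J \<Longrightarrow> 0 \<le> w j" "(\<Sum>j\<in>J. w j) = 1" for w
  proof -
    have "\<bar>\<Sum>j\<in>J. w j * g j\<bar> \<le> (\<Sum>j\<in>J. w j * G)"
      using w(1) G J by (intro order_trans[OF sum_abs] sum_mono) (auto simp: abs_mult intro!: mult_left_mono)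
    then show ?thesis using w(2) by (simp flip: sum_distrib_right)
  qed
  have "(\<Sum>j\<in>J. weight \<mu> j * g j) - (\<Sum>j\<in>J. m j * g j) = (1 - \<theta>) * ((\<Sum>j\<in>J. n j * g j) - (\<Sum>j\<in>J. m j * g j))"
    by (simp add: weight_def m_def algebra_simps sum.distrib sum_subtractf sum_distrib_left)
  also have "\<bar>\<dots>\<bar> \<le> (1 - \<theta>) * (G + G)"
  proof -
    have "\<bar>\<Sum>j\<in>J. n j * g j\<bar> \<le> G" "\<bar>\<Sum>j\<in>J. m j * g j\<bar> \<le> G"
      unfolding m_def using bG integral_\<phi>_nonneg sum_integral_\<phi> \<mu> \<nu> by auto
    then have "\<bar>(\<Sum>j\<in>J. n j * g j) - (\<Sum>j\<in>J. m j * g j)\<bar> \<le> G + G" by linarith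
    then show ?thesis using \<theta> by (simp add: abs_mult mult_left_mono)
  qed
  finally have b3: "\<bar>(\<Sum>j\<in>J. weight \<mu> j * g j) - (\<Sum>j\<in>J. m j * g j)\<bar> \<le> 2 * (1 - \<theta>) * G"
    by (simp add: algebra_simps)
  show ?thesis using b1 b2 b3 by linarith
qed

end

section \<open>Limits of geodesics\<close>

lemma W2_commute:
  assumes X: "compact_space (mtopology_of X)" and P2: "\<mu> \<in> P2 X" "\<mu>' \<in> P2 X"
  shows "W2 X \<mu> \<mu>' = W2 X \<mu>' \<mu>"
proof -
  have le: "W2 X \<mu>' \<mu> \<le> W2 X \<mu> \<mu>'" if P2: "\<mu> \<in> P2 X" "\<mu>' \<in> P2 X" for \<mu> \<mu>'
  proof -
    have "(W2 X \<mu>' \<mu>)\<^sup>2 \<le> (W2 X \<mu> \<mu>')\<^sup>2"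
    proof (rule field_le_epsilon)
      fix e :: real assume e: "0 < e"
      obtain \<pi> where \<pi>: "\<pi> \<in> couplings X \<mu> \<mu>'" "cost X \<pi> < (W2 X \<mu> \<mu>')\<^sup>2 + e"
        using W2_squared_approx[OF P2 e] by auto
      let ?B = "borel_of X"
      define F where "F = (\<lambda>p :: 'a \<times> 'a. (snd p, fst p))"
      have F: "F \<in> measurable \<pi> (?B \<Otimes>\<^sub>M ?B)"
        unfolding F_def couplings_measurable[OF \<pi>(1)] by measurable
      have "distr (distr \<pi> (?B \<Otimes>\<^sub>M ?B) F) ?B fst = distr \<pi> ?B snd"
        using F by (simp add: distr_distr) (simp add: F_def comp_def)
      moreover have "distr (distr \<pi> (?B \<Otimes>\<^sub>M ?B) F) ?B snd = distr \<pi> ?B fst"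
        using F by (simp add: distr_distr) (simp add: F_def comp_def)
      ultimately have "distr \<pi> (?B \<Otimes>\<^sub>M ?B) F \<in> couplings X \<mu>' \<mu>"
        by (simp add: couplings_def couplings_D[OF \<pi>(1)])
      moreover have "cost X (distr \<pi> (?B \<Otimes>\<^sub>M ?B) F) = cost X \<pi>"
        using F mdist_measurable[OF X] by (subst integral_distr) (auto simp: case_prod_beta' F_def mdist_commute)
      ultimately show "(W2 X \<mu>' \<mu>)\<^sup>2 \<le> (W2 X \<mu> \<mu>')\<^sup>2 + e"
        using W2_squared_le \<pi>(2) by fastforce
    qed
    then show ?thesis using W2_nonneg[OF P2] by (rule power2_le_imp_le)
  qed
  show ?thesis using le[OF P2] le[OF P2(2,1)] by simp
qed

text \<open>The open set where g is nonzero is \<nu>-null, so it misses both supports and each of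
  its points has a \<mu>-null neighbourhood. It is exhausted by compact sets, each covered by
  finitely many of these. This yields \<open>dominated\<close> from the support condition.\<close>

lemma integral_zero_if_supp_subset:
  assumes X: "compact_space (mtopology_of X)" and P2: "\<mu> \<in> P2 X" "\<nu> \<in> P2 X"
    and supp: "measure_supp X \<mu> \<subseteq> measure_supp X \<nu>"
    and g: "contr X g" "\<And>x. x \<in> mspace X \<Longrightarrow> 0 \<le> g x" and z: "(\<integral>x. g x \<partial>\<nu>) = 0"
  shows "(\<integral>x. g x \<partial>\<mu>) = 0"
proof -
  note m = P2_D[OF P2(1)] and n = P2_D[OF P2(2)]
  interpret m: prob_space \<mu> by (rule m)
  let ?T = "mtopology_of X"
  have "AE x in \<nu>. g x = 0"
    using integral_nonneg_eq_0_iff_AE[OF cont_integrable[OF X P2(2) g(1)] AE_I2] g(2) z n(3) by auto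
  then have nV: "emeasure \<nu> {x \<in> space \<nu>. g x \<noteq> 0} = 0"
    using cont_measurable_P2[OF P2(2) g(1)] by (subst (asm) AE_iff_measurable[OF _ refl]) auto
  define V where "V = {x \<in> mspace X. g x \<noteq> 0}"
  have "openin ?T {x \<in> topspace ?T. g x \<in> - {0}}" by (rule openin_continuous_map_preimage[OF g(1)]) auto
  then have V: "openin ?T V" by (simp add: V_def)
  have ex: "\<exists>W. openin ?T W \<and> x \<in> W \<and> W \<in> null_sets \<mu>" if x: "x \<in> V" for x
  proof -
    have "x \<notin> measure_supp X \<nu>" using x V nV n(3) by (auto simp: measure_supp_def V_def)
    then have "x \<notin> measure_supp X \<mu>" using supp by auto
    then obtain W where W: "openin ?T W" "x \<in> W" "\<not> 0 < emeasure \<mu> W"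
      using x by (auto simp: measure_supp_def V_def)
    then show ?thesis using openin_sets_borel_of[OF W(1)] m(2) by (auto simp: null_sets_def)
  qed
  have K0: "{x \<in> mspace X. 1 / Suc k \<le> g x} \<in> null_sets \<mu>" for k
  proof -
    let ?K = "{x \<in> mspace X. 1 / Suc k \<le> g x}"
    have "closedin ?T {x \<in> topspace ?T. g x \<in> {1 / Suc k..}}" by (rule closedin_continuous_map_preimage[OF g(1)]) auto
    then have cK: "closedin ?T ?K" by simp
    then have "compactin ?T ?K" using X by (rule closedin_compact_space[rotated])
    moreover have "?K \<subseteq> \<Union> {W. openin ?T W \<and> W \<in> null_sets \<mu>}"
    proof
      fix x assume "x \<in> ?K"
      moreover have "0 < 1 / real (Suc k)" by simp
      ultimately have "x \<in> V" unfolding V_def by (smt (verit) mem_Collect_eq)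
      then show "x \<in> \<Union> {W. openin ?T W \<and> W \<in> null_sets \<mu>}" using ex by blast
    qed
    ultimately have "\<exists>\<W>. finite \<W> \<and> \<W> \<subseteq> {W. openin ?T W \<and> W \<in> null_sets \<mu>} \<and> ?K \<subseteq> \<Union> \<W>"
      by (intro compactinD) auto
    then obtain \<W> where \<W>: "finite \<W>" "\<W> \<subseteq> {W. openin ?T W \<and> W \<in> null_sets \<mu>}" "?K \<subseteq> \<Union> \<W>"
      by (elim exE conjE)
    have "\<Union> \<W> \<in> null_sets \<mu>" using \<W>(1,2) by (intro null_sets.finite_Union) auto
    moreover have "?K \<in> sets \<mu>" using closedin_sets_borel_of[OF cK] m(2) by simp
    ultimately show ?thesis using \<W>(3) by (rule null_sets_subset)
  qed
  have "V \<subseteq> (\<Union>k. {x \<in> mspace X. 1 / Suc k \<le> g x})"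
  proof
    fix x assume "x \<in> V"
    then have x: "x \<in> mspace X" "0 < g x" using g(2)[of x] by (auto simp: V_def)
    obtain k where "inverse (real (Suc k)) < g x" using reals_Archimedean[OF x(2)] by auto
    then have "1 / Suc k \<le> g x" by (simp add: inverse_eq_divide)
    then show "x \<in> (\<Union>k. {x \<in> mspace X. 1 / Suc k \<le> g x})" using x(1) by blast
  qed
  moreover have "(\<Union>k. {x \<in> mspace X. 1 / Suc k \<le> g x}) \<in> null_sets \<mu>" using K0 by (intro null_sets_UN)
  ultimately have "AE x in \<mu>. g x = 0"
    using m(3) by (intro AE_I'[where N="\<Union>k. {x \<in> mspace X. 1 / Suc k \<le> g x}"]) (auto simp: V_def)
  then have "(\<integral>x. g x \<partial>\<mu>) = (\<integral>x. 0 \<partial>\<mu>)"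
    using cont_measurable_P2[OF P2(1) g(1)] by (intro integral_cong_AE) auto
  then show ?thesis by simp
qed

lemma weak_star_conv_subseq:
  assumes "weak_star_conv X \<mu>k \<mu>" "strict_mono r" shows "weak_star_conv X (\<lambda>k. \<mu>k (r k)) \<mu>"
  unfolding weak_star_conv_def
proof (intro allI impI)
  fix g assume "contr X g"
  then have "(\<lambda>n. \<integral>x. g x \<partial>\<mu>k n) \<longlonglongrightarrow> (\<integral>x. g x \<partial>\<mu>)" using assms(1) unfolding weak_star_conv_def by blast
  from LIMSEQ_subseq_LIMSEQ[OF this assms(2)] show "(\<lambda>n. \<integral>x. g x \<partial>\<mu>k (r n)) \<longlonglongrightarrow> (\<integral>x. g x \<partial>\<mu>)" by (simp add: o_def)
qed

text \<open>Sequential compactness is applied once for each index n. After finitely many terms the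
  diagonal sequence is a subsequence of the one chosen for n, and dropping these terms does not
  affect the limit.\<close>

lemma weak_diagonal_subseq:
  assumes X: "compact_space (mtopology_of X)" and \<eta>: "\<And>k n. \<eta> k n \<in> P2 X"
  obtains d :: "nat \<Rightarrow> nat" where "strict_mono d" "\<forall>n :: nat. \<exists>\<mu>\<in>P2 X. weak_star_conv X (\<lambda>k. \<eta> (d k) n) \<mu>"
proof -
  define P where "P n s \<longleftrightarrow> (\<exists>\<mu>\<in>P2 X. weak_star_conv X (\<lambda>k. \<eta> (s k) n) \<mu>)" for n :: nat and s :: "nat \<Rightarrow> nat"
  interpret subseqs P
  proof
    fix n and s :: "nat \<Rightarrow> nat" assume "strict_mono s"
    obtain r :: "nat \<Rightarrow> nat" and \<mu>' where "strict_mono r" "\<mu>' \<in> P2 X" "weak_star_conv X (\<lambda>k. \<eta> (s (r k)) n) \<mu>'"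
      using P2_sequentially_compact[OF X, of "\<lambda>k. \<eta> (s k) n"] \<eta> by blast
    then show "\<exists>r'. strict_mono r' \<and> P n (s \<circ> r')" unfolding P_def by (auto simp: o_def)
  qed
  have "\<exists>\<mu>\<in>P2 X. weak_star_conv X (\<lambda>k. \<eta> (diagseq k) n) \<mu>" for n
  proof -
    have "P n (diagseq \<circ> (+) (Suc n))"
    proof (rule diagseq_holds)
      fix r s :: "nat \<Rightarrow> nat" and n assume "strict_mono r" "P n s"
      then obtain \<mu> where "\<mu> \<in> P2 X" "weak_star_conv X (\<lambda>k. \<eta> (s k) n) \<mu>" by (auto simp: P_def)
      with weak_star_conv_subseq[OF this(2) \<open>strict_mono r\<close>] show "P n (s \<circ> r)" by (auto simp: P_def)
    qed
    then obtain \<mu> where \<mu>: "\<mu> \<in> P2 X" "weak_star_conv X (\<lambda>k. \<eta> (diagseq (Suc n + k)) n) \<mu>" by (auto simp: P_def)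
    have "weak_star_conv X (\<lambda>k. \<eta> (diagseq k) n) \<mu>"
      unfolding weak_star_conv_def
    proof (intro allI impI)
      fix g assume "contr X g"
      then have "(\<lambda>k. \<integral>x. g x \<partial>\<eta> (diagseq (k + Suc n)) n) \<longlonglongrightarrow> (\<integral>x. g x \<partial>\<mu>)"
        using \<mu>(2) unfolding weak_star_conv_def by (simp add: add.commute)
      then show "(\<lambda>k. \<integral>x. g x \<partial>\<eta> (diagseq k) n) \<longlonglongrightarrow> (\<integral>x. g x \<partial>\<mu>)"
        by (rule LIMSEQ_offset[where f="\<lambda>k. \<integral>x. g x \<partial>\<eta> (diagseq k) n"])
    qed
    then show ?thesis using \<mu>(1) by blast
  qed
  then show ?thesis using that subseq_diagseq by blast
qed

text \<open>Along a common subsequence the curves converge at rational times. At any other time the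
  value is a limit along a further subsequence that depends on the time. This suffices, since the
  distance between the values at two times is estimated through a rational time in between.\<close>

lemma limit_geodesic:
  assumes X: "compact_space (mtopology_of X)" and \<eta>: "\<And>k t. t \<in> {0..1} \<Longrightarrow> \<eta> k t \<in> P2 X"
    and \<mu>01: "\<mu>0 \<in> P2 X" "\<mu>1 \<in> P2 X"
    and w: "weak_star_conv X (\<lambda>k. \<eta> k 0) \<mu>0" "weak_star_conv X (\<lambda>k. \<eta> k 1) \<mu>1"
    and W: "\<And>k t s. t \<in> {0..1} \<Longrightarrow> s \<in> {0..1} \<Longrightarrow> (W2 X (\<eta> k t) (\<eta> k s))\<^sup>2 \<le> (t - s)\<^sup>2 * b k + e k"
    and b: "b \<longlonglongrightarrow> (W2 X \<mu>0 \<mu>1)\<^sup>2" and e: "e \<longlonglongrightarrow> (0 :: real)"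
  obtains \<mu> where "wasserstein_geodesic X \<mu>0 \<mu>1 \<mu>"
    "\<forall>t\<in>{0..1}. \<exists>r. strict_mono r \<and> weak_star_conv X (\<lambda>k. \<eta> (r k) t) (\<mu> t)"
proof -
  define D where "D = W2 X \<mu>0 \<mu>1"
  have D0: "0 \<le> D" unfolding D_def by (rule W2_nonneg[OF \<mu>01])
  define Q where "Q = \<rat> \<inter> {0..1::real}"
  have "0 \<in> Q" by (simp add: Q_def)
  then have Q: "countable Q" "Q \<noteq> {}" unfolding Q_def by (auto intro: countable_subset[OF _ countable_rat])
  define q where "q = from_nat_into Q"
  have q: "range q = Q" unfolding q_def by (rule range_from_nat_into[OF Q(2,1)])
  have "\<eta> k (q n) \<in> P2 X" for k n
  proof -
    have "q n \<in> Q" using q by auto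
    then show ?thesis using \<eta> by (simp add: Q_def)
  qed
  then obtain d :: "nat \<Rightarrow> nat" where d: "strict_mono d" "\<forall>n. \<exists>\<mu>\<in>P2 X. weak_star_conv X (\<lambda>k. \<eta> (d k) (q n)) \<mu>"
    by (rule weak_diagonal_subseq[OF X])
  define R where "R t \<mu> \<longleftrightarrow> \<mu> \<in> P2 X \<and> (\<exists>r. strict_mono r \<and> weak_star_conv X (\<lambda>k. \<eta> (d (r k)) t) \<mu>) \<and>
      (t \<in> Q \<longrightarrow> weak_star_conv X (\<lambda>k. \<eta> (d k) t) \<mu>)" for t \<mu>
  have idm: "strict_mono (\<lambda>k :: nat. k)" by (simp add: strict_mono_def)
  \<comment> \<open>The values at 0 and 1 are prescribed, since weak convergence to the given
    endpoints is already known; outside [0, 1] any value will do.\<close>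
  have "\<exists>\<mu>. (t \<in> {0..1} \<longrightarrow> R t \<mu>) \<and> (t = 0 \<longrightarrow> \<mu> = \<mu>0) \<and> (t = 1 \<longrightarrow> \<mu> = \<mu>1)" for t
  proof -
    consider "t = 0" | "t = 1" | "t \<noteq> 0" "t \<noteq> 1" "t \<in> Q" | "t \<noteq> 0" "t \<noteq> 1" "t \<notin> Q" "t \<in> {0..1}" | "t \<notin> {0..1}" by blast
    then show ?thesis
    proof cases
      case 1
      have "R 0 \<mu>0" unfolding R_def using \<mu>01(1) weak_star_conv_subseq[OF w(1) d(1)] idm by blast
      then show ?thesis using 1 by auto
    next
      case 2
      have "R 1 \<mu>1" unfolding R_def using \<mu>01(2) weak_star_conv_subseq[OF w(2) d(1)] idm by blast
      then show ?thesis using 2 by auto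
    next
      case 3
      then obtain n where "t = q n" using q by auto
      then obtain \<mu> where "\<mu> \<in> P2 X" "weak_star_conv X (\<lambda>k. \<eta> (d k) t) \<mu>" using d(2) by blast
      then have "R t \<mu>" unfolding R_def using idm by blast
      then show ?thesis using 3 by auto
    next
      case 4
      then obtain r :: "nat \<Rightarrow> nat" and \<mu> where "strict_mono r" "\<mu> \<in> P2 X" "weak_star_conv X (\<lambda>k. \<eta> (d (r k)) t) \<mu>"
        using P2_sequentially_compact[OF X, of "\<lambda>k. \<eta> (d k) t"] \<eta> by blast
      then have "R t \<mu>" unfolding R_def using 4 by blast
      then show ?thesis using 4 by auto
    next
      case 5
      then show ?thesis by auto
    qed
  qed
  then obtain \<mu> where \<mu>: "\<And>t. t \<in> {0..1} \<Longrightarrow> R t (\<mu> t)" "\<mu> 0 = \<mu>0" "\<mu> 1 = \<mu>1" by metis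
  have P2: "\<mu> t \<in> P2 X" if "t \<in> {0..1}" for t using \<mu>(1)[OF that] by (simp add: R_def)
  have lim: "W2 X (\<mu> t) (\<mu> s) \<le> \<bar>t - s\<bar> * D"
    if ts: "t \<in> {0..1}" "s \<in> {0..1}" and r: "strict_mono r" "weak_star_conv X (\<lambda>k. \<eta> (d (r k)) t) (\<mu> t)"
      "weak_star_conv X (\<lambda>k. \<eta> (d (r k)) s) (\<mu> s)" for t s r
  proof -
    have dr: "strict_mono (d \<circ> r)" by (rule strict_mono_o[OF d(1) r(1)])
    have "(\<lambda>k. (t - s)\<^sup>2 * b k + e k) \<longlonglongrightarrow> (t - s)\<^sup>2 * D\<^sup>2 + 0"
      using b e unfolding D_def by (intro tendsto_intros)
    from LIMSEQ_subseq_LIMSEQ[OF this dr]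
    have "(\<lambda>k. (t - s)\<^sup>2 * b (d (r k)) + e (d (r k))) \<longlonglongrightarrow> (t - s)\<^sup>2 * D\<^sup>2" by (simp add: o_def)
    then have "(W2 X (\<mu> t) (\<mu> s))\<^sup>2 \<le> (t - s)\<^sup>2 * D\<^sup>2"
      using ts by (intro W2_lower_semicontinuous[OF X _ _ P2 P2 r(2,3) W]) (auto intro: \<eta>)
    also have "\<dots> = (\<bar>t - s\<bar> * D)\<^sup>2" by (simp add: power_mult_distrib)
    finally show ?thesis by (rule power2_le_imp_le) (simp add: D0)
  qed
  \<comment> \<open>At a time in \<open>Q\<close> the curves converge along all of \<open>d\<close>,
    hence also along the further subsequence belonging to t.\<close>
  have limQ: "W2 X (\<mu> t) (\<mu> s) \<le> \<bar>t - s\<bar> * D" if t: "t \<in> {0..1}" and s: "s \<in> Q" for t s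
  proof -
    obtain r where r: "strict_mono r" "weak_star_conv X (\<lambda>k. \<eta> (d (r k)) t) (\<mu> t)" using \<mu>(1)[OF t] unfolding R_def by blast
    have s': "s \<in> {0..1}" using s by (simp add: Q_def)
    then have "weak_star_conv X (\<lambda>k. \<eta> (d k) s) (\<mu> s)" using \<mu>(1)[OF s'] s by (simp add: R_def)
    then show ?thesis by (intro lim[OF t s' r] weak_star_conv_subseq[OF _ r(1), where \<mu>k="\<lambda>k. \<eta> (d k) s"])
  qed
  have upper: "W2 X (\<mu> t) (\<mu> s) \<le> (s - t) * D" if ts: "t \<in> {0..1}" "s \<in> {0..1}" "t \<le> s" for t s
  proof (cases "t = s")
    case True
    obtain r where r: "strict_mono r" "weak_star_conv X (\<lambda>k. \<eta> (d (r k)) t) (\<mu> t)" using \<mu>(1)[OF ts(1)] unfolding R_def by blast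
    show ?thesis using lim[OF ts(1,1) r r(2)] True by simp
  next
    case False
    then obtain p where p: "p \<in> \<rat>" "t < p" "p < s" using Rats_dense_in_real[of t s] ts by auto
    then have pQ: "p \<in> Q" and p01: "p \<in> {0..1}" using ts by (auto simp: Q_def)
    have "W2 X (\<mu> t) (\<mu> s) \<le> W2 X (\<mu> t) (\<mu> p) + W2 X (\<mu> s) (\<mu> p)"
      using W2_triangle[OF X P2[OF ts(1)] P2[OF p01] P2[OF ts(2)]] W2_commute[OF X P2[OF p01] P2[OF ts(2)]] by simp
    also have "\<dots> \<le> (p - t) * D + (s - p) * D"
      using limQ[OF ts(1) pQ] limQ[OF ts(2) pQ] p by simp
    finally show ?thesis by (simp add: algebra_simps)
  qed
  \<comment> \<open>The three upper bounds over [0, t], [t, s] and [s, 1] add up to the distance of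
    the endpoints, so the triangle inequality forces equality.\<close>
  have eq: "W2 X (\<mu> t) (\<mu> s) = (s - t) * D" if ts: "t \<in> {0..1}" "s \<in> {0..1}" "t \<le> s" for t s
  proof -
    have "D \<le> W2 X (\<mu> 0) (\<mu> t) + (W2 X (\<mu> t) (\<mu> s) + W2 X (\<mu> s) (\<mu> 1))"
      using W2_triangle[OF X P2 P2[OF ts(1)] P2, of 0 1] W2_triangle[OF X P2[OF ts(1)] P2[OF ts(2)] P2, of 1]
      by (simp add: D_def \<mu>)
    also have "\<dots> \<le> (t - 0) * D + (W2 X (\<mu> t) (\<mu> s) + (1 - s) * D)"
      using upper[of 0 t] upper[of s 1] ts by (intro add_mono) auto
    finally have "(s - t) * D \<le> W2 X (\<mu> t) (\<mu> s)" by (simp add: algebra_simps)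
    then show ?thesis using upper[OF ts] by simp
  qed
  have "wasserstein_geodesic X \<mu>0 \<mu>1 \<mu>"
    unfolding wasserstein_geodesic_def
  proof (intro conjI ballI)
    fix t s :: real assume ts: "t \<in> {0..1}" "s \<in> {0..1}"
    show "W2 X (\<mu> t) (\<mu> s) = \<bar>t - s\<bar> * W2 X \<mu>0 \<mu>1"
      using eq[OF ts] eq[OF ts(2,1)] W2_commute[OF X P2[OF ts(1)] P2[OF ts(2)]] by (cases "t \<le> s") (auto simp: D_def)
  qed (use \<mu> P2 in auto)
  moreover have "\<exists>r. strict_mono r \<and> weak_star_conv X (\<lambda>k. \<eta> (r k) t) (\<mu> t)" if t: "t \<in> {0..1}" for t
  proof -
    obtain r where "strict_mono r" "weak_star_conv X (\<lambda>k. \<eta> (d (r k)) t) (\<mu> t)" using \<mu>(1)[OF t] unfolding R_def by blast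
    then show ?thesis using strict_mono_o[OF d(1), of r] by (intro exI[of _ "d \<circ> r"]) simp
  qed
  ultimately show ?thesis using that by blast
qed

section \<open>Stability of displacement convexity\<close>

text \<open>A continuous minorant pair on \<open>X\<close> whose value exceeds \<open>L\<close> is
  fixed. Its compositions with f k are minorant pairs on \<open>Y k\<close>, so its value is a limit
  of numbers at most c k, which is a contradiction.\<close>

lemma U_functional_lower_semicontinuous:
  assumes X: "compact_space (mtopology_of X)" and U: "admissible U" and P2: "\<mu> \<in> P2 X" "\<nu> \<in> P2 X"
    and f: "\<And>k. f k \<in> measurable (borel_of (Y k)) (borel_of X)"
    and \<kappa>: "\<And>k. \<kappa> k \<in> P2 (Y k)" "\<And>k. \<nu>' k \<in> P2 (Y k)"
    and w: "weak_star_conv X (\<lambda>k. distr (\<kappa> k) (borel_of X) (f k)) \<mu>"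
      "weak_star_conv X (\<lambda>k. distr (\<nu>' k) (borel_of X) (f k)) \<nu>"
    and c: "\<And>k. U_functional U (\<nu>' k) (\<kappa> k) \<le> ereal (c k)" "c \<longlonglongrightarrow> L"
  shows "U_functional U \<nu> \<mu> \<le> ereal L"
proof (rule ccontr)
  assume "\<not> ?thesis"
  then have less: "ereal L < U_functional U \<nu> \<mu>" by simp
  obtain a b where ab: "contr X a" "contr X b" "\<forall>x\<in>mspace X. minorant U (a x) (b x)"
    "L < (\<integral>x. a x \<partial>\<mu>) - (\<integral>x. b x \<partial>\<nu>)"
    by (rule U_functional_less[OF X U P2 less])
  obtain A where A: "\<And>x. x \<in> mspace X \<Longrightarrow> \<bar>a x\<bar> \<le> A" using cont_bounded[OF X ab(1)] by blast
  obtain B where B: "\<And>x. x \<in> mspace X \<Longrightarrow> \<bar>b x\<bar> \<le> B" using cont_bounded[OF X ab(2)] by blast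
  have le: "(\<integral>x. a x \<partial>distr (\<kappa> k) (borel_of X) (f k)) - (\<integral>x. b x \<partial>distr (\<nu>' k) (borel_of X) (f k)) \<le> c k" for k
  proof -
    note s = P2_D[OF \<kappa>(1)[of k]] and n = P2_D[OF \<kappa>(2)[of k]]
    have fX: "f k x \<in> mspace X" if "x \<in> mspace (Y k)" for x using measurable_space[OF f, of x k] that by simp
    have fm: "f k \<in> measurable (\<kappa> k) (borel_of X)" "f k \<in> measurable (\<nu>' k) (borel_of X)"
      using f[of k] by (simp_all add: measurable_cong_sets[OF s(2) refl] measurable_cong_sets[OF n(2) refl])
    have m: "(\<lambda>x. a (f k x)) \<in> borel_measurable (\<nu>' k)" "(\<lambda>x. b (f k x)) \<in> borel_measurable (\<nu>' k)"
      using measurable_compose[OF fm(2) cont_measurable[OF ab(1)]] measurable_compose[OF fm(2) cont_measurable[OF ab(2)]] .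
    have "ereal ((\<integral>x. a (f k x) \<partial>\<kappa> k) - (\<integral>x. b (f k x) \<partial>\<nu>' k)) \<le> U_functional U (\<nu>' k) (\<kappa> k)"
      using A B fX ab(3) n(3) s(2) n(2)
      by (intro U_functional_ge[OF U s(1) n(1) _ m(1) _ m(2), where B="max A B"]) (auto simp: le_max_iff_disj)
    also have "\<dots> \<le> ereal (c k)" by (rule c(1))
    finally show ?thesis
      by (simp add: integral_distr[OF fm(1) cont_measurable[OF ab(1)]] integral_distr[OF fm(2) cont_measurable[OF ab(2)]])
  qed
  have "(\<lambda>k. (\<integral>x. a x \<partial>distr (\<kappa> k) (borel_of X) (f k)) - (\<integral>x. b x \<partial>distr (\<nu>' k) (borel_of X) (f k)))
      \<longlonglongrightarrow> (\<integral>x. a x \<partial>\<mu>) - (\<integral>x. b x \<partial>\<nu>)"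
    using w ab(1,2) unfolding weak_star_conv_def by (intro tendsto_diff) blast+
  then have "(\<integral>x. a x \<partial>\<mu>) - (\<integral>x. b x \<partial>\<nu>) \<le> L" using le by (intro LIMSEQ_le[OF _ c(2)]) auto
  then show False using ab(4) by simp
qed

section \<open>Auxiliary facts for the stability theorem\<close>

lemma ereal_convex_combination:
  fixes u :: ereal assumes "u \<noteq> -\<infinity>" "t \<in> {0..1}"
  shows "ereal t * u + ereal (1 - t) * u = u"
  using assms by (cases u; cases "t = 0"; cases "t = 1") (auto simp: algebra_simps)

lemma admissible_bounded:
  assumes "admissible U" obtains B where "0 \<le> B" "\<And>s. 0 \<le> s \<Longrightarrow> s \<le> 2 \<Longrightarrow> U s \<le> B"
proof -
  have "continuous_on {0..2} U" using assms by (auto simp: admissible_def intro: continuous_on_subset[of "{0..}"])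
  then have "compact (U ` {0..2})" by (intro compact_continuous_image) auto
  then obtain C where "\<And>y. y \<in> U ` {0..2} \<Longrightarrow> norm y \<le> C" using compact_imp_bounded bounded_iff by metis
  then have "U s \<le> max C 0" if "0 \<le> s" "s \<le> 2" for s using that by fastforce
  then show ?thesis using that[of "max C 0"] by auto
qed

text \<open>As (1 + \<theta>)/2 is below 1, convergence of the cell masses suffices in cells of
  positive \<nu>-mass; the others are trivial, and there are finitely many cells.\<close>

lemma mass_eventually:
  assumes X: "compact_space (mtopology_of X)" and \<nu>: "\<nu> \<in> P2 X"
    and \<nu>s: "\<And>i. \<nu>s i \<in> P2 (Xs i)" and f: "\<And>i. f i \<in> measurable (borel_of (Xs i)) (borel_of X)"
    and w: "weak_star_conv X (\<lambda>i. distr (\<nu>s i) (borel_of X) (f i)) \<nu>"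
    and \<phi>: "fine_partition X \<delta> J \<phi>" and \<theta>: "\<theta> < 1"
  shows "\<forall>\<^sub>F i in sequentially. \<forall>j\<in>J. (\<integral>x. \<phi> j x \<partial>\<nu>) * (1 + \<theta>) \<le> 2 * (\<integral>x. \<phi> j (f i x) \<partial>\<nu>s i)"
proof (rule eventually_ball_finite)
  note F = fine_partition_D[OF \<phi>]
  show "finite J" by (rule F(1))
  show "\<forall>j\<in>J. \<forall>\<^sub>F i in sequentially. (\<integral>x. \<phi> j x \<partial>\<nu>) * (1 + \<theta>) \<le> 2 * (\<integral>x. \<phi> j (f i x) \<partial>\<nu>s i)"
  proof
    fix j assume j: "j \<in> J"
    have fX: "f i x \<in> mspace X" if "x \<in> mspace (Xs i)" for i x using measurable_space[OF f, of x i] that by simp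
    have n0: "0 \<le> (\<integral>x. \<phi> j x \<partial>\<nu>)" using F(4)[OF j] P2_D(3)[OF \<nu>] by (intro integral_nonneg_AE AE_I2) auto
    have ni0: "0 \<le> (\<integral>x. \<phi> j (f i x) \<partial>\<nu>s i)" for i
      using F(4)[OF j] P2_D(3)[OF \<nu>s[of i]] fX by (intro integral_nonneg_AE AE_I2) auto
    have fm: "f i \<in> measurable (\<nu>s i) (borel_of X)" for i
      using f[of i] by (simp add: measurable_cong_sets[OF P2_D(2)[OF \<nu>s] refl])
    have "(\<lambda>i. \<integral>x. \<phi> j x \<partial>distr (\<nu>s i) (borel_of X) (f i)) \<longlonglongrightarrow> (\<integral>x. \<phi> j x \<partial>\<nu>)"
      using w F(3)[OF j] unfolding weak_star_conv_def by blast
    then have lim: "(\<lambda>i. \<integral>x. \<phi> j (f i x) \<partial>\<nu>s i) \<longlonglongrightarrow> (\<integral>x. \<phi> j x \<partial>\<nu>)"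
      by (simp add: integral_distr[OF fm cont_measurable[OF F(3)[OF j]]])
    show "\<forall>\<^sub>F i in sequentially. (\<integral>x. \<phi> j x \<partial>\<nu>) * (1 + \<theta>) \<le> 2 * (\<integral>x. \<phi> j (f i x) \<partial>\<nu>s i)"
    proof (cases "(\<integral>x. \<phi> j x \<partial>\<nu>) = 0")
      case True
      then show ?thesis using ni0 by simp
    next
      case False
      then have "(\<integral>x. \<phi> j x \<partial>\<nu>) * (1 + \<theta>) / 2 < (\<integral>x. \<phi> j x \<partial>\<nu>)" using n0 \<theta> by simp
      from order_tendstoD(1)[OF lim this] show ?thesis by eventually_elim simp
    qed
  qed
qed

theorem theorem4p27:
  fixes Xs :: "nat \<Rightarrow> 'a metric" and \<nu>s :: "nat \<Rightarrow> 'a measure"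
    and X :: "'b metric" and \<nu> :: "'b measure"
    and F :: "(real \<Rightarrow> real) set" and lam :: "(real \<Rightarrow> real) \<Rightarrow> ereal"
  assumes "\<And>i. compact_measured_length_space (Xs i) (\<nu>s i)"
    and "compact_measured_metric_space X \<nu>"
    and "measured_GH_conv Xs \<nu>s X \<nu>"
    and "\<And>U. U \<in> F \<Longrightarrow> continuous_on {0..} U \<and> convex_on {0..} U \<and> U 0 = 0"
    and "\<And>U. U \<in> F \<Longrightarrow> lam U \<noteq> \<infinity>"
    and "\<And>i. weakly_displacement_convex (Xs i) (\<nu>s i) F lam"
  shows "weakly_displacement_convex X \<nu> F lam"
  unfolding weakly_displacement_convex_def
proof (intro ballI impI)
  fix \<mu>0 \<mu>1
  assume \<mu>01: "\<mu>0 \<in> P2 X" "\<mu>1 \<in> P2 X"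
    and supp: "measure_supp X \<mu>0 \<subseteq> measure_supp X \<nu> \<and> measure_supp X \<mu>1 \<subseteq> measure_supp X \<nu>"
  have X: "compact_space (mtopology_of X)" and \<nu>: "\<nu> \<in> P2 X"
    using assms(2) by (auto simp: compact_measured_metric_space_def)
  have Xs: "compact_space (mtopology_of (Xs i))" and \<nu>s: "\<nu>s i \<in> P2 (Xs i)" for i
    using assms(1)[of i] by (auto simp: compact_measured_length_space_def compact_measured_metric_space_def)
  have adm: "admissible U" if "U \<in> F" for U using assms(4)[OF that] by (simp add: admissible_def)
  let ?D = "W2 X \<mu>0 \<mu>1"
  let ?ineq = "\<lambda>\<mu> U t. U_functional U \<nu> (\<mu> t) \<le> ereal t * U_functional U \<nu> \<mu>1 + ereal (1 - t) * U_functional U \<nu> \<mu>0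
      - ereal (1 / 2) * lam U * ereal (t * (1 - t)) * ereal (?D\<^sup>2)"
  show "\<exists>\<mu>. wasserstein_geodesic X \<mu>0 \<mu>1 \<mu> \<and> (\<forall>U\<in>F. \<forall>t\<in>{0..1}. ?ineq \<mu> U t)"
  \<comment> \<open>If the distance is 0, the \<lambda>-term vanishes even for \<lambda> U =
    -\<infinity>, whereas the transplanted measures may lie at positive distance and satisfy only a
    trivial inequality. The constant curve settles this case directly.\<close>
  proof (cases "?D = 0")
    case True
    then have eq: "\<mu>1 = \<mu>0" using W2_eq_0_imp_eq[OF X \<mu>01] by simp
    have "wasserstein_geodesic X \<mu>0 \<mu>1 (\<lambda>_. \<mu>0)"
      using \<mu>01 True eq by (simp add: wasserstein_geodesic_def)
    moreover have "?ineq (\<lambda>_. \<mu>0) U t" if "U \<in> F" "t \<in> {0..1}" for U t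
      using ereal_convex_combination[OF U_functional_not_MInf[OF adm[OF that(1)] \<mu>01(1) \<nu>] that(2)] True eq
      by (simp flip: zero_ereal_def)
    ultimately show ?thesis by blast
  next
    case False
    then have Dpos: "0 < ?D" using W2_nonneg[OF \<mu>01] by simp

    \<comment> \<open>Parameters of the approximation\<close>
    obtain \<epsilon> f where gh: "\<And>i. GH_approximation (\<epsilon> i) (Xs i) X (f i)" and \<epsilon>: "\<epsilon> \<longlonglongrightarrow> 0"
      and wk: "weak_star_conv X (\<lambda>i. distr (\<nu>s i) (borel_of X) (f i)) \<nu>"
      using assms(3) by (auto simp: measured_GH_conv_def)
    have fm: "f i \<in> measurable (borel_of (Xs i)) (borel_of X)" for i using gh[of i] by (simp add: GH_approximation_def)
    obtain Dia where Dia: "0 \<le> Dia" "\<And>x y. x \<in> mspace X \<Longrightarrow> y \<in> mspace X \<Longrightarrow> mdist X x y \<le> Dia"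
      using mdist_bounded[OF X] by blast
    define \<delta> where "\<delta> k = 1 / real (Suc k)" for k
    have \<delta>: "0 < \<delta> k" "\<delta> k \<le> 1" for k by (auto simp: \<delta>_def)
    have \<delta>0: "\<delta> \<longlonglongrightarrow> 0" unfolding \<delta>_def by (rule LIMSEQ_Suc[OF lim_const_over_n])
    \<comment> \<open>A single null sequence \<delta> controls the mesh, the admixture of \<nu> and,
      through the choice of the index, the approximation error.\<close>
    define \<theta> where "\<theta> k = 1 - \<delta> k" for k
    have \<theta>: "0 \<le> \<theta> k" "\<theta> k < 1" for k using \<delta>[of k] by (auto simp: \<theta>_def)
    \<comment> \<open>The index i is chosen after the partition, because the mass condition holds
      only from some i on that depends on the partition. The clause k \<le> i makes the chosen
      indices tend to infinity.\<close>
    define R where "R k i J \<phi> \<longleftrightarrow> k \<le> i \<and> \<epsilon> i \<le> \<delta> k \<and> fine_partition X (\<delta> k) J \<phi> \<and>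
      (\<forall>j\<in>J. (\<integral>x. \<phi> j x \<partial>\<nu>) * (1 + \<theta> k) \<le> 2 * (\<integral>x. \<phi> j (f i x) \<partial>\<nu>s i))" for k i J \<phi>
    have "\<exists>i J \<phi>. R k i J \<phi>" for k
    proof -
      obtain J \<phi> where \<phi>: "fine_partition X (\<delta> k) J \<phi>" using fine_partition_exists[OF X \<delta>(1)] by blast
      have "\<forall>\<^sub>F i in sequentially. \<epsilon> i < \<delta> k" by (rule order_tendstoD(2)[OF \<epsilon> \<delta>(1)])
      moreover have "\<forall>\<^sub>F i in sequentially. k \<le> i" by (rule eventually_ge_at_top)
      ultimately have "\<forall>\<^sub>F i in sequentially. R k i J \<phi>"
        using mass_eventually[OF X \<nu> \<nu>s fm wk \<phi> \<theta>(2)[of k]]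
      proof eventually_elim
        case (elim i)
        then show ?case using \<phi> by (simp add: R_def)
      qed
      then obtain i where "R k i J \<phi>" by (metis eventually_sequentially order_refl)
      then show ?thesis by blast
    qed
    then obtain I J \<phi> where R: "\<And>k. R k (I k) (J k) (\<phi> k)" by metis
    have I: "k \<le> I k" "\<epsilon> (I k) \<le> \<delta> k" and \<phi>: "fine_partition X (\<delta> k) (J k) (\<phi> k)" for k
      using R[of k] by (auto simp: R_def)
    interpret T: transplantation X \<nu> "Xs (I k)" "\<nu>s (I k)" "f (I k)" "\<epsilon> (I k)" "\<delta> k" "\<theta> k" "J k" "\<phi> k" for k
      using X Xs \<nu> \<nu>s gh \<phi> \<delta>(1)[of k] \<theta>[of k] R[of k] by unfold_locales (auto simp: R_def less_imp_le)
    have \<epsilon>0: "0 \<le> \<epsilon> (I k)" for k by (rule T.\<epsilon>_nonneg)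
    have dom0: "T.dominated k \<mu>0" and dom1: "T.dominated k \<mu>1" for k
      using integral_zero_if_supp_subset[OF X \<mu>01(1) \<nu> _ T.F(3) T.F(4)] integral_zero_if_supp_subset[OF X \<mu>01(2) \<nu> _ T.F(3) T.F(4)]
        supp \<mu>01 by (auto simp: T.dominated_def)
    have "\<exists>\<pi>. \<pi> \<in> couplings X \<mu>0 \<mu>1 \<and> cost X \<pi> < ?D\<^sup>2 + \<delta> k" for k
      using W2_squared_approx[OF \<mu>01 \<delta>(1)] by metis
    then obtain \<pi> where \<pi>: "\<And>k. \<pi> k \<in> couplings X \<mu>0 \<mu>1" "\<And>k. cost X (\<pi> k) < ?D\<^sup>2 + \<delta> k" by metis

    \<comment> \<open>Transplanted endpoints and geodesics between them\<close>
    define a where "a k = transplant (J k) (\<phi> k) (f (I k)) (\<nu>s (I k)) (T.weight k \<mu>0)" for k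
    define b where "b k = transplant (J k) (\<phi> k) (f (I k)) (\<nu>s (I k)) (T.weight k \<mu>1)" for k
    have aP: "a k \<in> P2 (Xs (I k))" and bP: "b k \<in> P2 (Xs (I k))" for k
      unfolding a_def b_def using T.moved_P2 dom0 dom1 by auto
    define W where "W k = (W2 (Xs (I k)) (a k) (b k))\<^sup>2" for k
    \<comment> \<open>The factors 5 and 3 come from 4 \<delta> + \<epsilon> and 2 \<delta> +
      \<epsilon>, with the approximation error at most \<delta>. In \<open>e2\<close> the diameter
      of the approximating space is at most that of \<open>X\<close> plus \<delta>.\<close>
    define e1 where "e1 k = \<delta> k + 5 * \<delta> k * (2 * Dia + 5 * \<delta> k) + (3 * \<delta> k)\<^sup>2" for k
    define e2 where "e2 k = \<delta> k * (2 * (Dia + \<delta> k) + \<delta> k)" for k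
    have e1: "e1 \<longlonglongrightarrow> 0" unfolding e1_def by (rule tendsto_eq_intros \<delta>0 refl | simp)+
    have e2: "e2 \<longlonglongrightarrow> 0" unfolding e2_def by (rule tendsto_eq_intros \<delta>0 refl | simp)+
    have Wle: "W k \<le> ?D\<^sup>2 + e1 k" for k
    proof -
      have "W k \<le> cost X (\<pi> k) + (4 * \<delta> k + \<epsilon> (I k)) * (2 * Dia + (4 * \<delta> k + \<epsilon> (I k))) + (2 * \<delta> k + \<epsilon> (I k))\<^sup>2"
        unfolding W_def a_def b_def by (rule T.moved_W2(3)[OF dom0 dom1 \<pi>(1) Dia(2,1)])
      also have "(4 * \<delta> k + \<epsilon> (I k)) * (2 * Dia + (4 * \<delta> k + \<epsilon> (I k))) \<le> 5 * \<delta> k * (2 * Dia + 5 * \<delta> k)"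
        using I(2)[of k] \<epsilon>0[of k] \<delta>(1)[of k] Dia(1) by (intro mult_mono) auto
      also have "(2 * \<delta> k + \<epsilon> (I k))\<^sup>2 \<le> (3 * \<delta> k)\<^sup>2"
        using I(2)[of k] \<epsilon>0[of k] \<delta>(1)[of k] by (intro power_mono) auto
      finally show ?thesis using \<pi>(2)[of k] by (simp add: e1_def)
    qed
    \<comment> \<open>The geodesic is chosen before U is quantified, so the same sequence of curves
      serves the whole family.\<close>
    have "\<exists>\<gamma>. wasserstein_geodesic (Xs (I k)) (a k) (b k) \<gamma> \<and> (\<forall>U\<in>F. \<forall>t\<in>{0..1}.
        U_functional U (\<nu>s (I k)) (\<gamma> t) \<le> ereal t * U_functional U (\<nu>s (I k)) (b k) + ereal (1 - t) * U_functional U (\<nu>s (I k)) (a k)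
          - ereal (1 / 2) * lam U * ereal (t * (1 - t)) * ereal (W k))" for k
      using assms(6)[of "I k"] aP[of k] bP[of k] T.moved_supp[of k \<mu>0] T.moved_supp[of k \<mu>1]
      unfolding weakly_displacement_convex_def W_def a_def b_def by blast
    then obtain \<gamma> where \<gamma>: "\<And>k. wasserstein_geodesic (Xs (I k)) (a k) (b k) (\<gamma> k)"
      and \<gamma>U: "\<And>k U t. U \<in> F \<Longrightarrow> t \<in> {0..1} \<Longrightarrow> U_functional U (\<nu>s (I k)) (\<gamma> k t) \<le>
        ereal t * U_functional U (\<nu>s (I k)) (b k) + ereal (1 - t) * U_functional U (\<nu>s (I k)) (a k)
          - ereal (1 / 2) * lam U * ereal (t * (1 - t)) * ereal (W k)" by metis
    have \<gamma>P: "\<gamma> k t \<in> P2 (Xs (I k))" if "t \<in> {0..1}" for k t using \<gamma>[of k] that by (simp add: wasserstein_geodesic_def)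
    define \<eta> where "\<eta> k t = distr (\<gamma> k t) (borel_of X) (f (I k))" for k t
    have \<eta>P: "\<eta> k t \<in> P2 X" if "t \<in> {0..1}" for k t
      unfolding \<eta>_def by (rule distr_P2[OF \<gamma>P[OF that] fm])
    have \<eta>W: "(W2 X (\<eta> k t) (\<eta> k s))\<^sup>2 \<le> (t - s)\<^sup>2 * W k + e2 k" if ts: "t \<in> {0..1}" "s \<in> {0..1}" for k t s
    proof -
      have dle: "mdist X (f (I k) x) (f (I k) y) \<le> mdist (Xs (I k)) x y + \<epsilon> (I k)" "mdist (Xs (I k)) x y \<le> Dia + \<epsilon> (I k)"
        if "x \<in> mspace (Xs (I k))" "y \<in> mspace (Xs (I k))" for x y
        using T.f_dist[OF that] Dia(2)[OF T.f_in[OF that(1)] T.f_in[OF that(2)]] by auto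
      have "(W2 X (\<eta> k t) (\<eta> k s))\<^sup>2 \<le> (W2 (Xs (I k)) (\<gamma> k t) (\<gamma> k s))\<^sup>2 + \<epsilon> (I k) * (2 * (Dia + \<epsilon> (I k)) + \<epsilon> (I k))"
        unfolding \<eta>_def by (rule W2_distr_le[OF Xs X fm dle \<gamma>P[OF ts(1)] \<gamma>P[OF ts(2)] \<epsilon>0])
      also have "W2 (Xs (I k)) (\<gamma> k t) (\<gamma> k s) = \<bar>t - s\<bar> * W2 (Xs (I k)) (a k) (b k)"
        using \<gamma>[of k] ts by (simp add: wasserstein_geodesic_def)
      also have "(\<bar>t - s\<bar> * W2 (Xs (I k)) (a k) (b k))\<^sup>2 = (t - s)\<^sup>2 * W k" by (simp add: W_def power_mult_distrib)
      also have "\<epsilon> (I k) * (2 * (Dia + \<epsilon> (I k)) + \<epsilon> (I k)) \<le> e2 k"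
        unfolding e2_def using I(2)[of k] \<epsilon>0[of k] Dia(1) by (intro mult_mono add_mono) auto
      finally show ?thesis by simp
    qed

    \<comment> \<open>Convergence of the endpoints and of their distances\<close>
    have wgen: "weak_star_conv X (\<lambda>k. distr (transplant (J k) (\<phi> k) (f (I k)) (\<nu>s (I k)) (T.weight k \<mu>)) (borel_of X) (f (I k))) \<mu>"
      if dom: "\<And>k. T.dominated k \<mu>" for \<mu>
      unfolding weak_star_conv_def
    proof (intro allI impI)
      fix g assume g: "contr X g"
      let ?t = "\<lambda>k. transplant (J k) (\<phi> k) (f (I k)) (\<nu>s (I k)) (T.weight k \<mu>)"
      obtain G where G: "G \<ge> 0" "\<And>x. x \<in> mspace X \<Longrightarrow> \<bar>g x\<bar> \<le> G" using cont_bounded[OF X g] by blast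
      have ftm: "f (I k) \<in> measurable (?t k) (borel_of X)" for k
        using fm[of "I k"] by (simp add: measurable_cong_sets[OF P2_D(2)[OF T.moved_P2[OF dom]] refl])
      show "(\<lambda>k. \<integral>x. g x \<partial>distr (?t k) (borel_of X) (f (I k))) \<longlonglongrightarrow> (\<integral>x. g x \<partial>\<mu>)"
        unfolding integral_distr[OF ftm cont_measurable[OF g]]
      proof (rule LIMSEQ_I)
        fix r :: real assume r: "0 < r"
        obtain d where d: "d > 0" "\<And>x y. x \<in> mspace X \<Longrightarrow> y \<in> mspace X \<Longrightarrow> mdist X x y < d \<Longrightarrow> \<bar>g x - g y\<bar> < r / 4"
          using cont_uniformly[OF X g, of "r / 4"] r by auto
        have "(\<lambda>k. 2 * \<delta> k * G) \<longlonglongrightarrow> 2 * 0 * G" by (intro tendsto_intros \<delta>0)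
        then have "\<forall>\<^sub>F k in sequentially. 2 * \<delta> k * G < r / 2" using r by (intro order_tendstoD(2)) auto
        moreover have "\<forall>\<^sub>F k in sequentially. \<delta> k < d" by (rule order_tendstoD(2)[OF \<delta>0 d(1)])
        ultimately have "\<forall>\<^sub>F k in sequentially. norm ((\<integral>x. g (f (I k) x) \<partial>?t k) - (\<integral>x. g x \<partial>\<mu>)) < r"
        proof eventually_elim
          case (elim k)
          have \<omega>: "\<bar>g x - g y\<bar> \<le> r / 4" if "x \<in> mspace X" "y \<in> mspace X" "mdist X x y \<le> \<delta> k" for x y
            using d(2)[OF that(1,2)] that(3) elim(2) by simp
          have "\<bar>(\<integral>x. g (f (I k) x) \<partial>?t k) - (\<integral>x. g x \<partial>\<mu>)\<bar> \<le> 2 * (r / 4) + 2 * (1 - \<theta> k) * G"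
            by (rule T.moved_weak[OF dom g G(2) \<omega>])
          then show ?case using elim(1) by (simp add: \<theta>_def)
        qed
        then show "\<exists>no. \<forall>k\<ge>no. norm ((\<integral>x. g (f (I k) x) \<partial>?t k) - (\<integral>x. g x \<partial>\<mu>)) < r"
          by (simp add: eventually_sequentially)
      qed
    qed
    have w0: "weak_star_conv X (\<lambda>k. \<eta> k 0) \<mu>0" and w1: "weak_star_conv X (\<lambda>k. \<eta> k 1) \<mu>1"
      using wgen[OF dom0] wgen[OF dom1] \<gamma> unfolding \<eta>_def wasserstein_geodesic_def a_def b_def by simp_all
    \<comment> \<open>Lower semicontinuity of the distance, applied along a subsequence on which the
      bound is assumed to fail.\<close>
    have low: "\<forall>\<^sub>F k in sequentially. ?D\<^sup>2 - h < (W2 X (\<eta> k 0) (\<eta> k 1))\<^sup>2" if h: "0 < h" for h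
    proof (rule ccontr)
      assume "\<not> ?thesis"
      then obtain r where r: "strict_mono (r :: nat \<Rightarrow> nat)" "\<And>k. \<not> ?D\<^sup>2 - h < (W2 X (\<eta> (r k) 0) (\<eta> (r k) 1))\<^sup>2"
        using not_eventually_sequentiallyD by blast
      have "?D\<^sup>2 \<le> ?D\<^sup>2 - h"
      proof (rule W2_lower_semicontinuous[OF X _ _ \<mu>01 weak_star_conv_subseq[OF w0 r(1)] weak_star_conv_subseq[OF w1 r(1)]])
        show "(W2 X (\<eta> (r k) 0) (\<eta> (r k) 1))\<^sup>2 \<le> ?D\<^sup>2 - h" for k using r(2)[of k] by simp
      qed (auto intro: \<eta>P)
      then show False using h by simp
    qed
    \<comment> \<open>The upper bound comes from the transplanted couplings. The lower bound comes
      from pushing the endpoints back to \<open>X\<close>, which increases the squared distance by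
      at most \<open>e2\<close>. Both are needed, as the factor of \<open>W k\<close> in the
      inequality may have either sign.\<close>
    have Wlim: "W \<longlonglongrightarrow> ?D\<^sup>2"
    proof (rule order_tendstoI)
      fix y assume y: "?D\<^sup>2 < y"
      have "(\<lambda>k. ?D\<^sup>2 + e1 k) \<longlonglongrightarrow> ?D\<^sup>2 + 0" by (intro tendsto_intros e1)
      then have "\<forall>\<^sub>F k in sequentially. ?D\<^sup>2 + e1 k < y" using y by (intro order_tendstoD(2)) auto
      then show "\<forall>\<^sub>F k in sequentially. W k < y" by eventually_elim (rule le_less_trans[OF Wle])
    next
      fix y assume y: "y < ?D\<^sup>2"
      define h where "h = (?D\<^sup>2 - y) / 2"
      have h: "0 < h" using y by (simp add: h_def)
      have "\<forall>\<^sub>F k in sequentially. e2 k < h" by (rule order_tendstoD(2)[OF e2 h])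
      with low[OF h] show "\<forall>\<^sub>F k in sequentially. y < W k"
      proof eventually_elim
        case (elim k)
        have "(W2 X (\<eta> k 0) (\<eta> k 1))\<^sup>2 \<le> W k + e2 k" using \<eta>W[of 0 1 k] by simp
        moreover have "?D\<^sup>2 - h = y + h" by (simp add: h_def field_simps)
        ultimately show ?case using elim by linarith
      qed
    qed

    \<comment> \<open>The limit geodesic and the inequality along it\<close>
    obtain \<mu> where \<mu>: "wasserstein_geodesic X \<mu>0 \<mu>1 \<mu>"
      "\<forall>t\<in>{0..1}. \<exists>r. strict_mono r \<and> weak_star_conv X (\<lambda>k. \<eta> (r k) t) (\<mu> t)"
      by (rule limit_geodesic[OF X \<eta>P \<mu>01 w0 w1 \<eta>W Wlim e2])
    have "?ineq \<mu> U t" if UF: "U \<in> F" and t: "t \<in> {0..1}" for U t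
    proof -
      note U = adm[OF UF]
      have n0: "U_functional U \<nu> \<mu>0 \<noteq> -\<infinity>" and n1: "U_functional U \<nu> \<mu>1 \<noteq> -\<infinity>"
        using U_functional_not_MInf[OF U _ \<nu>] \<mu>01 by auto
      \<comment> \<open>At the endpoints the factors 0 suppress possible infinite values and
        equality holds. For 0 < t < 1 an infinite functional or \<lambda> U = -\<infinity> makes the
        right-hand side \<infinity>.\<close>
      consider "t = 0" | "t = 1" | "0 < t" "t < 1" using t by fastforce
      then show ?thesis
      proof cases
        case 1
        then show ?thesis using \<mu>(1) by (simp add: wasserstein_geodesic_def flip: zero_ereal_def one_ereal_def)
      next
        case 2
        then show ?thesis using \<mu>(1) by (simp add: wasserstein_geodesic_def flip: zero_ereal_def one_ereal_def)
      next
        case 3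
        have tt: "0 < t * (1 - t)" using 3 by simp
        show ?thesis
        proof (cases "U_functional U \<nu> \<mu>0 = \<infinity> \<or> U_functional U \<nu> \<mu>1 = \<infinity> \<or> lam U = -\<infinity>")
          case True
          have "ereal t * U_functional U \<nu> \<mu>1 \<noteq> -\<infinity>" "ereal (1 - t) * U_functional U \<nu> \<mu>0 \<noteq> -\<infinity>"
            using n0 n1 3 by (cases "U_functional U \<nu> \<mu>0"; cases "U_functional U \<nu> \<mu>1"; simp)+
          then have "ereal t * U_functional U \<nu> \<mu>1 + ereal (1 - t) * U_functional U \<nu> \<mu>0
              - ereal (1 / 2) * lam U * ereal (t * (1 - t)) * ereal (?D\<^sup>2) = \<infinity>"
            using True n0 n1 3 tt Dpos assms(5)[OF UF]
            by (cases "U_functional U \<nu> \<mu>0"; cases "U_functional U \<nu> \<mu>1"; cases "lam U") auto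
          then show ?thesis by simp
        next
          case False
          obtain u0 u1 l where u: "U_functional U \<nu> \<mu>0 = ereal u0" "U_functional U \<nu> \<mu>1 = ereal u1" "lam U = ereal l"
            using False n0 n1 assms(5)[OF UF]
            by (cases "U_functional U \<nu> \<mu>0"; cases "U_functional U \<nu> \<mu>1"; cases "lam U") auto
          obtain B where B: "0 \<le> B" "\<And>s. 0 \<le> s \<Longrightarrow> s \<le> 2 \<Longrightarrow> U s \<le> B" by (rule admissible_bounded[OF U]) blast
          \<comment> \<open>The intermediate sum \<open>S\<close> is replaced by the finite value
            \<open>v\<close> above it; this uses that \<theta> is nonnegative.\<close>
          have up: "U_functional U (\<nu>s (I k)) (transplant (J k) (\<phi> k) (f (I k)) (\<nu>s (I k)) (T.weight k \<kappa>)) \<le> ereal (\<theta> k * v + \<delta> k * B)"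
            if dom: "T.dominated k \<kappa>" and v: "U_functional U \<nu> \<kappa> = ereal v" for k \<kappa> v
          proof -
            obtain S where S: "ereal S \<le> U_functional U \<nu> \<kappa>"
              "U_functional U (\<nu>s (I k)) (transplant (J k) (\<phi> k) (f (I k)) (\<nu>s (I k)) (T.weight k \<kappa>)) \<le> ereal (\<theta> k * S + (1 - \<theta> k) * B)"
              by (rule T.moved_U_functional[OF U dom B(2,1)])
            have "\<theta> k * S + (1 - \<theta> k) * B \<le> \<theta> k * v + \<delta> k * B"
              using S(1) v mult_left_mono[of S v "\<theta> k"] \<theta>(1)[of k] by (simp add: \<theta>_def)
            then show ?thesis by (intro order_trans[OF S(2)]) simp
          qed
          define c where "c k = t * (\<theta> k * u1 + \<delta> k * B) + (1 - t) * (\<theta> k * u0 + \<delta> k * B) - 1 / 2 * l * (t * (1 - t)) * W k" for k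
          have cle: "U_functional U (\<nu>s (I k)) (\<gamma> k t) \<le> ereal (c k)" for k
          proof -
            have "U_functional U (\<nu>s (I k)) (\<gamma> k t) \<le> ereal t * U_functional U (\<nu>s (I k)) (b k) + ereal (1 - t) * U_functional U (\<nu>s (I k)) (a k)
                - ereal (1 / 2) * lam U * ereal (t * (1 - t)) * ereal (W k)" by (rule \<gamma>U[OF UF t])
            also have "\<dots> \<le> ereal t * ereal (\<theta> k * u1 + \<delta> k * B) + ereal (1 - t) * ereal (\<theta> k * u0 + \<delta> k * B)
                - ereal (1 / 2) * lam U * ereal (t * (1 - t)) * ereal (W k)"
              unfolding a_def b_def using 3 up[OF dom0 u(1), of k] up[OF dom1 u(2), of k]
              by (intro ereal_minus_mono[OF add_mono[OF ereal_mult_left_mono ereal_mult_left_mono] order_refl]) auto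
            also have "\<dots> = ereal (c k)" by (simp add: c_def u)
            finally show ?thesis .
          qed
          have "\<theta> \<longlonglongrightarrow> 1 - 0" unfolding \<theta>_def by (intro tendsto_intros \<delta>0)
          then have \<theta>1: "\<theta> \<longlonglongrightarrow> 1" by simp
          have "c \<longlonglongrightarrow> t * (1 * u1 + 0 * B) + (1 - t) * (1 * u0 + 0 * B) - 1 / 2 * l * (t * (1 - t)) * ?D\<^sup>2"
            unfolding c_def by (intro tendsto_intros \<theta>1 \<delta>0 Wlim)
          then have clim: "c \<longlonglongrightarrow> t * u1 + (1 - t) * u0 - 1 / 2 * l * (t * (1 - t)) * ?D\<^sup>2" by simp
          obtain r where r: "strict_mono r" "weak_star_conv X (\<lambda>k. \<eta> (r k) t) (\<mu> t)" using \<mu>(2) t by blast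
          \<comment> \<open>The indices \<open>I (r k)\<close> tend to infinity but need not be
            strictly increasing, so convergence is transferred along a filter limit instead of a
            subsequence.\<close>
          have Ir: "filterlim (\<lambda>k. I (r k)) sequentially sequentially"
            using I(1) seq_suble[OF r(1)] by (intro filterlim_at_top_mono[OF filterlim_ident] always_eventually) (auto intro: order_trans)
          have "U_functional U \<nu> (\<mu> t) \<le> ereal (t * u1 + (1 - t) * u0 - 1 / 2 * l * (t * (1 - t)) * ?D\<^sup>2)"
          proof (rule U_functional_lower_semicontinuous[OF X U _ \<nu>, where Y="\<lambda>k. Xs (I (r k))" and f="\<lambda>k. f (I (r k))"
                and \<kappa>="\<lambda>k. \<gamma> (r k) t" and \<nu>'="\<lambda>k. \<nu>s (I (r k))" and c="\<lambda>k. c (r k)"])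
            show "\<mu> t \<in> P2 X" using \<mu>(1) t by (simp add: wasserstein_geodesic_def)
            show "weak_star_conv X (\<lambda>k. distr (\<gamma> (r k) t) (borel_of X) (f (I (r k)))) (\<mu> t)" using r(2) by (simp add: \<eta>_def)
            show "weak_star_conv X (\<lambda>k. distr (\<nu>s (I (r k))) (borel_of X) (f (I (r k)))) \<nu>"
              unfolding weak_star_conv_def
            proof (intro allI impI)
              fix g assume "contr X g"
              then have "(\<lambda>i. \<integral>x. g x \<partial>distr (\<nu>s i) (borel_of X) (f i)) \<longlonglongrightarrow> (\<integral>x. g x \<partial>\<nu>)"
                using wk unfolding weak_star_conv_def by blast
              from filterlim_compose[OF this Ir]
              show "(\<lambda>k. \<integral>x. g x \<partial>distr (\<nu>s (I (r k))) (borel_of X) (f (I (r k)))) \<longlonglongrightarrow> (\<integral>x. g x \<partial>\<nu>)" .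
            qed
            show "(\<lambda>k. c (r k)) \<longlonglongrightarrow> t * u1 + (1 - t) * u0 - 1 / 2 * l * (t * (1 - t)) * ?D\<^sup>2"
              using LIMSEQ_subseq_LIMSEQ[OF clim r(1)] by (simp add: o_def)
          qed (use fm \<gamma>P[OF t] \<nu>s cle in auto)
          then show ?thesis by (simp add: u)
        qed
      qed
    qed
    then show ?thesis using \<mu>(1) by blast
  qed
qed

end
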